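(* Let $X_n$ be the protection number of a random P\'olya tree of size $n$. Let $T(z)$ be the generating function of P\'olya trees, $\rho$ its dominant singularity, and for $k\ge 0$ let $T_k(z)$ be the generating function of P\'olya trees with protection number at least $k$. Then $$\lim_{n\to\infty}\mathbb{E}X_n=\sum_{k\ge 1}\prod_{i=1}^{k}\left(T_i(\rho)+\rho\right)\approx 2.154889671973873,$$ and $$\lim_{n\to\infty}\mathbb{V}X_n\approx 1.369993017502652 .$$
   Context: A P\'olya tree is an unlabelled non-plane rooted tree (an isomorphism class of finite rooted trees); its size is its number of vertices. A random P\'olya tree of size $n$ is chosen uniformly among all P\'olya trees with $n$ vertices. The protection number of a rooted tree is the length (number of edges) of the shortest path from the root to a leaf; a single vertex is a leaf and has protection number $0$. The generating function $T(z)$ of P\'olya trees (counted by number of vertices) satisfies $T(z)=z\,e^{T(z)}\exp\left(\sum_{i\ge 2}\frac{T(z^i)}{i}\right)$. The generating functions $T_k(z)$ satisfy $T_0(z)=T(z)$ and $$T_k(z)=z\,e^{T_{k-1}(z)}\exp\left(\sum_{i\ge 2}\frac{T_{k-1}(z^i)}{i}\right)-z,\qquad k\ge 1 .$$ The dominant singularity $\rho\approx 0.3383218568992$ is the (positive) radius of convergence of $T(z)$, and $T(\rho)=1$. $\mathbb{E}$ and $\mathbb{V}$ denote expectation and variance. The symbol $\approx$ indicates a numerical decimal approximation of the limit. *)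

theory Defs
  imports "HOL-Probability.Probability" "HOL-Library.Multiset"
begin

(* An isomorphism class of finite rooted trees is determined by the multiset of the
   isomorphism classes of the subtrees rooted at the children of the root, so the type below
   has exactly one value per unlabelled non-plane rooted tree. *)
datatype polya_tree = Node "polya_tree multiset"

primrec num_vertices :: "polya_tree \<Rightarrow> nat" where
  "num_vertices (Node M) = Suc (\<Sum>\<^sub># (image_mset num_vertices M))"

(* "leaf_at_depth t d": some path of d edges leads from the root of t down to a leaf,
   i.e. to a vertex without children. *)
inductive leaf_at_depth :: "polya_tree \<Rightarrow> nat \<Rightarrow> bool" where
  leaf: "leaf_at_depth (Node {#}) 0"
| child: "t \<in># M \<Longrightarrow> leaf_at_depth t d \<Longrightarrow> leaf_at_depth (Node M) (Suc d)"

definition protection_number :: "polya_tree \<Rightarrow> nat" where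
  "protection_number t = (LEAST d. leaf_at_depth t d)"

definition polya_trees :: "nat \<Rightarrow> polya_tree set" where
  "polya_trees n = {t. num_vertices t = n}"

(* Finite and nonempty for n \<ge> 1 (shown below), so this is the uniform distribution;
   the value at n = 0 is unspecified. *)
definition random_polya_tree :: "nat \<Rightarrow> polya_tree pmf" where
  "random_polya_tree n = pmf_of_set (polya_trees n)"

definition T_gf :: "real fps" where
  "T_gf = Abs_fps (\<lambda>n. real (card (polya_trees n)))"

definition Tk_gf :: "nat \<Rightarrow> real fps" where
  "Tk_gf k = Abs_fps (\<lambda>n. real (card {t \<in> polya_trees n. protection_number t \<ge> k}))"

(* Radius of convergence of T; since the coefficients are nonnegative, the positive real point
   of this modulus is the dominant singularity. *)
definition rho :: real where
  "rho = real_of_ereal (fps_conv_radius T_gf)"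

lemma ex_leaf_at_depth: "\<exists>d. leaf_at_depth t d"
proof (induction t)
  case (Node M)
  show ?case
  proof (cases "M = {#}")
    case True
    then show ?thesis by (auto intro: leaf_at_depth.intros)
  next
    case False
    then obtain t where "t \<in># M" by auto
    with Node show ?thesis by (blast intro: leaf_at_depth.intros)
  qed
qed

lemma size_le_num_vertices: "size M < num_vertices (Node M)"
proof -
  have pos: "num_vertices t > 0" for t by (cases t) simp
  have "size M \<le> \<Sum>\<^sub># (image_mset num_vertices M)"
  proof (induction M)
    case (add t M)
    then show ?case using pos[of t] by simp
  qed simp
  then show ?thesis by simp
qed

lemma num_vertices_child: "t \<in># M \<Longrightarrow> num_vertices t < num_vertices (Node M)"
  by (auto dest!: multi_member_split)

lemma finite_polya_trees: "finite (polya_trees n)"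
proof (induction n rule: less_induct)
  case (less n)
  let ?A = "\<Union>m<n. polya_trees m"
  have "finite ?A" using less by simp
  then have "finite (\<Union>k<n. mset ` {xs. set xs \<subseteq> ?A \<and> length xs = k})"
    by (intro finite_UN_I finite_imageI finite_lists_length_eq) auto
  moreover have "polya_trees n \<subseteq> Node ` (\<Union>k<n. mset ` {xs. set xs \<subseteq> ?A \<and> length xs = k})"
  proof
    fix t assume t: "t \<in> polya_trees n"
    obtain M where M: "t = Node M" by (cases t)
    obtain xs where xs: "mset xs = M" using ex_mset by blast
    have "length xs < n"
      using size_le_num_vertices[of M] t M xs by (auto simp: polya_trees_def)
    moreover have "set xs \<subseteq> ?A"
      using num_vertices_child[of _ M] t M xs
      by (auto simp: polya_trees_def simp del: num_vertices.simps)
    ultimately show "t \<in> Node ` (\<Union>k<n. mset ` {xs. set xs \<subseteq> ?A \<and> length xs = k})"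
      using M xs by auto
  qed
  ultimately show ?case by (meson finite_imageI finite_subset)
qed

lemma polya_trees_nonempty: "polya_trees (Suc n) \<noteq> {}"
proof -
  have "Node (replicate_mset n (Node {#})) \<in> polya_trees (Suc n)"
    by (induction n) (auto simp: polya_trees_def)
  then show ?thesis by blast
qed

end

theory Submission
  imports Defs "HOL-Real_Asymp.Real_Asymp" "HOL-Complex_Analysis.Complex_Analysis"
begin

text \<open>
  Let \<open>eul f\<close> denote the series \<open>\<Sum>i\<ge>1. f (z ^ i) / i\<close>. Separating the term with \<open>i = 1\<close> turns
  \<open>T = z * exp (eul T)\<close> into \<open>T = tree_fps \<circ> G\<close>, where \<open>tree_fps = (\<Sum>m\<ge>1. m ^ (m - 1) / m! * x ^ m)\<close> inverts
  \<open>y * exp (-y)\<close> and \<open>G\<close> converges beyond \<open>rho\<close> with \<open>G rho = exp (-1)\<close>. The coefficients of the outer series behave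
  like those of \<open>sqrt (1 - x)\<close>, for which the composition can be computed explicitly: with
  \<open>F z = exp 1 * G (rho * z)\<close>, the quotient \<open>(1 - F) / (1 - z)\<close> has no zero in the closed unit disc and hence a square root
  with exponentially small coefficients. So the coefficients of \<open>T\<close> are of order \<open>rho ^ (-n) * n powr (-3/2)\<close>.

  Sequences of this order are stable under products and exponentials, so the recursion for \<open>T\<^sub>k\<close> gives the limit of
  \<open>P (X\<^sub>n \<ge> k)\<close> by induction on \<open>k\<close>. The same recursion bounds \<open>P (X\<^sub>n \<ge> k)\<close> geometrically in \<open>k\<close>, uniformly
  in \<open>n\<close>, and Tannery's theorem yields the first two moments.

  For the numerical values, \<open>T\<^sub>k (rho ^ j)\<close> is enclosed for all relevant \<open>j\<close> and \<open>k\<close> through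
  \<open>T\<^sub>k\<^sub>+\<^sub>1 x = x * (exp (\<Sum>i\<ge>1. T\<^sub>k (x ^ i) / i) - 1)\<close> in fixed-point arithmetic. All quantities are monotone in each other, so
  lower and upper bounds are computed separately; for \<open>k = 0\<close> a guessed solution is verified.
\<close>

text \<open>The usual transfer of a square-root singularity needs an analytic continuation of
  \<open>T_gf\<close> around \<open>rho\<close>. It is replaced by linearity of
  \<open>a oo F\<close> in \<open>a\<close>: up to a multiple of \<open>sqrt (1 - x)\<close>, the
  tree function has coefficients of order o(n^(-3/2)), and such an error stays negligible under
  composition because the coefficients of \<open>F\<close> form a probability distribution on the
  positive integers with exponential tail. Complex analysis enters only to show that the square root
  of \<open>(1 - F) / (1 - z)\<close> converges beyond the unit disc. Asymptotic constants never
  have to be identified: every limit is a ratio of two coefficients, so only the positivity of the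
  constant for \<open>T_gf\<close> matters. Convergence of P (X_n >= k) for each fixed
  \<open>k\<close> does not yet give convergence of the moments. The geometric bound rests on e^a -
  1 <= a e^a, which makes the recursion linear in \<open>eul (Tk_gf k)\<close>, so that a bound
  relative to \<open>T_gf\<close> shrinks by a constant factor in each step.\<close>

unbundle no vec_syntax
unbundle fps_syntax

section \<open>The generating functions of trees and forests\<close>

text \<open>For \<open>n = i * d\<close> the term \<open>f (z ^ i) / i\<close> contributes
  \<open>f $ d / i = d * f $ d / n\<close> to the coefficient of z^n, hence the sum over divisors.
  At \<open>n = 0\<close> the division by zero makes the coefficient 0 for every
  \<open>f\<close>.\<close>

definition eul :: "real fps \<Rightarrow> real fps" where
  "eul f = Abs_fps (\<lambda>n. \<Sum>d | d dvd n. real d * f $ d / real n)"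

definition class_gf :: "polya_tree set \<Rightarrow> real fps" where
  "class_gf C = Abs_fps (\<lambda>n. real (card (polya_trees n \<inter> C)))"

definition forests :: "polya_tree set \<Rightarrow> nat \<Rightarrow> polya_tree multiset set" where
  "forests C n = {M. set_mset M \<subseteq> C \<and> \<Sum>\<^sub># (image_mset num_vertices M) = n}"

lemma num_vertices_pos [simp]: "num_vertices t > 0"
  by (cases t) simp

lemma polya_trees_0 [simp]: "polya_trees 0 = {}"
  by (auto simp: polya_trees_def)

lemma Node_forests_subset: "Node ` forests C n \<subseteq> polya_trees (Suc n)"
  by (auto simp: forests_def polya_trees_def)

lemma finite_forests [simp]: "finite (forests C n)"
  using finite_subset[OF Node_forests_subset finite_polya_trees]
  by (rule finite_imageD) (simp add: inj_on_def)

lemma forests_0: "forests C 0 = {{#}}"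
proof -
  have "M = {#}" if "\<Sum>\<^sub># (image_mset num_vertices M) = 0" for M
  proof (rule ccontr)
    assume "M \<noteq> {#}"
    then obtain t where "t \<in># M" by auto
    then show False using that num_vertices_pos[of t] by auto
  qed
  then show ?thesis by (auto simp: forests_def)
qed

lemma sum_count_times:
  fixes f :: "'a \<Rightarrow> nat"
  assumes "finite A"
  shows "set_mset M \<subseteq> A \<Longrightarrow> (\<Sum>t\<in>A. count M t * f t) = \<Sum>\<^sub># (image_mset f M)"
proof (induction M)
  case (add x M)
  have "(\<Sum>t\<in>A. count (add_mset x M) t * f t)
      = (\<Sum>t\<in>A. count M t * f t + (if t = x then f x else 0))"
    by (intro sum.cong) auto
  also have "\<dots> = \<Sum>\<^sub># (image_mset f M) + f x"
    using add assms by (simp add: sum.distrib)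
  finally show ?case by simp
qed simp

text \<open>Writing \<open>count M t\<close> as the number of \<open>i\<close> with
  \<open>1 \<le> i \<le> count M t\<close> makes the size a sum over pairs \<open>(t, i)\<close>.
  The ranges do not depend on \<open>M\<close>, so this sum can be exchanged with one over
  \<open>M\<close>.\<close>

lemma sum_mset_num_vertices_eq:
  assumes "M \<in> forests C n"
  shows "n = (\<Sum>t\<in>(\<Union>d\<le>n. polya_trees d \<inter> C). \<Sum>i=1..n.
              (if i \<le> count M t then num_vertices t else 0))"
proof -
  let ?A = "\<Union>d\<le>n. polya_trees d \<inter> C"
  have finA: "finite ?A" by (auto simp: finite_polya_trees)
  have M: "set_mset M \<subseteq> C" "\<Sum>\<^sub># (image_mset num_vertices M) = n"
    using assms by (auto simp: forests_def)
  have sub: "set_mset M \<subseteq> ?A"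
  proof
    fix t assume t: "t \<in># M"
    then have "num_vertices t \<le> n"
      using num_vertices_child[of t M] M(2) by simp
    then show "t \<in> ?A" using t M(1) by (auto simp: polya_trees_def)
  qed
  have cnt: "count M t \<le> n" for t
    using size_le_num_vertices[of M] M(2) count_le_size[of M t] by simp
  have inner: "(\<Sum>i=1..n. (if i \<le> count M t then num_vertices t else 0))
      = count M t * num_vertices t" for t
  proof -
    have "(\<Sum>i=1..n. (if i \<le> count M t then num_vertices t else 0))
      = (\<Sum>i\<in>{1..n} \<inter> {i. i \<le> count M t}. num_vertices t)"
      by (subst sum.inter_restrict) auto
    also have "{1..n} \<inter> {i. i \<le> count M t} = {1..count M t}"
      using cnt[of t] by auto
    finally show ?thesis by simp
  qed
  have "n = (\<Sum>t\<in>?A. count M t * num_vertices t)"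
    using sum_count_times[OF finA sub] M(2) by simp
  then show ?thesis unfolding inner .
qed

text \<open>Removing \<open>i\<close> copies of \<open>t\<close> is a bijection onto the forests of
  the remaining size. The case distinction guards against truncated subtraction.\<close>

lemma card_forests_count_ge:
  assumes "t \<in> C"
  shows "card {M \<in> forests C n. i \<le> count M t} =
    (if i * num_vertices t \<le> n then card (forests C (n - i * num_vertices t)) else 0)"
proof (cases "i * num_vertices t \<le> n")
  case True
  have "bij_betw (\<lambda>M. M + replicate_mset i t) (forests C (n - i * num_vertices t))
      {M \<in> forests C n. i \<le> count M t}"
  proof (rule bij_betwI[where g = "\<lambda>M. M - replicate_mset i t"])
    show "(\<lambda>M. M + replicate_mset i t) \<in> forests C (n - i * num_vertices t) \<rightarrow>
        {M \<in> forests C n. i \<le> count M t}"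
      using assms True by (auto simp: forests_def split: if_splits)
    show "(\<lambda>M. M - replicate_mset i t) \<in> {M \<in> forests C n. i \<le> count M t} \<rightarrow>
        forests C (n - i * num_vertices t)"
    proof
      fix M assume M: "M \<in> {M \<in> forests C n. i \<le> count M t}"
      then obtain N where "M = replicate_mset i t + N"
        by (metis (mono_tags, lifting) count_le_replicate_mset_subset_eq mem_Collect_eq mset_subset_eq_exists_conv)
      then show "M - replicate_mset i t \<in> forests C (n - i * num_vertices t)"
        using M by (auto simp: forests_def)
    qed
  qed (auto simp: count_le_replicate_mset_subset_eq)
  then show ?thesis using True by (simp add: bij_betw_same_card)
next
  case False
  have "i * num_vertices t \<le> n" if M: "M \<in> forests C n" "i \<le> count M t" for M
  proof -
    obtain N where "M = replicate_mset i t + N" using M(2)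
      by (metis count_le_replicate_mset_subset_eq mset_subset_eq_exists_conv)
    then show ?thesis using M(1) by (auto simp: forests_def)
  qed
  then have "{M \<in> forests C n. i \<le> count M t} = {}" using False by auto
  then show ?thesis using False by (simp only: card.empty if_False)
qed

text \<open>Double counting of the vertices of all forests of size \<open>n\<close>, with the pairs
  \<open>(t, i)\<close> grouped by \<open>j = i * num_vertices t\<close>. This is the coefficient
  form of \<open>P' = P * A'\<close> for the forest series \<open>P\<close> and
  \<open>A = eul (class_gf C)\<close>.\<close>

lemma card_forests_rec:
  "n * card (forests C n) =
     (\<Sum>j=1..n. (\<Sum>d | d dvd j. d * card (polya_trees d \<inter> C)) * card (forests C (n - j)))"
proof -
  let ?A = "\<Union>d\<le>n. polya_trees d \<inter> C"
  \<comment> \<open>For \<open>j > n\<close> the truncated difference \<open>n - j\<close> would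
    count the empty forest, so \<open>h\<close> is 0 there.\<close>
  define h where "h j = (if j \<le> n then card (forests C (n - j)) else 0)" for j
  have finA: "finite ?A" by (auto simp: finite_polya_trees)
  have "n * card (forests C n) = (\<Sum>M\<in>forests C n. n)" by simp
  also have "\<dots> = (\<Sum>M\<in>forests C n. \<Sum>t\<in>?A. \<Sum>i=1..n. (if i \<le> count M t then num_vertices t else 0))"
    by (rule sum.cong[OF refl], rule sum_mset_num_vertices_eq)
  also have "\<dots> = (\<Sum>t\<in>?A. \<Sum>i=1..n. \<Sum>M\<in>forests C n. (if i \<le> count M t then num_vertices t else 0))"
    by (subst sum.swap, rule sum.cong[OF refl], rule sum.swap)
  also have "\<dots> = (\<Sum>t\<in>?A. \<Sum>i=1..n. num_vertices t * h (i * num_vertices t))"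
  proof (intro sum.cong refl)
    fix t i assume "t \<in> ?A"
    then have t: "t \<in> C" by auto
    have "(\<Sum>M\<in>forests C n. (if i \<le> count M t then num_vertices t else 0))
       = (\<Sum>M | M \<in> forests C n \<and> i \<le> count M t. num_vertices t)"
      by (rule sum.inter_filter[symmetric]) simp
    then show "(\<Sum>M\<in>forests C n. (if i \<le> count M t then num_vertices t else 0))
       = num_vertices t * h (i * num_vertices t)"
      using card_forests_count_ge[OF t, of n i] by (simp add: h_def)
  qed
  also have "\<dots> = (\<Sum>d\<le>n. \<Sum>t\<in>polya_trees d \<inter> C. \<Sum>i=1..n. num_vertices t * h (i * num_vertices t))"
    by (rule sum.UNION_disjoint) (auto simp: finite_polya_trees, auto simp: polya_trees_def)
  also have "\<dots> = (\<Sum>d\<le>n. \<Sum>t\<in>polya_trees d \<inter> C. \<Sum>i=1..n. d * h (i * d))"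
    by (intro sum.cong refl) (auto simp: polya_trees_def)
  also have "\<dots> = (\<Sum>d=1..n. \<Sum>i=1..n. (d * card (polya_trees d \<inter> C)) * h (i * d))"
    by (rule sum.mono_neutral_cong_right) (auto simp: sum_distrib_left mult_ac not_le less_Suc_eq)
  also have "\<dots> = (\<Sum>(d, i)\<in>{1..n} \<times> {1..n}. (d * card (polya_trees d \<inter> C)) * h (i * d))"
    by (simp add: sum.cartesian_product)
  also have "\<dots> = (\<Sum>(d, i)\<in>{(d, i). 1 \<le> d \<and> 1 \<le> i \<and> i * d \<le> n}. (d * card (polya_trees d \<inter> C)) * h (i * d))"
  proof (rule sum.mono_neutral_right)
    show "{(d, i). 1 \<le> d \<and> 1 \<le> i \<and> i * d \<le> n} \<subseteq> {1..n} \<times> {1..n}"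
    proof clarsimp
      fix d i :: nat assume *: "Suc 0 \<le> d" "Suc 0 \<le> i" "i * d \<le> n"
      have "1 * d \<le> i * d" "i * 1 \<le> i * d" using * by (intro mult_le_mono; simp)+
      then show "d \<le> n \<and> i \<le> n" using *(3) by linarith
    qed
  qed (auto simp: h_def split: if_splits)
  also have "\<dots> = (\<Sum>(j, d)\<in>(SIGMA j:{1..n}. {d. d dvd j}). (d * card (polya_trees d \<inter> C)) * h j)"
  proof (rule sum.reindex_bij_witness[where i = "\<lambda>(j, d). (d, j div d)" and j = "\<lambda>(d, i). (i * d, d)"])
    fix b assume "b \<in> (SIGMA j:{1..n}. {d. d dvd j})"
    then obtain j d where b: "b = (j, d)" "1 \<le> j" "j \<le> n" "d dvd j" by auto
    then have "d > 0" by (intro Nat.gr0I) simp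
    moreover have "j div d > 0" using b \<open>d > 0\<close> by (auto elim!: dvdE)
    ultimately show "(case b of (j, d) \<Rightarrow> (d, j div d)) \<in> {(d, i). 1 \<le> d \<and> 1 \<le> i \<and> i * d \<le> n}"
      using b by (simp add: Suc_le_eq)
  qed (auto simp: Suc_le_eq)
  also have "\<dots> = (\<Sum>j=1..n. \<Sum>d | d dvd j. (d * card (polya_trees d \<inter> C)) * h j)"
    by (rule sum.Sigma[symmetric]) auto
  also have "\<dots> = (\<Sum>j=1..n. (\<Sum>d | d dvd j. d * card (polya_trees d \<inter> C)) * card (forests C (n - j)))"
    by (intro sum.cong refl) (simp add: h_def sum_distrib_right)
  finally show ?thesis .
qed

text \<open>Coefficient \<open>m + 1\<close> of a solution is determined by the coefficients up to
  \<open>m\<close>. This uniqueness takes the place of logarithms of power series.\<close>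

lemma fps_deriv_eq_mult_unique:
  fixes P Q D :: "real fps"
  assumes P: "fps_deriv P = P * D" and Q: "fps_deriv Q = Q * D"
    and 0: "P $ 0 = Q $ 0"
  shows "P = Q"
proof (rule fps_ext)
  fix n show "P $ n = Q $ n"
  proof (induction n rule: less_induct)
    case (less n)
    show ?case
    proof (cases n)
      case (Suc m)
      have "of_nat (Suc m) * P $ (Suc m) = (P * D) $ m"
        using P by (metis fps_deriv_nth Suc_eq_plus1)
      also have "\<dots> = (Q * D) $ m"
        unfolding fps_mult_nth using less Suc by (intro sum.cong refl) auto
      also have "\<dots> = of_nat (Suc m) * Q $ (Suc m)"
        using Q by (metis fps_deriv_nth Suc_eq_plus1)
      finally show ?thesis using Suc by (simp del: of_nat_Suc)
    qed (use 0 in simp)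
  qed
qed

lemma eul_nth_0 [simp]: "(eul f) $ 0 = 0"
  by (simp add: eul_def)

lemma fps_deriv_exp_compose:
  fixes a :: "real fps"
  assumes "a $ 0 = 0"
  shows "fps_deriv (fps_exp 1 oo a) = (fps_exp 1 oo a) * fps_deriv a"
  using fps_compose_deriv[OF assms, of "fps_exp 1"] by simp

text \<open>Polya's exponential formula for multisets. Both sides solve the same linear differential
  equation with constant coefficient 1, which avoids infinite products.\<close>

theorem forests_gf:
  "Abs_fps (\<lambda>n. real (card (forests C n))) = fps_exp 1 oo eul (class_gf C)"
proof (rule fps_deriv_eq_mult_unique)
  let ?M = "Abs_fps (\<lambda>n. real (card (forests C n)))" and ?A = "eul (class_gf C)"
  show "fps_deriv ?M = ?M * fps_deriv ?A"
  proof (rule fps_ext)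
    fix n
    define s where "s j = (\<Sum>d | d dvd j. d * card (polya_trees d \<inter> C))" for j
    have s: "(fps_deriv ?A) $ j = real (s (Suc j))" for j
      by (simp add: eul_def class_gf_def s_def flip: sum_divide_distrib)
    have "(fps_deriv ?M) $ n = real (Suc n * card (forests C (Suc n)))"
      by (simp add: algebra_simps)
    also have "\<dots> = (\<Sum>j=1..Suc n. real (s j) * real (card (forests C (Suc n - j))))"
      by (subst card_forests_rec) (simp add: s_def)
    also have "\<dots> = (\<Sum>i=0..n. real (card (forests C i)) * real (s (Suc (n - i))))"
      by (rule sum.reindex_bij_witness[where i = "\<lambda>i. Suc n - i" and j = "\<lambda>i. Suc n - i"])
         (auto simp: Suc_diff_le)
    also have "\<dots> = (?M * fps_deriv ?A) $ n"
      by (simp add: fps_mult_nth s del: fps_deriv_nth)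
    finally show "(fps_deriv ?M) $ n = (?M * fps_deriv ?A) $ n" .
  qed
qed (auto simp: fps_deriv_exp_compose forests_0)

lemma T_gf_eq_class_gf: "T_gf = class_gf UNIV"
  by (simp add: T_gf_def class_gf_def)

lemma Tk_gf_eq_class_gf: "Tk_gf k = class_gf {t. k \<le> protection_number t}"
  by (rule fps_ext) (simp add: Tk_gf_def class_gf_def Collect_conj_eq)

lemma Tk_gf_0 [simp]: "Tk_gf 0 = T_gf"
  by (simp add: Tk_gf_eq_class_gf T_gf_eq_class_gf)

lemma le_protection_number_iff:
  "k \<le> protection_number t \<longleftrightarrow> (\<forall>d. leaf_at_depth t d \<longrightarrow> k \<le> d)"
proof
  show "\<forall>d. leaf_at_depth t d \<longrightarrow> k \<le> d" if "k \<le> protection_number t"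
    using that Least_le[of "leaf_at_depth t"] unfolding protection_number_def by fastforce
  show "k \<le> protection_number t" if "\<forall>d. leaf_at_depth t d \<longrightarrow> k \<le> d"
    using that LeastI_ex[OF ex_leaf_at_depth[of t]] unfolding protection_number_def by blast
qed

lemma Suc_le_protection_number_iff:
  "Suc k \<le> protection_number (Node M) \<longleftrightarrow> M \<noteq> {#} \<and> (\<forall>t\<in>#M. k \<le> protection_number t)"
proof
  assume L: "Suc k \<le> protection_number (Node M)"
  have "M \<noteq> {#}" using L leaf_at_depth.leaf by (auto simp: le_protection_number_iff)
  moreover have "k \<le> protection_number t" if "t \<in># M" for t
    using L that unfolding le_protection_number_iff by (blast dest: leaf_at_depth.child)
  ultimately show "M \<noteq> {#} \<and> (\<forall>t\<in>#M. k \<le> protection_number t)" by blast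
next
  assume R: "M \<noteq> {#} \<and> (\<forall>t\<in>#M. k \<le> protection_number t)"
  show "Suc k \<le> protection_number (Node M)"
    unfolding le_protection_number_iff
  proof (intro allI impI)
    fix d assume "leaf_at_depth (Node M) d"
    then show "Suc k \<le> d" using R
      by cases (auto simp: le_protection_number_iff)
  qed
qed

text \<open>It confines \<open>k\<close> to \<open>k < n\<close> for trees with \<open>n\<close>
  vertices: \<open>Tk_gf k\<close> starts after index \<open>k\<close>, and the sums over
  \<open>k\<close> at a fixed \<open>n\<close> are finite.\<close>

lemma protection_number_less: "protection_number t < num_vertices t"
proof (induction t)
  case (Node M)
  show ?case
  proof (cases "protection_number (Node M)")
    case (Suc k)
    then have M: "M \<noteq> {#}" "\<forall>t\<in>#M. k \<le> protection_number t"
      using Suc_le_protection_number_iff[of k M] by auto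
    then obtain t where t: "t \<in># M" by auto
    with M have "k < num_vertices t" using Node by fastforce
    then show ?thesis using num_vertices_child[OF t] Suc by simp
  qed simp
qed

lemma T_gf_rec: "T_gf = fps_X * (fps_exp 1 oo eul T_gf)"
proof (rule fps_ext)
  fix n show "T_gf $ n = (fps_X * (fps_exp 1 oo eul T_gf)) $ n"
  proof (cases n)
    case (Suc m)
    have "polya_trees n = Node ` forests UNIV m"
    proof (intro equalityI subsetI)
      fix t assume "t \<in> polya_trees n"
      then show "t \<in> Node ` forests UNIV m"
        by (cases t) (auto simp: forests_def polya_trees_def Suc)
    qed (auto simp: forests_def polya_trees_def Suc)
    then have "card (polya_trees n) = card (forests UNIV m)"
      by (simp add: card_image inj_on_def)
    then have "(class_gf UNIV) $ n = (fps_X * (fps_exp 1 oo eul (class_gf UNIV))) $ n"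
      unfolding forests_gf[symmetric] by (simp add: Suc class_gf_def)
    then show ?thesis by (simp add: T_gf_eq_class_gf)
  qed (simp add: T_gf_def)
qed

text \<open>By \<open>Suc_le_protection_number_iff\<close> the children of the root form a nonempty
  forest of trees with protection number at least \<open>k\<close>; the subtracted 1 removes the
  empty forest, that is, the single vertex.\<close>

lemma Tk_gf_Suc: "Tk_gf (Suc k) = fps_X * ((fps_exp 1 oo eul (Tk_gf k)) - 1)"
proof (rule fps_ext)
  fix n show "(Tk_gf (Suc k)) $ n = (fps_X * ((fps_exp 1 oo eul (Tk_gf k)) - 1)) $ n"
  proof (cases n)
    case (Suc m)
    let ?C = "{t. k \<le> protection_number t}"
    have "{t \<in> polya_trees n. Suc k \<le> protection_number t} = Node ` (forests ?C m - {{#}})"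
    proof (intro equalityI subsetI)
      fix t assume t: "t \<in> {t \<in> polya_trees n. Suc k \<le> protection_number t}"
      then show "t \<in> Node ` (forests ?C m - {{#}})"
        by (cases t) (auto simp: Suc_le_protection_number_iff forests_def polya_trees_def Suc)
    qed (auto simp: Suc_le_protection_number_iff forests_def polya_trees_def Suc)
    then have "card {t \<in> polya_trees n. Suc k \<le> protection_number t} = card (forests ?C m - {{#}})"
      by (simp add: card_image inj_on_def)
    also have "real \<dots> = real (card (forests ?C m)) - (if m = 0 then 1 else 0)"
    proof (cases "m = 0")
      case False
      then have "{#} \<notin> forests ?C m" by (simp add: forests_def)
      then show ?thesis using False by simp
    qed (simp add: forests_0)
    finally show ?thesis
      unfolding Tk_gf_eq_class_gf[of k] forests_gf[symmetric] by (simp add: Tk_gf_def Suc)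
  qed (simp add: Tk_gf_def)
qed

lemma Tk_gf_nth_eq_0: "n \<le> k \<Longrightarrow> (Tk_gf k) $ n = 0"
proof -
  assume n: "n \<le> k"
  have "\<not> k \<le> protection_number t" if "t \<in> polya_trees n" for t
    using protection_number_less[of t] that n by (simp add: polya_trees_def)
  then have e: "{t \<in> polya_trees n. k \<le> protection_number t} = {}" by blast
  show ?thesis unfolding Tk_gf_def fps_nth_Abs_fps e by simp
qed

lemma Tk_gf_nth_nonneg: "(Tk_gf k) $ n \<ge> 0"
  by (simp add: Tk_gf_def)

lemma Tk_gf_antimono: "k \<le> l \<Longrightarrow> (Tk_gf l) $ n \<le> (Tk_gf k) $ n"
proof -
  assume "k \<le> l"
  then have "{t \<in> polya_trees n. l \<le> protection_number t} \<subseteq> {t \<in> polya_trees n. k \<le> protection_number t}"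
    by auto
  then have "card {t \<in> polya_trees n. l \<le> protection_number t} \<le> card {t \<in> polya_trees n. k \<le> protection_number t}"
    by (rule card_mono[rotated]) (simp add: finite_polya_trees)
  then show ?thesis by (simp add: Tk_gf_def)
qed

lemma T_gf_nth_ge_1: "n > 0 \<Longrightarrow> T_gf $ n \<ge> 1"
  using polya_trees_nonempty[of "n - 1"] finite_polya_trees[of n]
  by (simp add: T_gf_def Suc_le_eq card_gt_0_iff)

section \<open>Values of power series with nonnegative coefficients\<close>

text \<open>Convergence and value in one relation. Nonnegative coefficients justify the
  rearrangements below without a margin inside the disc of convergence, which is essential at the
  boundary point \<open>rho\<close>.\<close>

abbreviation fsums :: "real fps \<Rightarrow> real \<Rightarrow> real \<Rightarrow> bool" where
  "fsums f x y \<equiv> (\<lambda>n. f $ n * x ^ n) sums y"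

abbreviation fsummable :: "real fps \<Rightarrow> real \<Rightarrow> bool" where
  "fsummable f x \<equiv> summable (\<lambda>n. f $ n * x ^ n)"

abbreviation fps_nonneg :: "real fps \<Rightarrow> bool" where
  "fps_nonneg f \<equiv> \<forall>n. 0 \<le> f $ n"

lemma fps_nonneg_mult: "fps_nonneg f \<Longrightarrow> fps_nonneg g \<Longrightarrow> fps_nonneg (f * g)"
  by (auto simp: fps_mult_nth intro!: sum_nonneg)

lemma fps_nonneg_power: "fps_nonneg f \<Longrightarrow> fps_nonneg (f ^ m)"
  by (induction m) (use fps_nonneg_mult in auto)

lemma fps_nonneg_compose: "fps_nonneg f \<Longrightarrow> fps_nonneg g \<Longrightarrow> fps_nonneg (g oo f)"
  using fps_nonneg_power[of f] by (auto simp: fps_compose_nth intro!: sum_nonneg)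

lemma fps_nonneg_exp: "fps_nonneg (fps_exp 1)"
  by simp

lemma fps_nonneg_eul: "fps_nonneg f \<Longrightarrow> fps_nonneg (eul f)"
  by (auto simp: eul_def intro!: sum_nonneg)

lemma fps_mult_mono:
  fixes f g f' g' :: "real fps"
  assumes "\<And>n. f $ n \<le> f' $ n" "\<And>n. g $ n \<le> g' $ n"
    and "fps_nonneg f" "fps_nonneg g"
  shows "(f * g) $ n \<le> (f' * g') $ n"
  unfolding fps_mult_nth
  by (intro sum_mono mult_mono) (use assms order_trans in blast)+

lemma eul_mono:
  assumes "\<And>n. f $ n \<le> f' $ n"
  shows "(eul f) $ n \<le> (eul f') $ n"
  unfolding eul_def fps_nth_Abs_fps
  by (intro sum_mono divide_right_mono mult_left_mono) (use assms in auto)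

lemma fsums_nonneg: "fsums f x y \<Longrightarrow> fps_nonneg f \<Longrightarrow> 0 \<le> x \<Longrightarrow> 0 \<le> y"
  by (rule sums_le[OF _ sums_zero]) auto

lemma fsums_mult:
  assumes "fsums f x y" "fsums g x z" "fps_nonneg f" "fps_nonneg g" "0 \<le> x"
  shows "fsums (f * g) x (y * z)"
proof -
  have *: "summable (\<lambda>k. norm (h $ k * x ^ k))" if "fsums h x w" "fps_nonneg h" for h w
    using that assms(5) by (auto simp: sums_iff)
  have "(\<lambda>n. \<Sum>i\<le>n. f $ i * x ^ i * (g $ (n - i) * x ^ (n - i))) sums (y * z)"
    using Cauchy_product_sums[OF * *, OF assms(1,3,2,4)] assms(1,2) by (simp add: sums_iff)
  also have "(\<lambda>n. \<Sum>i\<le>n. f $ i * x ^ i * (g $ (n - i) * x ^ (n - i)))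
      = (\<lambda>n. (f * g) $ n * x ^ n)"
  proof
    fix n
    have "x ^ i * x ^ (n - i) = x ^ n" if "i \<le> n" for i
      using that by (simp flip: power_add)
    then show "(\<Sum>i\<le>n. f $ i * x ^ i * (g $ (n - i) * x ^ (n - i))) = (f * g) $ n * x ^ n"
      unfolding fps_mult_nth sum_distrib_right atLeast0AtMost
      by (intro sum.cong refl) (auto simp: mult_ac)
  qed
  finally show ?thesis .
qed

lemma fsums_power:
  assumes "fsums f x y" "fps_nonneg f" "0 \<le> x"
  shows "fsums (f ^ m) x (y ^ m)"
proof (induction m)
  case 0
  have "(\<lambda>n. 1 $ n * x ^ n) = (\<lambda>n. if n = 0 then 1 else 0)" by auto
  then show ?case using sums_single[of 0 "\<lambda>_. 1 :: real"] by simp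
next
  case (Suc m)
  show ?case unfolding power_Suc
    by (rule fsums_mult) (use assms Suc fps_nonneg_power[OF assms(2)] in auto)
qed

text \<open>The nonnegative double family \<open>g $ m * (f ^ m) $ n * x ^ n\<close> is summed first
  over \<open>n\<close>, giving \<open>g $ m * y ^ m\<close>, and then in the other order.\<close>

lemma fsums_compose:
  assumes f: "fsums f x y" "fps_nonneg f" "f $ 0 = 0" and x: "0 \<le> x"
    and g: "fsums g y z" "fps_nonneg g"
  shows "fsums (g oo f) x z"
proof -
  define a where "a = (\<lambda>(m, n). g $ m * ((f ^ m) $ n * x ^ n))"
  have y: "0 \<le> y" using fsums_nonneg f(1,2) x by blast
  have nn: "a (m, n) \<ge> 0" for m n
    using fps_nonneg_power[OF f(2), of m] g(2) x by (auto simp: a_def)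
  have inner: "((\<lambda>n. a (m, n)) has_sum (g $ m * y ^ m)) UNIV" for m
    unfolding a_def prod.case
    by (intro sums_nonneg_imp_has_sum sums_mult fsums_power f x)
       (use fps_nonneg_power[OF f(2), of m] g(2) x in auto)
  have outer: "((\<lambda>m. g $ m * y ^ m) has_sum z) UNIV"
    by (rule sums_nonneg_imp_has_sum) (use g y in auto)
  have "a summable_on UNIV \<times> UNIV"
    by (rule summable_on_SigmaI[OF inner]) (use outer nn in \<open>auto simp: summable_on_def\<close>)
  then have "(a has_sum z) (UNIV \<times> UNIV)"
    using inner outer by (intro has_sum_SigmaI) auto
  then have sw: "((\<lambda>(n, m). a (m, n)) has_sum z) (UNIV \<times> UNIV)"
    by (rule iffD1[OF has_sum_swap])
  have inner2: "((\<lambda>m. a (m, n)) has_sum ((g oo f) $ n * x ^ n)) UNIV" for n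
  proof -
    have "((\<lambda>m. a (m, n)) has_sum (\<Sum>m\<in>{0..n}. a (m, n))) {0..n}" by simp
    \<comment> \<open>Since \<open>f $ 0 = 0\<close>, the power \<open>f ^ m\<close> has no
      coefficient of index \<open>n < m\<close>.\<close>
    also have "?this \<longleftrightarrow> ((\<lambda>m. a (m, n)) has_sum (\<Sum>m\<in>{0..n}. a (m, n))) UNIV"
      by (rule has_sum_cong_neutral) (auto simp: a_def startsby_zero_power_prefix[OF f(3)])
    also have "(\<Sum>m\<in>{0..n}. a (m, n)) = (g oo f) $ n * x ^ n"
      by (simp add: a_def fps_compose_nth sum_distrib_right mult.assoc)
    finally show ?thesis .
  qed
  have "((\<lambda>n. (g oo f) $ n * x ^ n) has_sum z) UNIV"
    by (rule has_sum_SigmaD[OF sw]) (simp add: inner2)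
  then show ?thesis by (rule has_sum_imp_sums)
qed

lemma fsums_exp: "fsums (fps_exp 1) y (exp y)"
  using exp_converges[of y] by (simp add: divide_inverse mult_ac)

lemma fsums_exp_compose:
  assumes "fsums f x y" "fps_nonneg f" "f $ 0 = 0" "0 \<le> x"
  shows "fsums (fps_exp 1 oo f) x (exp y)"
  by (rule fsums_compose[OF assms fsums_exp fps_nonneg_exp])

lemma fsums_X_mult:
  assumes "fsums f x y"
  shows "fsums (fps_X * f) x (x * y)"
proof -
  have "(\<lambda>n. (fps_X * f) $ (Suc n) * x ^ Suc n) sums (x * y)"
    using sums_mult[OF assms, of x] by (simp add: mult_ac)
  from sums_Suc[OF this] show ?thesis by simp
qed

lemma fsums_le:
  assumes "fsums f x y" "fsums g x z" "\<And>n. f $ n \<le> g $ n" "0 \<le> x"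
  shows "y \<le> z"
  by (rule sums_le[OF _ assms(1,2)]) (use assms in \<open>auto intro: mult_right_mono\<close>)

lemma summable_fps_le:
  fixes f g :: "real fps"
  assumes "fsummable f x" "\<And>n. \<bar>g $ n\<bar> \<le> f $ n" "0 \<le> x"
  shows "fsummable g x"
  by (rule summable_comparison_test'[OF assms(1)]) (use assms in \<open>auto simp: abs_mult intro!: mult_right_mono\<close>)

lemma summable_fps_mono:
  fixes f :: "real fps"
  assumes "fsummable f x" "fps_nonneg f" "0 \<le> w" "w \<le> x"
  shows "fsummable f w"
  by (rule summable_comparison_test'[OF assms(1)])
     (use assms in \<open>auto simp: abs_mult intro!: mult_left_mono power_mono\<close>)

lemma eval_fps_sums:
  fixes f :: "real fps"
  shows "fsummable f x \<Longrightarrow> fsums f x (eval_fps f x)"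
  by (simp add: eval_fps_def summable_sums)

lemma fsums_imp_eval_fps: "fsums f x y \<Longrightarrow> eval_fps f x = y"
  by (simp add: eval_fps_def sums_iff)

lemma eval_fps_nonneg:
  assumes "fsummable f x" "fps_nonneg f" "0 \<le> x"
  shows "0 \<le> eval_fps f x"
  using fsums_nonneg[OF eval_fps_sums[OF assms(1)] assms(2,3)] .

lemma eval_fps_mono:
  assumes "fsummable f x" "fps_nonneg f" "0 \<le> w" "w \<le> x"
  shows "eval_fps f w \<le> eval_fps f x"
  by (rule sums_le[OF _ eval_fps_sums[OF summable_fps_mono[OF assms]] eval_fps_sums[OF assms(1)]])
     (use assms in \<open>auto intro!: mult_left_mono power_mono\<close>)

text \<open>With no coefficient below index \<open>m\<close>, shrinking the argument by
  \<open>u\<close> gains a factor \<open>u ^ m\<close>. The case \<open>m = 1\<close> supplies the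
  geometric majorants for series over the arguments \<open>x ^ i\<close>.\<close>

lemma eval_fps_mult_le:
  assumes "fsummable f x" "fps_nonneg f" "\<And>n. n < m \<Longrightarrow> f $ n = 0"
    "0 \<le> x" "0 \<le> u" "u \<le> 1"
  shows "eval_fps f (x * u) \<le> u ^ m * eval_fps f x"
proof (rule sums_le)
  have "x * u \<le> x" using assms by (simp add: mult_left_le)
  then show "fsums f (x * u) (eval_fps f (x * u))"
    using assms by (intro eval_fps_sums summable_fps_mono[OF assms(1)]) auto
  show "(\<lambda>n. u ^ m * (f $ n * x ^ n)) sums (u ^ m * eval_fps f x)"
    by (intro sums_mult eval_fps_sums assms)
  show "f $ n * (x * u) ^ n \<le> u ^ m * (f $ n * x ^ n)" for n
  proof (cases "n < m")
    case False
    then have "u ^ n \<le> u ^ m" using assms by (intro power_decreasing) auto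
    then have "f $ n * x ^ n * u ^ n \<le> f $ n * x ^ n * u ^ m"
      using assms by (intro mult_left_mono) auto
    then show ?thesis by (simp add: power_mult_distrib mult_ac)
  qed (use assms in auto)
qed

lemma eval_fps_power_le:
  assumes "fsummable f x" "fps_nonneg f" "f $ 0 = 0" "0 \<le> x" "x \<le> 1"
  shows "eval_fps f (x ^ Suc i) \<le> x ^ i * eval_fps f x"
  using eval_fps_mult_le[of f x 1 "x ^ i"] assms by (simp add: power_le_one)

lemma summable_eul_terms:
  assumes "fsummable f x" "fps_nonneg f" "f $ 0 = 0" "0 \<le> x" "x < 1"
  shows "summable (\<lambda>i. eval_fps f (x ^ Suc i) / real (Suc i))"
proof (rule summable_comparison_test')
  show "summable (\<lambda>i. x ^ i * eval_fps f x)"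
    using assms by (intro summable_mult2 summable_geometric) auto
  fix i :: nat assume "0 \<le> i"
  have "x ^ Suc i \<le> x ^ 1" using assms by (intro power_decreasing) auto
  then have s: "fsummable f (x ^ Suc i)"
    using assms by (intro summable_fps_mono[OF assms(1)]) auto
  have "eval_fps f (x ^ Suc i) / real (Suc i) \<le> eval_fps f (x ^ Suc i) / 1"
    using eval_fps_nonneg[OF s] assms by (intro divide_left_mono) auto
  also have "\<dots> \<le> x ^ i * eval_fps f x" using eval_fps_power_le[of f x i] assms by simp
  finally show "norm (eval_fps f (x ^ Suc i) / real (Suc i)) \<le> x ^ i * eval_fps f x"
    using eval_fps_nonneg[OF s] assms by simp
qed

text \<open>The double family \<open>f $ d * x ^ (i * d) / i\<close> is summed over \<open>d\<close>
  and then over \<open>i\<close> on one side, and by the product \<open>n = i * d\<close> on the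
  other.\<close>

lemma fsums_eul:
  assumes f: "fsummable f x" "fps_nonneg f" "f $ 0 = 0"
    and x: "0 \<le> x" "x < 1"
  shows "fsums (eul f) x (\<Sum>i. eval_fps f (x ^ Suc i) / real (Suc i))"
proof -
  let ?z = "\<Sum>i. eval_fps f (x ^ Suc i) / real (Suc i)"
  define a where "a = (\<lambda>(i, d). f $ d * x ^ (i * d) / real i)"
  have summ: "fsummable f (x ^ Suc i)" for i
  proof -
    have "x ^ Suc i \<le> x ^ 1" using x by (intro power_decreasing) auto
    then show ?thesis using assms by (intro summable_fps_mono[OF f(1)]) auto
  qed
  have nn: "a (i, d) \<ge> 0" for i d using f x by (auto simp: a_def)
  have inner: "((\<lambda>d. a (i, d)) has_sum (eval_fps f (x ^ i) / real i)) {1..}" if i1: "i \<in> {1..}" for i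
  proof -
    obtain j where i: "i = Suc j" using i1 by (metis atLeast_iff not_one_le_zero not0_implies_Suc)
    have "((\<lambda>d. f $ d * (x ^ i) ^ d / real i) has_sum (eval_fps f (x ^ i) / real i)) UNIV"
      unfolding i by (intro sums_nonneg_imp_has_sum sums_divide eval_fps_sums summ) (use f x in auto)
    also have "?this \<longleftrightarrow> ((\<lambda>d. a (i, d)) has_sum (eval_fps f (x ^ i) / real i)) {1..}"
      by (rule has_sum_cong_neutral) (auto simp: a_def f not_less_eq_eq power_mult)
    finally show ?thesis .
  qed
  have "((\<lambda>i. eval_fps f (x ^ Suc i) / real (Suc i)) has_sum ?z) UNIV"
    using summable_eul_terms[OF f x] eval_fps_nonneg[OF summ f(2)] x
    by (intro sums_nonneg_imp_has_sum summable_sums) auto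
  moreover have "bij_betw Suc UNIV {1..}"
    by (rule bij_betwI[where g = "\<lambda>n. n - 1"]) auto
  ultimately have outer: "((\<lambda>i. eval_fps f (x ^ i) / real i) has_sum ?z) {1..}"
    using has_sum_reindex_bij_betw[of Suc UNIV "{1..}" "\<lambda>i. eval_fps f (x ^ i) / real i"] by simp
  have "a summable_on {1..} \<times> {1..}"
    by (rule summable_on_SigmaI[OF inner]) (use outer nn in \<open>auto simp: summable_on_def\<close>)
  then have tot: "(a has_sum ?z) ({1..} \<times> {1..})"
    by (intro has_sum_SigmaI[OF inner outer])
  have "bij_betw (\<lambda>(n :: nat, d). (n div d, d)) (SIGMA n:{1..}. {d. d dvd n}) ({1..} \<times> {1..})"
  proof (rule bij_betwI[where g = "\<lambda>(i, d). (i * d, d)"], goal_cases)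
    case 1
    show ?case
    proof (rule Pi_I)
      fix p :: "nat \<times> nat" assume "p \<in> (SIGMA n:{1..}. {d. d dvd n})"
      then obtain n d where p: "p = (n, d)" "1 \<le> n" "d dvd n" by auto
      then have "d > 0" by (intro Nat.gr0I) auto
      moreover from this have "n div d > 0" using p by (simp add: div_greater_zero_iff dvd_imp_le)
      ultimately
      show "(case p of (n, d) \<Rightarrow> (n div d, d)) \<in> {1..} \<times> {1..}"
        using p by (simp add: Suc_le_eq)
    qed
  qed (auto simp: Suc_le_eq)
  from has_sum_reindex_bij_betw[OF this, of a ?z] tot
  have tot': "((\<lambda>(n, d). a (n div d, d)) has_sum ?z) (SIGMA n:{1..}. {d. d dvd n})"
    by (simp add: case_prod_unfold)
  have inner': "((\<lambda>d. a (n div d, d)) has_sum ((eul f) $ n * x ^ n)) {d. d dvd n}" if n: "n \<in> {1..}" for n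
  proof -
    have "(eul f) $ n * x ^ n = (\<Sum>d | d dvd n. a (n div d, d))"
      unfolding eul_def fps_nth_Abs_fps sum_distrib_right
    proof (intro sum.cong refl)
      fix d assume "d \<in> {d. d dvd n}"
      then obtain k where k: "n = d * k" by (auto elim: dvdE)
      then have "d > 0" "k > 0" using n by (auto simp: Suc_le_eq)
      then show "real d * f $ d / real n * x ^ n = a (n div d, d)"
        using k by (simp add: a_def field_simps)
    qed
    then show ?thesis using n by (intro has_sum_finiteI) auto
  qed
  have "((\<lambda>n. (eul f) $ n * x ^ n) has_sum ?z) {1..}"
    by (rule has_sum_SigmaD[OF tot']) (simp only: prod.case inner')
  also have "?this \<longleftrightarrow> ((\<lambda>n. (eul f) $ n * x ^ n) has_sum ?z) UNIV"
    by (rule has_sum_cong_neutral) (auto simp: not_less_eq_eq)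
  finally show ?thesis by (rule has_sum_imp_sums)
qed

section \<open>The tree function and the dominant singularity\<close>

text \<open>Cayley's tree function, the exponential generating function of labelled rooted trees.
  Index 0 is separate because truncated subtraction would give
  \<open>0 ^ (0 - 1) = 1\<close>.\<close>

definition tree_fps :: "real fps" where
  "tree_fps = Abs_fps (\<lambda>m. if m = 0 then 0 else real m ^ (m - 1) / fact m)"

lemma tree_fps_nth_0 [simp]: "tree_fps $ 0 = 0"
  by (simp add: tree_fps_def)

lemma fps_nonneg_tree_fps: "fps_nonneg tree_fps"
  by (simp add: tree_fps_def)

text \<open>The \<open>n\<close>-th finite difference of a polynomial of degree \<open>j < n\<close>
  vanishes: up to the factor \<open>fact j\<close>, the sum is coefficient \<open>j\<close> of
  \<open>(e^x - 1) ^ n\<close>, a series that starts with x^n.\<close>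

lemma sum_alternating_choose_power_eq_0:
  assumes "j < n"
  shows "(\<Sum>m\<le>n. real (n choose m) * (-1) ^ (n - m) * real m ^ j) = 0"
proof -
  have c: "real (n choose m) * (-1) ^ (n - m) * real m ^ j / fact j
       = (of_nat (n choose m) * fps_exp 1 ^ m * (-1) ^ (n - m)) $ j" for m
  proof -
    have "of_nat (n choose m) * fps_exp 1 ^ m * (-1) ^ (n - m)
        = fps_const (real (n choose m) * (-1) ^ (n - m)) * fps_exp (real m)"
      by (simp add: fps_exp_power_mult mult_ac flip: fps_of_nat fps_const_mult fps_const_power fps_const_neg)
    then show ?thesis by simp
  qed
  have "(\<Sum>m\<le>n. real (n choose m) * (-1) ^ (n - m) * real m ^ j) / fact j
      = ((fps_exp 1 + (-1)) ^ n) $ j"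
    unfolding binomial_ring fps_sum_nth sum_divide_distrib c ..
  also have "\<dots> = 0"
    using startsby_zero_power_prefix[of "fps_exp 1 + (-1) :: real fps" n] assms by auto
  finally show ?thesis by simp
qed

text \<open>A direct check in place of Lagrange inversion: coefficient \<open>n\<close> of the
  composition is, up to \<open>fact n\<close>, an alternating binomial sum over the powers
  \<open>m ^ (n - 1)\<close>.\<close>

lemma tree_fps_inverse: "tree_fps oo (fps_X * fps_exp (-1)) = fps_X"
proof (rule fps_ext)
  fix n
  show "(tree_fps oo (fps_X * fps_exp (-1))) $ n = fps_X $ n"
  proof (cases "n = 0")
    case n: False
    \<comment> \<open>The binomial expression also has a term for \<open>m = 0\<close>, where the
      composition has none. Because \<open>0 ^ 0 = 1\<close> it is -1 for \<open>n = 1\<close>;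
      removing it produces the coefficient of \<open>fps_X\<close>.\<close>
    have t: "tree_fps $ m * ((fps_X * fps_exp (-1)) ^ m) $ n =
        real (n choose m) * (-1) ^ (n - m) * real m ^ (n - 1) / fact n - (if n = 1 \<and> m = 0 then -1 else 0)"
      if m: "m \<le> n" for m
    proof (cases "m = 0")
      case False
      have "(fps_X * fps_exp (-1)) ^ m = fps_X ^ m * fps_exp (- real m)"
        by (simp add: power_mult_distrib fps_exp_power_mult)
      then have "((fps_X * fps_exp (-1)) ^ m) $ n = (- real m) ^ (n - m) / fact (n - m)"
        using m by (simp add: fps_X_power_mult_nth)
      also have "(- real m) ^ (n - m) = (-1) ^ (n - m) * real m ^ (n - m)"
        by (metis mult_minus1 power_mult_distrib)
      finally have e: "((fps_X * fps_exp (-1)) ^ m) $ n = (-1) ^ (n - m) * real m ^ (n - m) / fact (n - m)" .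
      have p: "real m ^ (n - 1) = real m ^ (m - 1) * real m ^ (n - m)"
        using m False by (simp flip: power_add)
      have "real (n choose m) = fact n / (fact m * fact (n - m))"
        using m by (rule binomial_fact)
      then show ?thesis using False e p by (simp add: tree_fps_def)
    qed (use n in \<open>auto simp: power_0_left\<close>)
    have "(tree_fps oo (fps_X * fps_exp (-1))) $ n =
       (\<Sum>m\<le>n. real (n choose m) * (-1) ^ (n - m) * real m ^ (n - 1) / fact n - (if n = 1 \<and> m = 0 then -1 else 0))"
      unfolding fps_compose_nth atLeast0AtMost using t by (intro sum.cong) auto
    also have "\<dots> = (\<Sum>m\<le>n. real (n choose m) * (-1) ^ (n - m) * real m ^ (n - 1)) / fact n
       - (\<Sum>m\<le>n. (if n = 1 \<and> m = 0 then -1 else 0))"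
      by (simp add: sum_subtractf sum_divide_distrib)
    also have "(\<Sum>m\<le>n. real (n choose m) * (-1) ^ (n - m) * real m ^ (n - 1)) = 0"
      using n by (intro sum_alternating_choose_power_eq_0) auto
    also have "(\<Sum>m\<le>n. (if n = 1 \<and> m = 0 then -1 else 0)) = (if n = 1 then -1 else (0::real))"
      by (cases "n = 1") auto
    finally show ?thesis by simp
  qed simp
qed

lemma summable_tree_fps:
  assumes "0 \<le> y" "y < exp (-1)"
  shows "fsummable tree_fps y"
proof (rule summable_comparison_test')
  show "summable (\<lambda>n. (exp 1 * y) ^ n)"
    using assms by (intro summable_geometric) (simp add: exp_minus field_simps)
  fix n :: nat assume "0 \<le> n"
  \<comment> \<open>The bound \<open>n ^ n / fact n \<le> exp n\<close> comes from a single term of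
    the exponential series at \<open>n\<close>.\<close>
  have "(\<Sum>k\<in>{n}. (fps_exp 1) $ k * real n ^ k) \<le> (\<Sum>k. (fps_exp 1) $ k * real n ^ k)"
    using fsums_exp[of "real n"] by (intro sum_le_suminf) (auto simp: sums_iff)
  then have e: "real n ^ n / fact n \<le> exp (real n)"
    using fsums_exp[of "real n"] by (simp add: sums_iff field_simps)
  have "tree_fps $ n \<le> real n ^ n / fact n"
    by (auto simp: tree_fps_def intro!: divide_right_mono power_increasing)
  also note e
  finally have "tree_fps $ n * y ^ n \<le> exp (real n) * y ^ n"
    using assms by (intro mult_right_mono) auto
  also have "\<dots> = (exp 1 * y) ^ n"
    by (simp add: power_mult_distrib flip: exp_of_nat_mult)
  finally show "norm (tree_fps $ n * y ^ n) \<le> (exp 1 * y) ^ n"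
    using assms fps_nonneg_tree_fps by simp
qed

section \<open>Splitting off the term with \<open>i = 1\<close>:
  \<open>T = G * exp T\<close>\<close>

lemma fps_exp_compose_add:
  fixes a b :: "real fps"
  assumes "a $ 0 = 0" "b $ 0 = 0"
  shows "fps_exp 1 oo (a + b) = (fps_exp 1 oo a) * (fps_exp 1 oo b)"
proof (rule fps_deriv_eq_mult_unique)
  show "fps_deriv (fps_exp 1 oo (a + b)) = (fps_exp 1 oo (a + b)) * fps_deriv (a + b)"
    using assms by (intro fps_deriv_exp_compose) simp
  show "fps_deriv ((fps_exp 1 oo a) * (fps_exp 1 oo b)) = (fps_exp 1 oo a) * (fps_exp 1 oo b) * fps_deriv (a + b)"
    by (simp add: fps_deriv_exp_compose assms algebra_simps)
qed simp

text \<open>The terms of \<open>eul f\<close> with \<open>i \<ge> 2\<close>. At index 0 the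
  difference leaves \<open>- f $ 0\<close>, hence the assumptions on \<open>f $ 0\<close>
  below.\<close>

definition eulB :: "real fps \<Rightarrow> real fps" where
  "eulB f = eul f - f"

lemma eul_eq: "eul f = f + eulB f"
  by (simp add: eulB_def)

lemma eulB_nth:
  assumes "n > 0"
  shows "(eulB f) $ n = (\<Sum>d | d dvd n \<and> d \<noteq> n. real d * f $ d / real n)"
proof -
  have "{d. d dvd n} = insert n {d. d dvd n \<and> d \<noteq> n}" by auto
  moreover have "finite {d. d dvd n \<and> d \<noteq> n}"
    by (rule finite_subset[of _ "{d. d dvd n}"]) (use assms in auto)
  ultimately show ?thesis using assms by (simp add: eulB_def eul_def)
qed

lemma eulB_nth_0 [simp]: "(eulB f) $ 0 = - fps_nth f 0"
  by (simp add: eulB_def)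

lemma fps_nonneg_eulB:
  assumes "fps_nonneg f" "f $ 0 = 0"
  shows "fps_nonneg (eulB f)"
proof
  fix n show "0 \<le> (eulB f) $ n"
    using assms by (cases "n = 0") (auto simp: eulB_nth intro!: sum_nonneg)
qed

lemma eulB_mono:
  assumes "\<And>n. f $ n \<le> f' $ n" "f $ 0 = f' $ 0"
  shows "(eulB f) $ n \<le> (eulB f') $ n"
proof (cases "n = 0")
  case False
  then show ?thesis
    by (simp add: eulB_nth, intro sum_mono divide_right_mono mult_left_mono) (use assms in auto)
qed (use assms in simp)

text \<open>The divisors that occur in \<^term>\<open>eulB f\<close> are at most half of the index.\<close>
lemma summable_eulB:
  assumes f: "fps_nonneg f" "f $ 0 = 0" "fsummable f (y ^ 2)"
    and xy: "0 \<le> x" "x < y" "y \<le> 1"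
  shows "fsummable (eulB f) x"
proof -
  define c where "c = (\<Sum>n. f $ n * (y ^ 2) ^ n)"
  have y: "y > 0" using xy by simp
  have c: "f $ d * (y ^ 2) ^ d \<le> c" for d
  proof -
    have "(\<Sum>n\<in>{d}. f $ n * (y ^ 2) ^ n) \<le> c"
      unfolding c_def by (rule sum_le_suminf[OF f(3)]) (use f in auto)
    then show ?thesis by simp
  qed
  have c0: "c \<ge> 0" using c[of 0] f by simp
  show ?thesis
  proof (rule summable_comparison_test')
    have "summable (\<lambda>n. of_nat (Suc n) * (x / y) ^ n)"
      using geometric_deriv_sums[of "x / y"] xy y by (simp add: sums_iff)
    then show "summable (\<lambda>n. c * (real (Suc n) * (x / y) ^ n))" by (intro summable_mult) simp
    fix n :: nat assume "1 \<le> n"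
    have "(eulB f) $ n \<le> (\<Sum>d\<in>{1..n}. c / y ^ n)"
    proof -
      have "(eulB f) $ n = (\<Sum>d | d dvd n \<and> d \<noteq> n. real d * f $ d / real n)"
        using \<open>1 \<le> n\<close> by (simp add: eulB_nth)
      also have "\<dots> \<le> (\<Sum>d | d dvd n \<and> d \<noteq> n. c / y ^ n)"
      proof (rule sum_mono)
        fix d assume "d \<in> {d. d dvd n \<and> d \<noteq> n}"
        then obtain k where k: "n = d * k" "k \<noteq> 1" by (auto elim: dvdE)
        then have "2 \<le> k" using \<open>1 \<le> n\<close> by (cases k) auto
        then have "2 * d \<le> n" using k by (simp add: mult.commute)
        then have "d \<le> n" by simp
        have "real d * f $ d / real n \<le> real n * f $ d / real n"
          using \<open>d \<le> n\<close> f by (intro divide_right_mono mult_right_mono) auto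
        also have "\<dots> = f $ d * (y ^ 2) ^ d / (y ^ 2) ^ d" using \<open>1 \<le> n\<close> y by simp
        also have "\<dots> \<le> c / (y ^ 2) ^ d" using y by (intro divide_right_mono c) auto
        \<comment> \<open>As \<open>y \<le> 1\<close> and \<open>2 * d \<le> n\<close>, the power
          \<open>(y ^ 2) ^ d\<close> is at least \<open>y ^ n\<close>: convergence of
          \<open>f\<close> at \<open>y ^ 2\<close> controls \<open>eulB f\<close> up to
          \<open>y\<close>.\<close>
        also have "\<dots> \<le> c / y ^ n"
          using y c0 \<open>2 * d \<le> n\<close> xy by (intro divide_left_mono) (auto simp flip: power_mult intro: power_decreasing)
        finally show "real d * f $ d / real n \<le> c / y ^ n" .
      qed
      also have "\<dots> \<le> (\<Sum>d\<in>{1..n}. c / y ^ n)"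
      proof (rule sum_mono2)
        show "{d. d dvd n \<and> d \<noteq> n} \<subseteq> {1..n}"
          using \<open>1 \<le> n\<close> by (auto dest: dvd_imp_le simp: Suc_le_eq dvd_pos_nat)
      qed (use c0 y in auto)
      finally show ?thesis .
    qed
    then have "(eulB f) $ n * x ^ n \<le> (real n * (c / y ^ n)) * x ^ n"
      using xy by (intro mult_right_mono) auto
    also have "\<dots> = c * (real n * (x / y) ^ n)" by (simp add: power_divide)
    also have "\<dots> \<le> c * (real (Suc n) * (x / y) ^ n)"
      using c0 xy y by (intro mult_left_mono mult_right_mono) auto
    finally show "norm ((eulB f) $ n * x ^ n) \<le> c * (real (Suc n) * (x / y) ^ n)"
      using fps_nonneg_eulB[OF f(1,2)] xy by simp
  qed
qed

definition G_fps :: "real fps" where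
  "G_fps = fps_X * (fps_exp 1 oo eulB T_gf)"

lemma T_gf_nonneg: "fps_nonneg T_gf" by (simp add: T_gf_def)
lemma T_gf_nth_0 [simp]: "T_gf $ 0 = 0" by (simp add: T_gf_def)
lemmas eulB_T_gf_nonneg = fps_nonneg_eulB[OF T_gf_nonneg T_gf_nth_0]

lemma G_fps_nonneg: "fps_nonneg G_fps"
  unfolding G_fps_def
  by (intro fps_nonneg_mult fps_nonneg_compose fps_nonneg_exp eulB_T_gf_nonneg) (auto simp: fps_X_def)

lemma G_fps_nth_0 [simp]: "G_fps $ 0 = 0" and G_fps_nth_1 [simp]: "G_fps $ (Suc 0) = 1"
  by (simp_all add: G_fps_def)

lemma T_gf_eq_G_fps: "T_gf = G_fps * (fps_exp 1 oo T_gf)"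
proof -
  have "fps_exp 1 oo eul T_gf = (fps_exp 1 oo T_gf) * (fps_exp 1 oo eulB T_gf)"
    unfolding eul_eq by (rule fps_exp_compose_add) auto
  then show ?thesis using T_gf_rec unfolding G_fps_def by (metis mult.assoc mult.commute)
qed

text \<open>The functional equation says \<open>T_gf * exp (- T_gf) = G_fps\<close>, and
  \<open>tree_fps\<close> is the compositional inverse of \<open>y * exp (- y)\<close>.\<close>

lemma T_gf_eq_tree_fps: "T_gf = tree_fps oo G_fps"
proof -
  have "(fps_exp (-1) oo T_gf) * (fps_exp 1 oo T_gf) = (fps_exp (-1) * fps_exp 1) oo T_gf"
    by (rule fps_compose_mult_distrib[symmetric]) simp
  also have "fps_exp (-1) * fps_exp (1::real) = 1"
    by (simp flip: fps_exp_add_mult)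
  finally have inv: "(fps_exp (-1) oo T_gf) * (fps_exp 1 oo T_gf) = 1" by simp
  have "(fps_X * fps_exp (-1)) oo T_gf = T_gf * (fps_exp (-1) oo T_gf)"
    by (simp add: fps_compose_mult_distrib)
  also have "\<dots> = G_fps * ((fps_exp (-1) oo T_gf) * (fps_exp 1 oo T_gf))"
    by (subst T_gf_eq_G_fps) (simp add: mult_ac)
  finally have "(fps_X * fps_exp (-1)) oo T_gf = G_fps" using inv by simp
  then have "tree_fps oo G_fps = (tree_fps oo (fps_X * fps_exp (-1))) oo T_gf"
    using fps_compose_assoc[of T_gf "fps_X * fps_exp (-1)" tree_fps] by simp
  then show ?thesis by (simp add: tree_fps_inverse)
qed

section \<open>Radius of convergence of \<open>T_gf\<close> and its value there\<close>

lemma fps_power_nth_cong: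
  assumes "\<And>k. k \<le> n \<Longrightarrow> a $ k = b $ k"
  shows "(a ^ m) $ n = (b ^ m) $ n"
proof -
  have "\<forall>k\<le>n. (a ^ m) $ k = (b ^ m) $ k"
  proof (induction m)
    case (Suc m)
    show ?case
    proof (intro allI impI)
      fix k assume "k \<le> n"
      then show "(a ^ Suc m) $ k = (b ^ Suc m) $ k"
        using assms Suc by (simp add: fps_mult_nth)
    qed
  qed simp
  then show ?thesis by simp
qed

lemma fps_compose_nth_cong:
  assumes "\<And>k. k \<le> n \<Longrightarrow> a $ k = b $ k"
  shows "(g oo a) $ n = (g oo b) $ n"
  unfolding fps_compose_nth using fps_power_nth_cong[OF assms] by simp

lemma eul_nth_cong:
  assumes "\<And>k. k \<le> n \<Longrightarrow> a $ k = b $ k"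
  shows "(eul a) $ n = (eul b) $ n"
proof (cases "n = 0")
  case False
  then show ?thesis unfolding eul_def fps_nth_Abs_fps
    using assms by (intro sum.cong refl) (auto dest: dvd_imp_le)
qed simp

text \<open>The invariant \<open>T(1/4) \<le> 1/2\<close> reproduces itself because \<open>exp (2/3) / 4 \<le> 1/2\<close>.\<close>
lemma T_gf_partial_sum_le: "(\<Sum>n\<le>N. T_gf $ n * (1/4) ^ n) \<le> 1/2"
proof (induction N)
  case (Suc N)
  \<comment> \<open>In \<open>T_gf_rec\<close> the coefficients up to \<open>N + 1\<close> of the
    right-hand side depend only on those of \<open>T_gf\<close> up to \<open>N\<close>, so the
    truncation \<open>t\<close>, which converges everywhere, may replace
    \<open>T_gf\<close>.\<close>
  define t where "t = Abs_fps (\<lambda>n. if n \<le> N then T_gf $ n else 0)"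
  have t: "fps_nonneg t" "t $ 0 = 0" using T_gf_nonneg by (auto simp: t_def)
  have "fsums t (1/4) (\<Sum>n\<le>N. t $ n * (1/4) ^ n)"
    by (rule sums_finite) (auto simp: t_def)
  also have "(\<Sum>n\<le>N. t $ n * (1/4) ^ n) = (\<Sum>n\<le>N. T_gf $ n * (1/4) ^ n)"
    by (simp add: t_def)
  finally have ts: "fsums t (1/4) (\<Sum>n\<le>N. T_gf $ n * (1/4) ^ n)" .
  then have st: "fsummable t (1/4)" by (rule sums_summable)
  have et: "eval_fps t (1/4) \<le> 1/2" using fsums_imp_eval_fps[OF ts] Suc by simp
  define y where "y = (\<Sum>i. eval_fps t ((1/4) ^ Suc i) / real (Suc i))"
  have y: "fsums (eul t) (1/4) y" unfolding y_def by (rule fsums_eul[OF st t]) auto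
  \<comment> \<open>2/3 is the sum of the majorants \<open>(1/4) ^ i * (1/2)\<close>.\<close>
  have "y \<le> 2/3"
  proof (rule sums_le)
    show "(\<lambda>i. eval_fps t ((1/4) ^ Suc i) / real (Suc i)) sums y"
      unfolding y_def by (intro summable_sums summable_eul_terms st t) auto
    have "(\<lambda>i. (1/4) ^ i * (1/2)) sums (1 / (1 - 1/4) * (1/2 :: real))"
      by (intro sums_mult2 geometric_sums) simp
    then show "(\<lambda>i. (1/4 :: real) ^ i * (1/2)) sums (2/3)" by simp
    fix i
    have le: "eval_fps t ((1/4) ^ Suc i) \<le> (1/4) ^ i * eval_fps t (1/4)"
      by (rule eval_fps_power_le[OF st t]) auto
    have "0 \<le> eval_fps t ((1/4) ^ Suc i)"
      by (intro eval_fps_nonneg summable_fps_mono[OF st]) (use t power_le_one[of "1/4 :: real" i] in auto)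
    then have "eval_fps t ((1/4) ^ Suc i) / real (Suc i) \<le> eval_fps t ((1/4) ^ Suc i) / 1"
      by (intro divide_left_mono) auto
    also have "\<dots> \<le> (1/4) ^ i * eval_fps t (1/4)" using le by simp
    also have "\<dots> \<le> (1/4) ^ i * (1/2)" by (intro mult_left_mono et) auto
    finally show "eval_fps t ((1/4) ^ Suc i) / real (Suc i) \<le> (1/4) ^ i * (1/2)" .
  qed
  \<comment> \<open>Cubing reduces this to \<open>exp 1 ^ 2 \<le> 8\<close>, which follows from
    \<open>exp 1 < 2.72\<close>.\<close>
  have "exp (2/3 :: real) \<le> 2"
  proof (rule power_le_imp_le_base[where n = 2])
    have "exp (2/3 :: real) ^ Suc 2 = exp 1 ^ 2"
      by (simp flip: exp_of_nat_mult)
    also have "\<dots> \<le> 2 ^ Suc 2"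
      using power_mono[of "exp 1" "272/100 :: real" 2] e_less_272 by (simp add: power2_eq_square)
    finally show "exp (2/3 :: real) ^ Suc 2 \<le> 2 ^ Suc 2" .
  qed auto
  then have ey: "exp y \<le> 2" using \<open>y \<le> 2/3\<close> by (meson exp_le_cancel_iff order_trans)
  have "fsums (fps_X * (fps_exp 1 oo eul t)) (1/4) (1/4 * exp y)"
    by (intro fsums_X_mult fsums_exp_compose y fps_nonneg_eul t) auto
  note fin = this
  have eq: "T_gf $ n = (fps_X * (fps_exp 1 oo eul t)) $ n" if "n \<le> Suc N" for n
  proof (cases n)
    case (Suc m)
    then have "(fps_exp 1 oo eul T_gf) $ m = (fps_exp 1 oo eul t) $ m"
      using that by (intro fps_compose_nth_cong eul_nth_cong) (auto simp: t_def)
    then show ?thesis using Suc by (subst T_gf_rec) simp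
  qed simp
  have "(\<Sum>n\<le>Suc N. T_gf $ n * (1/4) ^ n) = (\<Sum>n\<le>Suc N. (fps_X * (fps_exp 1 oo eul t)) $ n * (1/4) ^ n)"
    by (rule sum.cong[OF refl]) (use eq in auto)
  also have "\<dots> \<le> 1/4 * exp y"
    using fin fps_nonneg_compose[OF fps_nonneg_eul[OF t(1)] fps_nonneg_exp]
    by (subst sums_unique[OF fin], intro sum_le_suminf) (auto simp: sums_iff)
  also have "\<dots> \<le> 1/2" using ey by simp
  finally show ?case .
qed simp

lemma summable_T_gf_quarter: "fsummable T_gf (1/4)"
proof (rule bounded_imp_summable[where B = "1/2"])
  show "(\<Sum>k\<le>n. T_gf $ k * (1/4) ^ k) \<le> 1/2" for n by (rule T_gf_partial_sum_le)
qed (use T_gf_nonneg in auto)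

text \<open>The lower bound makes \<open>rho\<close> positive. The upper one, due to coefficients
  that stay at least 1, makes the radius finite, so \<open>real_of_ereal\<close> in the definition
  of \<open>rho\<close> loses nothing.\<close>

lemma fps_conv_radius_T_gf_bounds: "ereal (1/4) \<le> fps_conv_radius T_gf" "fps_conv_radius T_gf \<le> 1"
proof -
  have "ereal (norm (1/4 :: real)) \<le> fps_conv_radius T_gf"
    unfolding fps_conv_radius_def by (intro conv_radius_geI summable_T_gf_quarter)
  then show "ereal (1/4) \<le> fps_conv_radius T_gf" by simp
  show "fps_conv_radius T_gf \<le> 1"
  proof (rule ccontr)
    assume "\<not> fps_conv_radius T_gf \<le> 1"
    then have "fsummable T_gf 1"
      unfolding fps_conv_radius_def by (intro summable_in_conv_radius) (auto simp: not_le one_ereal_def)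
    then have "(\<lambda>n. T_gf $ n) \<longlonglongrightarrow> 0" by (simp add: summable_LIMSEQ_zero)
    moreover have "eventually (\<lambda>n. T_gf $ n \<ge> 1) sequentially"
      using eventually_gt_at_top[of 0] by eventually_elim (rule T_gf_nth_ge_1)
    ultimately have "1 \<le> (0::real)"
      using tendsto_lowerbound[OF _ _ sequentially_bot] by blast
    then show False by simp
  qed
qed

lemma fps_conv_radius_T_gf: "fps_conv_radius T_gf = ereal rho"
  and rho_ge: "1/4 \<le> rho" and rho_le_1: "rho \<le> 1"
proof -
  obtain r where r: "fps_conv_radius T_gf = ereal r"
    using fps_conv_radius_T_gf_bounds by (cases "fps_conv_radius T_gf") auto
  then have "rho = r" by (simp add: rho_def)
  then show "fps_conv_radius T_gf = ereal rho" "1/4 \<le> rho" "rho \<le> 1"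
    using r fps_conv_radius_T_gf_bounds by simp_all
qed

lemma rho_pos: "rho > 0" using rho_ge by simp

lemma summable_T_gf: "0 \<le> x \<Longrightarrow> x < rho \<Longrightarrow> fsummable T_gf x"
  using fps_conv_radius_T_gf unfolding fps_conv_radius_def by (intro summable_in_conv_radius) auto

lemma not_summable_T_gf: "rho < x \<Longrightarrow> \<not> fsummable T_gf x"
  using conv_radius_geI[of "fps_nth T_gf" x] fps_conv_radius_T_gf rho_pos
  unfolding fps_conv_radius_def by auto

text \<open>\<open>eulB T_gf\<close> involves only \<open>T (z ^ i)\<close> with
  \<open>i \<ge> 2\<close>; convergence up to \<open>sqrt rho\<close> leaves room beyond
  \<open>rho\<close>.\<close>

lemma summable_eulB_T_gf:
  assumes "0 \<le> x" "x < sqrt rho"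
  shows "fsummable (eulB T_gf) x"
proof -
  define y where "y = (x + sqrt rho) / 2"
  have y: "x < y" "y < sqrt rho" "0 \<le> y" using assms by (auto simp: y_def)
  then have "y ^ 2 < rho" using power_strict_mono[of y "sqrt rho" 2] rho_pos by simp
  moreover have "y \<le> 1" using y(2) rho_le_1 real_sqrt_le_1_iff[of rho] by linarith
  ultimately show ?thesis
    using y assms by (intro summable_eulB[where y = y] summable_T_gf T_gf_nonneg) auto
qed

lemma rho_le_sqrt: "rho \<le> sqrt rho"
  using rho_le_1 rho_pos by (simp add: real_le_rsqrt power2_eq_square mult_left_le)

definition G :: "real \<Rightarrow> real" where
  "G x = x * exp (eval_fps (eulB T_gf) x)"

lemma fsums_G_fps:
  assumes "0 \<le> x" "x < sqrt rho"
  shows "fsums G_fps x (G x)"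
  unfolding G_fps_def G_def
  using assms by (intro fsums_X_mult fsums_exp_compose eval_fps_sums summable_eulB_T_gf eulB_T_gf_nonneg) auto

lemma G_strict_mono:
  assumes "0 \<le> w" "w < x" "x < sqrt rho"
  shows "G w < G x"
proof -
  have "eval_fps (eulB T_gf) w \<le> eval_fps (eulB T_gf) x"
    using assms by (intro eval_fps_mono summable_eulB_T_gf eulB_T_gf_nonneg) auto
  then have "w * exp (eval_fps (eulB T_gf) w) \<le> w * exp (eval_fps (eulB T_gf) x)"
    using assms by (intro mult_left_mono) auto
  also have "\<dots> < x * exp (eval_fps (eulB T_gf) x)"
    using assms by (intro mult_strict_right_mono) auto
  finally show ?thesis unfolding G_def .
qed

lemma T_eq_G_exp:
  assumes "0 \<le> x" "x < sqrt rho" "fsummable T_gf x"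
  shows "eval_fps T_gf x = G x * exp (eval_fps T_gf x)"
proof -
  have "fsums (G_fps * (fps_exp 1 oo T_gf)) x (G x * exp (eval_fps T_gf x))"
    using assms by (intro fsums_mult fsums_G_fps fsums_exp_compose eval_fps_sums G_fps_nonneg
        fps_nonneg_compose T_gf_nonneg fps_nonneg_exp) auto
  then show ?thesis
    unfolding T_gf_eq_G_fps[symmetric] by (rule fsums_imp_eval_fps)
qed

text \<open>The square of \<open>1 + (u - 1) / 2\<close> exceeds \<open>u\<close> by
  \<open>((1 - u) / 2) ^ 2 > 0\<close> and is at most \<open>exp (u - 1)\<close>; this gives
  strictness without derivatives.\<close>

lemma mult_exp_minus_less:
  fixes u :: real
  assumes "0 \<le> u" "u < 1"
  shows "u * exp (-u) < exp (-1)"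
proof -
  have "0 < ((1 - u) / 2) ^ 2" using assms by simp
  also have "\<dots> = (1 + (u - 1) / 2) ^ 2 - u" by (simp add: power2_eq_square field_simps)
  finally have "u < (1 + (u - 1) / 2) ^ 2" by simp
  also have "\<dots> \<le> exp ((u - 1) / 2) ^ 2"
    by (intro power_mono exp_ge_add_one_self) (use assms in \<open>simp add: field_simps\<close>)
  also have "\<dots> = exp (u - 1)" by (simp flip: exp_of_nat_mult)
  finally have "u * exp (-u) < exp (u - 1) * exp (-u)" by simp
  also have "\<dots> = exp (-1)" by (simp flip: exp_add)
  finally show ?thesis .
qed

lemma mult_exp_minus_le: "u * exp (-u) \<le> exp (-1 :: real)"
proof -
  have "u * exp (-u) \<le> exp (u - 1) * exp (-u)"
    using exp_ge_add_one_self[of "u - 1"] by (intro mult_right_mono) auto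
  then show ?thesis by (simp flip: exp_add)
qed

text \<open>If \<open>T\<close> reached 1 at some \<open>x1 < rho\<close>, then \<open>G x1\<close>
  would be \<open>exp (-1)\<close>, the maximum of \<open>u * exp (-u)\<close>. But
  \<open>G x2\<close> has the form \<open>u * exp (-u)\<close> too for a later
  \<open>x2 < rho\<close>, against strict monotonicity of \<open>G\<close>.\<close>

lemma T_less_1:
  assumes x: "0 \<le> x" "x < rho"
  shows "eval_fps T_gf x < 1"
proof (rule ccontr)
  assume "\<not> eval_fps T_gf x < 1"
  then have "1 \<le> eval_fps T_gf x" by simp
  moreover have "eval_fps T_gf 0 \<le> 1" by (simp add: eval_fps_at_0)
  moreover have "continuous_on {0..x} (eval_fps T_gf)"
    using x by (intro continuous_on_subset[OF continuous_on_eval_fps])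
      (auto simp: fps_conv_radius_T_gf eball_def)
  ultimately obtain x1 where x1: "0 \<le> x1" "x1 \<le> x" "eval_fps T_gf x1 = 1"
    using IVT'[of "eval_fps T_gf" 0 1 x] x by auto
  define x2 where "x2 = (x + rho) / 2"
  have x2: "x < x2" "x2 < rho" "x2 < sqrt rho" using x rho_le_sqrt by (auto simp: x2_def)
  have "G x1 = exp (-1)"
    using T_eq_G_exp[of x1] x1 x2 x by (simp add: summable_T_gf exp_minus field_simps)
  moreover have "G x2 = eval_fps T_gf x2 * exp (- eval_fps T_gf x2)"
  proof -
    have "eval_fps T_gf x2 = G x2 * exp (eval_fps T_gf x2)"
      using x2 x by (intro T_eq_G_exp summable_T_gf) auto
    then show ?thesis by (simp add: exp_minus field_simps)
  qed
  ultimately have "G x2 \<le> G x1" using mult_exp_minus_le by simp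
  moreover have "G x1 < G x2" using x1 x2 by (intro G_strict_mono) auto
  ultimately show False by simp
qed

text \<open>All coefficients from index 1 on are at least 1, so
  \<open>x / (1 - x) \<le> T x < 1\<close> for \<open>x < rho\<close>. The crude bound suffices for
  \<open>rho < sqrt rho\<close> and for geometric tails with ratio 1/2.\<close>

lemma rho_le_half: "rho \<le> 1/2"
proof (rule field_le_epsilon)
  fix e :: real assume e: "e > 0"
  define x where "x = max 0 (rho - e)"
  have x: "0 \<le> x" "x < rho" "x < 1" using rho_pos e rho_le_1 by (auto simp: x_def)
  have "x * (1 / (1 - x)) \<le> eval_fps T_gf x"
  proof (rule sums_le)
    show "(\<lambda>n. x * x ^ n) sums (x * (1 / (1 - x)))" using x by (intro sums_mult geometric_sums) auto
    show "(\<lambda>n. T_gf $ (Suc n) * x ^ Suc n) sums eval_fps T_gf x"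
      using eval_fps_sums[OF summable_T_gf[OF x(1,2)]] by (subst sums_Suc_iff) simp
    show "x * x ^ n \<le> T_gf $ (Suc n) * x ^ Suc n" for n
      using T_gf_nth_ge_1[of "Suc n"] x mult_right_mono[of 1 "T_gf $ (Suc n)" "x ^ Suc n"] by simp
  qed
  then have "x * (1 / (1 - x)) < 1" using T_less_1[OF x(1,2)] by simp
  then have "x < 1/2" using x by (simp add: field_simps)
  moreover have "rho - e \<le> x" by (simp add: x_def)
  ultimately show "rho \<le> 1/2 + e" by linarith
qed

lemma rho_less_sqrt: "rho < sqrt rho"
  using rho_le_half rho_pos by (intro real_less_rsqrt) (simp add: power2_eq_square)

text \<open>The bound by 1 passes from \<open>x < rho\<close> to the partial sums at
  \<open>rho\<close> by continuity of polynomials. Being uniform in \<open>N\<close>, it yields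
  convergence at the boundary point itself.\<close>

lemma T_gf_partial_sum_rho_le: "(\<Sum>n\<le>N. T_gf $ n * rho ^ n) \<le> 1"
proof (rule LIMSEQ_le_const2)
  show "(\<lambda>j. \<Sum>n\<le>N. T_gf $ n * (rho * (1 - inverse (real (Suc j)))) ^ n)
      \<longlonglongrightarrow> (\<Sum>n\<le>N. T_gf $ n * rho ^ n)"
  proof -
    have "(\<lambda>j. rho * (1 - inverse (real (Suc j)))) \<longlonglongrightarrow> rho * (1 - 0)"
      by (intro tendsto_intros LIMSEQ_inverse_real_of_nat)
    then have "(\<lambda>j. rho * (1 - inverse (real (Suc j)))) \<longlonglongrightarrow> rho" by simp
    then show ?thesis by (intro tendsto_sum tendsto_mult_left tendsto_power)
  qed
  have "(\<Sum>n\<le>N. T_gf $ n * (rho * (1 - inverse (real (Suc j)))) ^ n) \<le> 1" for j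
  proof -
    let ?x = "rho * (1 - inverse (real (Suc j)))"
    have x: "0 \<le> ?x" "?x < rho" using rho_pos by (auto simp: field_simps)
    have "(\<Sum>n\<le>N. T_gf $ n * ?x ^ n) \<le> eval_fps T_gf ?x"
      unfolding eval_fps_def using summable_T_gf[OF x] T_gf_nonneg x
      by (intro sum_le_suminf) (auto simp del: of_nat_Suc)
    then show ?thesis using T_less_1[OF x] by simp
  qed
  then show "\<exists>M. \<forall>j\<ge>M. (\<Sum>n\<le>N. T_gf $ n * (rho * (1 - inverse (real (Suc j)))) ^ n) \<le> 1"
    by blast
qed

lemma summable_T_gf_rho: "fsummable T_gf rho"
  by (rule bounded_imp_summable[where B = 1]) (use T_gf_nonneg rho_pos T_gf_partial_sum_rho_le in auto)

lemma isCont_G_rho: "isCont G rho"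
proof -
  define y where "y = (rho + sqrt rho) / 2"
  have y: "rho < y" "y < sqrt rho" using rho_less_sqrt by (auto simp: y_def)
  have "ereal (norm y) \<le> fps_conv_radius (eulB T_gf)"
    unfolding fps_conv_radius_def using y rho_pos by (intro conv_radius_geI summable_eulB_T_gf) auto
  moreover have "ereal (norm rho) < ereal (norm y)" using y rho_pos by simp
  ultimately have "ereal (norm rho) < fps_conv_radius (eulB T_gf)" by (rule less_le_trans[rotated])
  then show ?thesis unfolding G_def by (intro continuous_intros)
qed

text \<open>If \<open>T(rho) < 1\<close>, then \<open>G(rho) < exp (-1)\<close>, so \<open>T = tree_fps \<circ> G\<close> would
  still converge slightly to the right of \<open>rho\<close>.\<close>
theorem T_rho: "eval_fps T_gf rho = 1"
proof (rule ccontr)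
  let ?u = "eval_fps T_gf rho"
  assume "?u \<noteq> 1"
  moreover have "?u \<le> 1"
    using T_gf_partial_sum_rho_le summable_T_gf_rho unfolding eval_fps_def
    by (intro LIMSEQ_le_const2[OF summable_LIMSEQ']) auto
  moreover have "0 \<le> ?u" using rho_pos by (intro eval_fps_nonneg summable_T_gf_rho T_gf_nonneg) auto
  ultimately have u: "?u * exp (- ?u) < exp (-1)" by (intro mult_exp_minus_less) auto
  have "?u = G rho * exp ?u"
    using rho_pos rho_less_sqrt by (intro T_eq_G_exp summable_T_gf_rho) auto
  then have "G rho = ?u * exp (- ?u)" by (simp add: exp_minus field_simps)
  then have "G rho < exp (-1)" using u by simp
  then have "eventually (\<lambda>x. G x < exp (-1)) (at rho)"
    using isCont_G_rho by (simp add: isCont_def order_tendsto_iff)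
  then obtain d where d: "d > 0" "\<And>x. x \<noteq> rho \<Longrightarrow> dist x rho < d \<Longrightarrow> G x < exp (-1)"
    by (auto simp: eventually_at)
  define x where "x = min (rho + d / 2) ((rho + sqrt rho) / 2)"
  have x: "rho < x" "x < sqrt rho" "dist x rho < d"
    using d(1) rho_less_sqrt by (auto simp: x_def dist_real_def min_def)
  have G: "0 \<le> G x" "G x < exp (-1)" using d(2)[of x] x rho_pos by (auto simp: G_def)
  have "fsums (tree_fps oo G_fps) x (eval_fps tree_fps (G x))"
    using x rho_pos G by (intro fsums_compose[where y = "G x"] fsums_G_fps G_fps_nonneg fps_nonneg_tree_fps
      eval_fps_sums summable_tree_fps) auto
  then have "fsummable T_gf x"
    unfolding T_gf_eq_tree_fps[symmetric] by (rule sums_summable)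
  then show False using not_summable_T_gf[OF x(1)] by contradiction
qed

lemma G_rho: "G rho = exp (-1)"
proof -
  have "eval_fps T_gf rho = G rho * exp (eval_fps T_gf rho)"
    using rho_pos rho_less_sqrt by (intro T_eq_G_exp summable_T_gf_rho) auto
  then show ?thesis by (simp add: T_rho exp_minus field_simps)
qed

section \<open>Coefficients of order \<open>n powr (-3/2)\<close>\<close>

text \<open>The shift by one keeps the weight positive at index 0.\<close>

definition wt :: "nat \<Rightarrow> real" where
  "wt n = real (Suc n) powr (3/2)"

definition has_ratio :: "real fps \<Rightarrow> real \<Rightarrow> bool" where
  "has_ratio f c \<longleftrightarrow> (\<lambda>n. f $ n * wt n) \<longlonglongrightarrow> c"

lemma wt_pos [simp]: "wt n > 0" and wt_nonneg [simp]: "wt n \<ge> 0" and wt_nz [simp]: "wt n \<noteq> 0"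
  by (simp_all add: wt_def)

lemma wt_0 [simp]: "wt 0 = 1" by (simp add: wt_def)

lemma wt_mono: "m \<le> n \<Longrightarrow> wt m \<le> wt n"
  unfolding wt_def by (intro powr_mono2) auto

text \<open>The exponent 3/2 is rounded up to 2, so that the constant is an ordinary power of
  \<open>D\<close>.\<close>

lemma wt_le_mult:
  assumes "Suc n \<le> D * Suc m"
  shows "wt n \<le> real D ^ 2 * wt m"
proof -
  have D: "D \<ge> 1" using assms by (cases D) auto
  have "wt n \<le> real (D * Suc m) powr (3/2)"
    unfolding wt_def by (intro powr_mono2) (use assms in \<open>auto simp del: of_nat_Suc of_nat_mult\<close>)
  also have "\<dots> = real D powr (3/2) * wt m" by (simp add: wt_def powr_mult del: of_nat_Suc mult_Suc_right)
  also have "\<dots> \<le> real D powr 2 * wt m"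
    using D by (intro mult_right_mono powr_mono) auto
  finally show ?thesis using D by (simp add: powr_realpow)
qed

lemma summable_inverse_wt: "summable (\<lambda>n. 1 / wt n)"
proof -
  have "summable (\<lambda>n. real n powr (-3/2))" by (subst summable_real_powr_iff) auto
  then have "summable (\<lambda>n. real (Suc n) powr (-3/2))" by (subst summable_Suc_iff)
  then show ?thesis by (simp add: wt_def powr_minus_divide)
qed

lemma has_ratio_imp_bounded:
  assumes "has_ratio f c"
  obtains K where "K > 0" "\<And>n. \<bar>f $ n\<bar> \<le> K / wt n"
proof -
  have "Bseq (\<lambda>n. f $ n * wt n)"
    using assms unfolding has_ratio_def by (intro convergent_imp_Bseq) (auto simp: convergent_def)
  then obtain K where "K > 0" "\<And>n. norm (f $ n * wt n) \<le> K" by (auto elim: BseqE)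
  then show ?thesis by (intro that[of K]) (auto simp: field_simps abs_mult)
qed

lemma has_ratio_imp_abs_summable:
  assumes "has_ratio f c"
  shows "summable (\<lambda>n. \<bar>f $ n\<bar>)"
proof -
  obtain K where K: "K > 0" "\<And>n. \<bar>f $ n\<bar> \<le> K / wt n"
    using has_ratio_imp_bounded[OF assms] by blast
  show ?thesis
    by (rule summable_comparison_test'[OF summable_mult[OF summable_inverse_wt, of K]])
       (use K in auto)
qed

lemma has_ratio_imp_summable: "has_ratio f c \<Longrightarrow> summable (fps_nth f)"
  using has_ratio_imp_abs_summable summable_rabs_cancel by blast

lemma has_ratio_add: "has_ratio f c \<Longrightarrow> has_ratio g d \<Longrightarrow> has_ratio (f + g) (c + d)"
  unfolding has_ratio_def by (auto simp: algebra_simps intro: tendsto_add)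

lemma has_ratio_diff: "has_ratio f c \<Longrightarrow> has_ratio g d \<Longrightarrow> has_ratio (f - g) (c - d)"
  unfolding has_ratio_def by (auto simp: algebra_simps intro: tendsto_diff)

lemma has_ratio_cmult: "has_ratio f c \<Longrightarrow> has_ratio (fps_const a * f) (a * c)"
  unfolding has_ratio_def by (auto simp: mult.assoc intro: tendsto_mult_left)

lemma has_ratio_0_le:
  assumes "has_ratio g 0" "\<And>n. \<bar>f $ n\<bar> \<le> \<bar>g $ n\<bar>"
  shows "has_ratio f 0"
  unfolding has_ratio_def
proof (rule Lim_null_comparison)
  show "(\<lambda>n. \<bar>g $ n * wt n\<bar>) \<longlonglongrightarrow> 0"
    using assms(1) unfolding has_ratio_def by (rule tendsto_rabs_zero)
  show "eventually (\<lambda>n. norm (f $ n * wt n) \<le> \<bar>g $ n * wt n\<bar>) sequentially"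
    using assms(2) by (auto simp: abs_mult intro!: always_eventually mult_right_mono)
qed

text \<open>The factor \<open>Suc n\<close> pays for a sum of \<open>n + 1\<close> equal terms in
  \<open>has_ratio_compose_0\<close>.\<close>

lemma has_ratio_geometric:
  assumes "0 \<le> q" "q < (1::real)"
  shows "(\<lambda>n. real (Suc n) * q ^ n * wt n) \<longlonglongrightarrow> 0"
proof (cases "q = 0")
  case True
  have "eventually (\<lambda>n. real (Suc n) * q ^ n * wt n = 0) sequentially"
    using eventually_gt_at_top[of 0] by eventually_elim (simp add: True)
  then show ?thesis by (rule tendsto_eventually)
next
  case False
  then have "0 < q" using assms by simp
  then show ?thesis unfolding wt_def using assms by real_asymp
qed

lemma has_ratio_0_if_summable:
  assumes "fsummable f x" "x > 1"
  shows "has_ratio f 0"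
proof -
  have "Bseq (\<lambda>n. f $ n * x ^ n)"
    using summable_LIMSEQ_zero[OF assms(1)] by (intro convergent_imp_Bseq) (auto simp: convergent_def)
  then obtain K where K: "K > 0" "\<And>n. norm (f $ n * x ^ n) \<le> K" by (auto elim: BseqE)
  have "(\<lambda>n. K * (real (Suc n) * (1 / x) ^ n * wt n)) \<longlonglongrightarrow> K * 0"
    using assms(2) by (intro tendsto_mult_left has_ratio_geometric) auto
  then have lim: "(\<lambda>n. K * (real (Suc n) * (1 / x) ^ n * wt n)) \<longlonglongrightarrow> 0" by simp
  have "norm (f $ n * wt n) \<le> K * (real (Suc n) * (1 / x) ^ n * wt n)" for n
  proof -
    have "\<bar>f $ n\<bar> \<le> K * (1 / x) ^ n"
      using K(2)[of n] assms(2) by (simp add: abs_mult field_simps power_divide)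
    also have "\<dots> \<le> K * (real (Suc n) * (1 / x) ^ n)"
      using K assms(2) mult_right_mono[of 1 "real (Suc n)" "(1 / x) ^ n"] by (intro mult_left_mono) auto
    finally show ?thesis
      using mult_right_mono[OF _ wt_nonneg[of n]] by (fastforce simp: abs_mult mult.assoc)
  qed
  then show ?thesis
    unfolding has_ratio_def by (intro Lim_null_comparison[OF _ lim] always_eventually allI)
qed

lemma has_ratio_1: "has_ratio 1 0"
proof -
  have "summable (\<lambda>n. 1 $ n * 2 ^ n :: real)"
    by (rule summable_finite[of "{0}"]) auto
  then show ?thesis by (rule has_ratio_0_if_summable) simp
qed

lemma wt_ratio_tendsto: "(\<lambda>n. wt n / wt (n - j)) \<longlonglongrightarrow> 1"
proof -
  have "(\<lambda>n. wt (n + j) / wt n) \<longlonglongrightarrow> 1"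
    unfolding wt_def by real_asymp
  then show ?thesis using LIMSEQ_offset[of "\<lambda>n. wt n / wt (n - j)" j 1] by simp
qed

text \<open>For \<open>j \<le> h n\<close> the index \<open>n - j\<close> is at least n/2, so
  \<open>\<bar>g (n - j)\<bar> * wt n\<close> is bounded by \<open>4 * K\<close> and Tannery's
  theorem applies. The cut \<open>h\<close> is left open because the two halves of a convolution end
  at \<open>n div 2\<close> and \<open>(n - 1) div 2\<close>.\<close>

lemma half_convolution_tendsto:
  fixes f g :: "nat \<Rightarrow> real"
  assumes f: "summable (\<lambda>n. \<bar>f n\<bar>)" and g: "(\<lambda>n. g n * wt n) \<longlonglongrightarrow> d"
    and K: "\<And>n. \<bar>g n\<bar> \<le> K / wt n" "K > 0"
    and h: "\<And>n. h n \<le> n div 2" "filterlim h at_top sequentially"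
  shows "(\<lambda>n. (\<Sum>j\<le>h n. f j * g (n - j)) * wt n) \<longlonglongrightarrow> suminf f * d"
proof -
  define a where "a j n = (if j \<le> h n then f j * g (n - j) * wt n else 0)" for j n
  have "(\<lambda>n. \<Sum>j. a j n) \<longlonglongrightarrow> (\<Sum>j. f j * d)"
  proof (rule tannerys_theorem[THEN conjunct2, THEN conjunct2])
    fix j
    have "(\<lambda>n. g (n - j) * wt (n - j)) \<longlonglongrightarrow> d"
      using g by (rule filterlim_compose) (rule filterlim_minus_const_nat_at_top)
    then have "(\<lambda>n. f j * ((g (n - j) * wt (n - j)) * (wt n / wt (n - j)))) \<longlonglongrightarrow> f j * (d * 1)"
      by (intro tendsto_mult tendsto_const wt_ratio_tendsto)
    moreover have "eventually (\<lambda>n. f j * ((g (n - j) * wt (n - j)) * (wt n / wt (n - j))) = a j n) sequentially"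
      using filterlim_at_top[THEN iffD1, OF h(2), rule_format, of j]
      by eventually_elim (simp add: a_def)
    ultimately show "(\<lambda>n. a j n) \<longlonglongrightarrow> f j * d"
      by (simp add: filterlim_cong)
  next
    have "norm (a j n) \<le> \<bar>f j\<bar> * (K * 4)" for j n
    proof (cases "j \<le> h n")
      case True
      then have "Suc n \<le> 2 * Suc (n - j)" using h(1)[of n] by simp
      then have w: "wt n \<le> 4 * wt (n - j)" using wt_le_mult[of n 2 "n - j"] by simp
      have "\<bar>g (n - j)\<bar> * wt n \<le> K / wt (n - j) * (4 * wt (n - j))"
        using K w by (intro mult_mono) auto
      then have "\<bar>f j\<bar> * (\<bar>g (n - j)\<bar> * wt n) \<le> \<bar>f j\<bar> * (K * 4)"
        by (intro mult_left_mono) auto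
      then show ?thesis using True by (simp add: a_def abs_mult mult.assoc)
    qed (use K in \<open>simp add: a_def\<close>)
    then show "eventually (\<lambda>(j, n). norm (a j n) \<le> \<bar>f j\<bar> * (K * 4)) (at_top \<times>\<^sub>F sequentially)"
      by (intro always_eventually) auto
    show "summable (\<lambda>j. \<bar>f j\<bar> * (K * 4))" using f by (rule summable_mult2)
  qed simp
  moreover have "(\<Sum>j. a j n) = (\<Sum>j\<le>h n. f j * g (n - j)) * wt n" for n
  proof -
    have "(\<Sum>j. a j n) = (\<Sum>j\<le>h n. a j n)" by (rule suminf_finite) (auto simp: a_def)
    then show ?thesis by (simp add: a_def sum_distrib_right)
  qed
  moreover have "(\<Sum>j. f j * d) = suminf f * d"
    using f summable_rabs_cancel by (intro suminf_mult2[symmetric]) blast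
  ultimately show ?thesis by simp
qed

text \<open>In each half of the convolution one index is at most n/2: the factor with this index
  contributes its sum, the other one its asymptotic constant.\<close>

lemma has_ratio_mult:
  assumes "has_ratio f c" "has_ratio g d"
  shows "has_ratio (f * g) (suminf (fps_nth f) * d + suminf (fps_nth g) * c)"
proof -
  obtain K where K: "K > 0" "\<And>n. \<bar>f $ n\<bar> \<le> K / wt n"
    using has_ratio_imp_bounded[OF assms(1)] by blast
  obtain L where L: "L > 0" "\<And>n. \<bar>g $ n\<bar> \<le> L / wt n"
    using has_ratio_imp_bounded[OF assms(2)] by blast
  have 1: "filterlim (\<lambda>n::nat. n div 2) at_top sequentially" by real_asymp
  have 2: "filterlim (\<lambda>n::nat. (n - 1) div 2) at_top sequentially" 
    by (rule filterlim_compose[OF 1 filterlim_minus_const_nat_at_top])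
  have "(\<lambda>n. (\<Sum>j\<le>n div 2. f $ j * g $ (n - j)) * wt n) \<longlonglongrightarrow> suminf (fps_nth f) * d"
    by (rule half_convolution_tendsto[OF has_ratio_imp_abs_summable _ L(2,1) _ 1])
       (use assms in \<open>auto simp: has_ratio_def\<close>)
  moreover have "(\<lambda>n. (\<Sum>j\<le>(n - 1) div 2. g $ j * f $ (n - j)) * wt n) \<longlonglongrightarrow> suminf (fps_nth g) * c"
    by (rule half_convolution_tendsto[OF has_ratio_imp_abs_summable _ K(2,1) _ 2])
       (use assms in \<open>auto simp: has_ratio_def intro: div_le_mono\<close>)
  ultimately have lim: "(\<lambda>n. (\<Sum>j\<le>n div 2. f $ j * g $ (n - j)) * wt n +
      (\<Sum>j\<le>(n - 1) div 2. g $ j * f $ (n - j)) * wt n)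
      \<longlonglongrightarrow> suminf (fps_nth f) * d + suminf (fps_nth g) * c"
    by (rule tendsto_add)
  \<comment> \<open>At \<open>n = 0\<close> both halves would contain the only term.\<close>
  have split: "(f * g) $ n = (\<Sum>j\<le>n div 2. f $ j * g $ (n - j)) +
      (\<Sum>j\<le>(n - 1) div 2. g $ j * f $ (n - j))" if "n > 0" for n
  proof -
    have "(f * g) $ n = (\<Sum>j\<in>{..n div 2} \<union> {Suc (n div 2)..n}. f $ j * g $ (n - j))"
      unfolding fps_mult_nth by (rule sum.cong) auto
    also have "\<dots> = (\<Sum>j\<le>n div 2. f $ j * g $ (n - j)) +
        (\<Sum>j=Suc (n div 2)..n. f $ j * g $ (n - j))"
      by (rule sum.union_disjoint) auto
    also have "(\<Sum>j=Suc (n div 2)..n. f $ j * g $ (n - j)) =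
        (\<Sum>j\<le>(n - 1) div 2. g $ j * f $ (n - j))"
      by (rule sum.reindex_bij_witness[where i = "\<lambda>j. n - j" and j = "\<lambda>j. n - j"])
         (use that in auto)
    finally show ?thesis .
  qed
  have "eventually (\<lambda>n. (\<Sum>j\<le>n div 2. f $ j * g $ (n - j)) * wt n +
      (\<Sum>j\<le>(n - 1) div 2. g $ j * f $ (n - j)) * wt n = (f * g) $ n * wt n) sequentially"
    using eventually_gt_at_top[of 0] by eventually_elim (simp only: split distrib_right)
  from tendsto_cong[THEN iffD1, OF this lim] show ?thesis unfolding has_ratio_def .
qed

lemma has_ratio_X_mult:
  assumes "has_ratio f c"
  shows "has_ratio (fps_X * f) c"
proof -
  have "summable (\<lambda>n. fps_X $ n * 2 ^ n :: real)"
    by (rule summable_finite[of "{1}"]) auto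
  then have "has_ratio fps_X 0" by (rule has_ratio_0_if_summable) simp
  from has_ratio_mult[OF this assms] show ?thesis
    using suminf_finite[of "{1}" "fps_nth (fps_X :: real fps)"] by simp
qed

text \<open>Convolution constant of \<open>1 / wt\<close>: in the factor 8, 4 comes from
  \<open>wt_le_mult\<close> with \<open>D = 2\<close>, and 2 from the two symmetric sums.\<close>

definition wt_sum :: real where
  "wt_sum = 8 * (\<Sum>n. 1 / wt n)"

lemma wt_convolution_le: "(\<Sum>j\<le>n. 1 / (wt j * wt (n - j))) \<le> wt_sum / wt n"
proof -
  have "1 / (wt j * wt (n - j)) \<le> 4 / wt n * (1 / wt j + 1 / wt (n - j))" if "j \<le> n" for j
  proof -
    have "wt n \<le> 4 * (wt j + wt (n - j))"
    proof (cases "j \<le> n - j")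
      case True
      then have "Suc n \<le> 2 * Suc (n - j)" using that by arith
      then have "wt n \<le> 4 * wt (n - j)" using wt_le_mult[of n 2 "n - j"] by simp
      also have "\<dots> \<le> 4 * (wt j + wt (n - j))" by simp
      finally show ?thesis .
    next
      case False
      then have "Suc n \<le> 2 * Suc j" using that by arith
      then have "wt n \<le> 4 * wt j" using wt_le_mult[of n 2 j] by simp
      also have "\<dots> \<le> 4 * (wt j + wt (n - j))" by simp
      finally show ?thesis .
    qed
    then show ?thesis by (simp add: field_simps)
  qed
  then have "(\<Sum>j\<le>n. 1 / (wt j * wt (n - j))) \<le> (\<Sum>j\<le>n. 4 / wt n * (1 / wt j + 1 / wt (n - j)))"
    by (intro sum_mono) auto
  also have "\<dots> = 4 / wt n * ((\<Sum>j\<le>n. 1 / wt j) + (\<Sum>j\<le>n. 1 / wt (n - j)))"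
    by (simp only: sum.distrib flip: sum_distrib_left)
  also have "(\<Sum>j\<le>n. 1 / wt (n - j)) = (\<Sum>j\<le>n. 1 / wt j)"
    by (rule sum.reindex_bij_witness[where i = "\<lambda>j. n - j" and j = "\<lambda>j. n - j"]) auto
  also have "4 / wt n * ((\<Sum>j\<le>n. 1 / wt j) + (\<Sum>j\<le>n. 1 / wt j)) \<le> 4 / wt n * ((\<Sum>j. 1 / wt j) + (\<Sum>j. 1 / wt j))"
    by (intro mult_left_mono add_mono sum_le_suminf[OF summable_inverse_wt]) auto
  finally show ?thesis by (simp add: wt_sum_def)
qed

lemma wt_sum_nonneg: "wt_sum \<ge> 0"
  unfolding wt_sum_def using summable_inverse_wt by (intro mult_nonneg_nonneg suminf_nonneg) auto

lemma fps_mult_wt_bound: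
  assumes "\<And>n. \<bar>f $ n\<bar> \<le> a / wt n" "\<And>n. \<bar>g $ n\<bar> \<le> b / wt n" "0 \<le> a" "0 \<le> b"
  shows "\<bar>(f * g) $ n\<bar> \<le> wt_sum * a * b / wt n"
proof -
  have "\<bar>(f * g) $ n\<bar> \<le> (\<Sum>j=0..n. \<bar>f $ j * g $ (n - j)\<bar>)"
    unfolding fps_mult_nth by (rule sum_abs)
  also have "\<dots> \<le> (\<Sum>j=0..n. a * b * (1 / (wt j * wt (n - j))))"
  proof (rule sum_mono)
    fix j
    have "\<bar>f $ j\<bar> * \<bar>g $ (n - j)\<bar> \<le> (a / wt j) * (b / wt (n - j))"
      using assms by (intro mult_mono) auto
    then show "\<bar>f $ j * g $ (n - j)\<bar> \<le> a * b * (1 / (wt j * wt (n - j)))"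
      by (simp add: abs_mult)
  qed
  also have "\<dots> = a * b * (\<Sum>j\<le>n. 1 / (wt j * wt (n - j)))"
    by (simp add: sum_distrib_left atLeast0AtMost)
  also have "\<dots> \<le> a * b * (wt_sum / wt n)"
    using assms by (intro mult_left_mono wt_convolution_le) auto
  finally show ?thesis by (simp add: mult_ac)
qed

text \<open>The growth in \<open>m\<close> is only geometric, hence dominated by the factorials of
  the exponential series.\<close>

lemma fps_power_wt_bound:
  assumes "\<And>n. \<bar>f $ n\<bar> \<le> a / wt n" "0 \<le> a"
  shows "\<bar>(f ^ m) $ n\<bar> \<le> (wt_sum * a) ^ m / wt n"
proof (induction m arbitrary: n)
  case (Suc m)
  have "\<bar>(f * f ^ m) $ n\<bar> \<le> wt_sum * a * (wt_sum * a) ^ m / wt n"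
    by (rule fps_mult_wt_bound) (use assms Suc wt_sum_nonneg in auto)
  then show ?case by simp
qed (auto simp: abs_if)

lemma has_ratio_power:
  assumes "has_ratio f c" "fps_nonneg f"
  shows "has_ratio (f ^ m) (real m * c * suminf (fps_nth f) ^ (m - 1))"
    and "suminf (fps_nth (f ^ m)) = suminf (fps_nth f) ^ m"
proof -
  let ?F = "suminf (fps_nth f)"
  show s: "suminf (fps_nth (f ^ m)) = ?F ^ m" for m
  proof -
    have "fsums f 1 ?F" using has_ratio_imp_summable[OF assms(1)] by (simp add: summable_sums)
    from fsums_power[OF this assms(2), of m] show ?thesis by (simp add: sums_iff)
  qed
  show "has_ratio (f ^ m) (real m * c * ?F ^ (m - 1))"
  proof (induction m)
    case 0
    then show ?case using has_ratio_1 by simp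
  next
    case (Suc m)
    have "?F * (real m * c * ?F ^ (m - 1)) + suminf (fps_nth (f ^ m)) * c = real (Suc m) * c * ?F ^ m"
      unfolding s by (cases m) (auto simp: algebra_simps)
    then show ?case using has_ratio_mult[OF assms(1) Suc] by simp
  qed
qed

text \<open>Tannery's theorem over the power \<open>m\<close>, with majorant
  \<open>L ^ m / fact m\<close>; with \<open>F\<close> the sum of the coefficients of
  \<open>f\<close>, the limits \<open>m * c * F ^ (m - 1) / fact m\<close> add up to
  \<open>c * exp F\<close>.\<close>

lemma has_ratio_exp_compose:
  assumes f: "has_ratio f c" "fps_nonneg f" "f $ 0 = 0"
  shows "has_ratio (fps_exp 1 oo f) (c * exp (suminf (fps_nth f)))"
proof -
  let ?F = "suminf (fps_nth f)"
  obtain a where a: "a > 0" "\<And>n. \<bar>f $ n\<bar> \<le> a / wt n"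
    using has_ratio_imp_bounded[OF f(1)] by blast
  define L where "L = wt_sum * a"
  have b: "\<bar>(f ^ m) $ n\<bar> \<le> L ^ m / wt n" for m n
    unfolding L_def using a by (intro fps_power_wt_bound) auto
  have "(\<lambda>n. \<Sum>m. (f ^ m) $ n / fact m * wt n) \<longlonglongrightarrow> (\<Sum>m. real m * c * ?F ^ (m - 1) / fact m)"
  proof (rule tannerys_theorem[THEN conjunct2, THEN conjunct2])
    fix m
    have "(\<lambda>n. ((f ^ m) $ n * wt n) / fact m) \<longlonglongrightarrow> real m * c * ?F ^ (m - 1) / fact m"
      using has_ratio_power(1)[OF f(1,2), of m] unfolding has_ratio_def by (intro tendsto_divide) auto
    then show "(\<lambda>n. (f ^ m) $ n / fact m * wt n) \<longlonglongrightarrow> real m * c * ?F ^ (m - 1) / fact m"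
      by simp
  next
    have "norm ((f ^ m) $ n / fact m * wt n) \<le> L ^ m / fact m" for m n
      using b[of m n] by (simp add: abs_mult field_simps)
    then show "eventually (\<lambda>(m, n). norm ((f ^ m) $ n / fact m * wt n) \<le> L ^ m / fact m) (at_top \<times>\<^sub>F sequentially)"
      by (intro always_eventually) auto
    show "summable (\<lambda>m. L ^ m / fact m)"
      using fsums_exp[of L] by (simp add: sums_iff)
  qed simp
  moreover have "(\<Sum>m. (f ^ m) $ n / fact m * wt n) = (fps_exp 1 oo f) $ n * wt n" for n
  proof -
    have "(\<Sum>m. (f ^ m) $ n / fact m * wt n) = (\<Sum>m=0..n. (f ^ m) $ n / fact m * wt n)"
      by (rule suminf_finite) (auto simp: startsby_zero_power_prefix[OF f(3)])
    then show ?thesis by (simp add: fps_compose_nth sum_distrib_right)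
  qed
  moreover have "(\<Sum>m. real m * c * ?F ^ (m - 1) / fact m) = c * exp ?F"
  proof -
    have "(\<lambda>m. c * ((fps_exp 1) $ m * ?F ^ m)) sums (c * exp ?F)"
      by (intro sums_mult fsums_exp)
    also have "(\<lambda>m. c * ((fps_exp 1) $ m * ?F ^ m)) = (\<lambda>m. real (Suc m) * c * ?F ^ (Suc m - 1) / fact (Suc m))"
    proof
      fix m
      show "c * ((fps_exp 1) $ m * ?F ^ m) = real (Suc m) * c * ?F ^ (Suc m - 1) / fact (Suc m)"
        using mult_divide_mult_cancel_left[of "real (Suc m)" "c * ?F ^ m" "fact m"]
        by (simp add: mult.assoc del: of_nat_Suc)
    qed
    finally have "(\<lambda>m. real m * c * ?F ^ (m - 1) / fact m) sums (c * exp ?F + real 0 * c * ?F ^ (0 - 1) / fact 0)"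
      by (rule sums_Suc)
    then show ?thesis by (simp add: sums_iff)
  qed
  ultimately show ?thesis unfolding has_ratio_def by simp
qed

section \<open>Composition with a series that has an exponential tail\<close>

text \<open>Renewal argument: if \<open>F $ j\<close> is the probability of a step of length
  \<open>j\<close>, the sum is the probability that the walk visits \<open>n\<close> within
  \<open>N\<close> steps. The induction writes the next partial sum as
  \<open>1 + F * V\<close>.\<close>

lemma sum_power_nth_le_1:
  assumes F: "fps_nonneg F" "F $ 0 = 0" "\<And>n. (\<Sum>j\<le>n. F $ j) \<le> 1"
  shows "(\<Sum>m\<le>N. (F ^ m) $ n) \<le> 1"
proof (induction N arbitrary: n)
  case 0
  show ?case by simp
next
  case (Suc N)
  let ?V = "\<Sum>m\<le>N. F ^ m"
  have "(\<Sum>m\<le>Suc N. F ^ m) = 1 + F * ?V"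
    by (simp add: sum.atMost_Suc_shift sum_distrib_left del: sum.atMost_Suc)
  then have e: "(\<Sum>m\<le>Suc N. (F ^ m) $ n) = (1 + F * ?V) $ n"
    by (metis fps_sum_nth)
  show ?case
  proof (cases "n = 0")
    case True
    then show ?thesis unfolding e using F(2) by simp
  next
    case False
    have "(F * ?V) $ n \<le> (\<Sum>j\<le>n. F $ j * 1)"
      unfolding fps_mult_nth atLeast0AtMost
      by (intro sum_mono mult_left_mono) (use F Suc in \<open>auto simp: fps_sum_nth\<close>)
    then show ?thesis unfolding e using F(3)[of n] False by simp
  qed
qed

lemma fps_nth_le_of_fsums:
  assumes "fsums f x y" "fps_nonneg f" "0 < x"
  shows "f $ n \<le> y / x ^ n"
proof -
  have "(\<Sum>k\<in>{n}. f $ k * x ^ k) \<le> (\<Sum>k. f $ k * x ^ k)"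
    by (rule sum_le_suminf) (use assms in \<open>auto simp: sums_iff\<close>)
  then show ?thesis using assms by (simp add: sums_iff field_simps)
qed

text \<open>For \<open>m \<le> n / D\<close> the coefficient of index \<open>n\<close> of
  \<open>F ^ m\<close> is exponentially small because \<open>F\<close> converges at
  \<open>l > 1\<close>. For larger \<open>m\<close> the factor \<open>b $ m\<close> is small against
  \<open>1 / wt n\<close>, and the coefficients of the powers add up to at most 1.\<close>

lemma has_ratio_compose_0:
  assumes F: "fps_nonneg F" "F $ 0 = 0" "\<And>n. (\<Sum>j\<le>n. F $ j) \<le> 1"
    and l: "fsums F l L" "l > 1" and b: "has_ratio b 0"
  shows "has_ratio (b oo F) 0"
proof -
  define m0 where "m0 = (1 + l) / 2"
  have m0: "1 < m0" "m0 < l" using l by (auto simp: m0_def)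
  have L0: "L \<ge> 0" using fsums_nonneg[OF l(1) F(1)] l by simp
  \<comment> \<open>\<open>D\<close> is chosen such that \<open>m * D \<le> n\<close> implies
    \<open>L ^ m \<le> m0 ^ n\<close>, which the denominator \<open>l ^ n\<close> still beats since
    \<open>m0 < l\<close>.\<close>
  obtain D' where "L < m0 ^ D'" using real_arch_pow[OF m0(1)] by blast
  define D where "D = Suc D'"
  have "m0 ^ D' \<le> m0 ^ D" unfolding D_def using m0 by (intro power_increasing) auto
  then have D: "L \<le> m0 ^ D" "D > 0" using \<open>L < m0 ^ D'\<close> by (auto simp: D_def)
  define q where "q = m0 / l"
  have q: "0 \<le> q" "q < 1" using m0 by (auto simp: q_def)
  obtain B where B: "B > 0" "\<And>n. \<bar>b $ n\<bar> \<le> B / wt n"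
    using has_ratio_imp_bounded[OF b] by blast
  have B': "\<bar>b $ n\<bar> \<le> B" for n
  proof -
    have "B / wt n \<le> B / 1" using B(1) wt_mono[of 0 n] by (intro divide_left_mono) auto
    then show ?thesis using B(2)[of n] by simp
  qed
  have Fnn: "0 \<le> (F ^ m) $ n" for m n using fps_nonneg_power[OF F(1)] by blast
  have key: "\<bar>(b oo F) $ n\<bar> * wt n \<le> B * (real (Suc n) * q ^ n * wt n) + real D ^ 2 * d"
    if M0: "\<And>m. m \<ge> M0 \<Longrightarrow> \<bar>b $ m\<bar> * wt m \<le> d" and n: "D * M0 \<le> n" for M0 d n
  proof -
    have d: "d \<ge> 0" using M0[of M0] by (meson abs_ge_zero mult_nonneg_nonneg order_trans wt_nonneg order_refl)
    have tm: "\<bar>b $ m\<bar> * (F ^ m) $ n * wt n \<le> B * q ^ n * wt n + real D ^ 2 * d * (F ^ m) $ n"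
      for m
    proof (cases "m * D \<le> n")
      case True
      have "(F ^ m) $ n \<le> L ^ m / l ^ n"
        by (rule fps_nth_le_of_fsums) (use fsums_power[OF l(1) F(1)] l Fnn in auto)
      also have "\<dots> \<le> (m0 ^ D) ^ m / l ^ n"
        using D L0 l by (intro divide_right_mono power_mono) auto
      also have "\<dots> = m0 ^ (m * D) / l ^ n" by (simp add: power_mult mult.commute flip: power_mult)
      also have "\<dots> \<le> m0 ^ n / l ^ n"
        using True m0 l by (intro divide_right_mono power_increasing) auto
      also have "\<dots> = q ^ n" by (simp add: q_def power_divide)
      finally have "\<bar>b $ m\<bar> * (F ^ m) $ n \<le> B * q ^ n"
        using B B' Fnn by (intro mult_mono) auto
      then have "\<bar>b $ m\<bar> * (F ^ m) $ n * wt n \<le> B * q ^ n * wt n"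
        by (intro mult_right_mono) auto
      moreover have "0 \<le> real D ^ 2 * d * (F ^ m) $ n" using d Fnn by simp
      ultimately show ?thesis by linarith
    next
      case False
      then have "D * M0 < D * m" using n by (metis mult.commute not_le order_le_less_trans)
      then have "M0 \<le> m" by simp
      have "Suc n \<le> D * Suc m" using False by (simp add: mult.commute)
      then have "\<bar>b $ m\<bar> * wt n \<le> \<bar>b $ m\<bar> * (real D ^ 2 * wt m)"
        by (intro mult_left_mono wt_le_mult) auto
      also have "\<dots> = real D ^ 2 * (\<bar>b $ m\<bar> * wt m)" by simp
      also have "\<dots> \<le> real D ^ 2 * d" using M0[OF \<open>M0 \<le> m\<close>] by (intro mult_left_mono) auto
      finally have "\<bar>b $ m\<bar> * wt n * (F ^ m) $ n \<le> real D ^ 2 * d * (F ^ m) $ n"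
        using Fnn by (intro mult_right_mono) auto
      moreover have "0 \<le> B * q ^ n * wt n" using B q by simp
      moreover have "\<bar>b $ m\<bar> * (F ^ m) $ n * wt n = \<bar>b $ m\<bar> * wt n * (F ^ m) $ n" by simp
      ultimately show ?thesis by linarith
    qed
    have "\<bar>(b oo F) $ n\<bar> \<le> (\<Sum>m\<le>n. \<bar>b $ m * (F ^ m) $ n\<bar>)"
      unfolding fps_compose_nth atLeast0AtMost by (rule sum_abs)
    also have "\<dots> = (\<Sum>m\<le>n. \<bar>b $ m\<bar> * (F ^ m) $ n)"
      using Fnn by (simp add: abs_mult)
    finally have "\<bar>(b oo F) $ n\<bar> * wt n \<le> (\<Sum>m\<le>n. \<bar>b $ m\<bar> * (F ^ m) $ n) * wt n"
      by (intro mult_right_mono) auto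
    also have "\<dots> = (\<Sum>m\<le>n. \<bar>b $ m\<bar> * (F ^ m) $ n * wt n)" by (rule sum_distrib_right)
    also have "\<dots> \<le> (\<Sum>m\<le>n. B * q ^ n * wt n + real D ^ 2 * d * (F ^ m) $ n)"
      by (intro sum_mono tm)
    also have "\<dots> = B * (real (Suc n) * q ^ n * wt n) + real D ^ 2 * d * (\<Sum>m\<le>n. (F ^ m) $ n)"
      by (simp add: sum.distrib sum_distrib_left mult_ac)
    also have "\<dots> \<le> B * (real (Suc n) * q ^ n * wt n) + real D ^ 2 * d * 1"
      using sum_power_nth_le_1[OF F] d by (intro add_left_mono mult_left_mono) auto
    finally show ?thesis by simp
  qed
  have D0: "real D ^ 2 > 0" using D by simp
  show ?thesis
    unfolding has_ratio_def
  proof (rule LIMSEQ_I)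
    fix e :: real assume e: "e > 0"
    define d where "d = e / 2 / real D ^ 2"
    have d: "d > 0" using e D0 by (simp add: d_def)
    have "(\<lambda>n. b $ n * wt n) \<longlonglongrightarrow> 0" using b by (simp add: has_ratio_def)
    from LIMSEQ_D[OF this d] obtain M0 where "\<forall>m\<ge>M0. \<bar>b $ m\<bar> * wt m < d"
      by (auto simp: abs_mult)
    then have M0: "\<And>m. m \<ge> M0 \<Longrightarrow> \<bar>b $ m\<bar> * wt m \<le> d" by (simp add: less_imp_le)
    have "(\<lambda>n. B * (real (Suc n) * q ^ n * wt n)) \<longlonglongrightarrow> B * 0"
      by (intro tendsto_mult_left has_ratio_geometric q)
    from LIMSEQ_D[OF this, of "e / 2"] e obtain N where
      N: "\<And>n. n \<ge> N \<Longrightarrow> \<bar>B * (real (Suc n) * q ^ n * wt n)\<bar> < e / 2" by auto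
    have "norm ((b oo F) $ n * wt n - 0) < e" if "n \<ge> max N (D * M0)" for n
    proof -
      have "\<bar>(b oo F) $ n\<bar> * wt n \<le> B * (real (Suc n) * q ^ n * wt n) + real D ^ 2 * d"
        by (rule key[of M0]) (use M0 that in auto)
      moreover have "B * (real (Suc n) * q ^ n * wt n) < e / 2" using N[of n] that by (auto simp: abs_less_iff)
      moreover have "real D ^ 2 * d = e / 2" using D0 by (simp add: d_def)
      ultimately show ?thesis by (simp add: abs_mult)
    qed
    then show "\<exists>no. \<forall>n\<ge>no. norm ((b oo F) $ n * wt n - 0) < e" by blast
  qed
qed

section \<open>The quotient \<open>(1 - F) / (1 - z)\<close> and its square root\<close>

definition fps_tails :: "real fps \<Rightarrow> real fps" where
  "fps_tails F = Abs_fps (\<lambda>n. 1 - (\<Sum>j\<le>n. F $ j))"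

text \<open>Division by \<open>1 - fps_X\<close> sums up coefficients. If a nonnegative
  \<open>F\<close> sums to 1, the quotient has the tails of \<open>F\<close> as coefficients, which
  are nonnegative as well.\<close>

lemma fps_tails_mult: "(1 - fps_X) * fps_tails F = 1 - F"
proof (rule fps_ext)
  fix n show "((1 - fps_X) * fps_tails F) $ n = (1 - F) $ n"
    by (cases n) (simp_all add: left_diff_distrib fps_tails_def)
qed

definition fps_of_real :: "real fps \<Rightarrow> complex fps" where
  "fps_of_real f = Abs_fps (\<lambda>n. of_real (f $ n))"

lemma fps_of_real_simps [simp]:
  "fps_of_real 1 = 1" "fps_of_real fps_X = fps_X"
  "fps_of_real (f - g) = fps_of_real f - fps_of_real g"
  "fps_of_real (f * g) = fps_of_real f * fps_of_real g"
  by (rule fps_ext; simp add: fps_of_real_def fps_mult_nth)+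

lemma fps_conv_radius_of_real_ge:
  assumes "fsummable f x" "0 \<le> x"
  shows "ereal x \<le> fps_conv_radius (fps_of_real f)"
proof -
  have "summable (\<lambda>n. (fps_of_real f) $ n * of_real x ^ n)"
    using summable_of_real[OF assms(1), where 'a = complex] by (simp add: fps_of_real_def)
  from conv_radius_geI[OF this] show ?thesis using assms(2) by (simp add: fps_conv_radius_def)
qed

text \<open>\<open>F\<close> is the generating function of a step distribution on the positive
  integers: \<open>F_1\<close> excludes periodicity, and \<open>sums_l\<close> at
  \<open>l > 1\<close> expresses the exponential tail.\<close>

locale aperiodic_steps =
  fixes F :: "real fps" and l L :: real
  assumes nonneg: "fps_nonneg F" and F_0: "F $ 0 = 0" and F_1: "F $ (Suc 0) > 0"
    and sums_1: "fps_nth F sums 1" and l: "l > 1" and sums_l: "fsums F l L"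
begin

lemma sum_le_1: "(\<Sum>j\<le>n. F $ j) \<le> 1"
  using sum_le_suminf[of "fps_nth F" "{..n}"] sums_1 nonneg by (auto simp: sums_iff)

definition r0 :: real where "r0 = (1 + l) / 2"

lemma r0: "1 < r0" "r0 < l" using l by (auto simp: r0_def)

lemma tails_nonneg: "fps_nonneg (fps_tails F)"
  using sum_le_1 by (simp add: fps_tails_def)

lemma tails_le: "(fps_tails F) $ n \<le> L / l ^ n"
proof -
  have "(\<Sum>j\<le>N. F $ j) \<le> (\<Sum>j\<le>n. F $ j) + L / l ^ n" if "N \<ge> n" for N
  proof -
    have "{..N} = {..n} \<union> {Suc n..N}" using that by auto
    then have "(\<Sum>j\<le>N. F $ j) = (\<Sum>j\<le>n. F $ j) + (\<Sum>j=Suc n..N. F $ j)"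
      by (simp add: sum.union_disjoint ivl_disj_int)
    also have "(\<Sum>j=Suc n..N. F $ j) \<le> (\<Sum>j=Suc n..N. F $ j * l ^ j / l ^ n)"
    proof (rule sum_mono)
      fix j assume "j \<in> {Suc n..N}"
      then have "1 \<le> l ^ j / l ^ n" using l by (simp add: power_increasing)
      from mult_left_mono[OF this, of "F $ j"] show "F $ j \<le> F $ j * l ^ j / l ^ n"
        using nonneg by simp
    qed
    also have "\<dots> = (\<Sum>j=Suc n..N. F $ j * l ^ j) / l ^ n" by (rule sum_divide_distrib[symmetric])
    also have "\<dots> \<le> L / l ^ n"
      using sum_le_suminf[of "\<lambda>j. F $ j * l ^ j" "{Suc n..N}"] sums_l nonneg l
      by (intro divide_right_mono) (auto simp: sums_iff)
    finally show ?thesis by simp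
  qed
  moreover have "(\<lambda>N. \<Sum>j\<le>N. F $ j) \<longlonglongrightarrow> 1" using sums_1 by (simp add: sums_def_le)
  ultimately have "1 \<le> (\<Sum>j\<le>n. F $ j) + L / l ^ n" by (intro LIMSEQ_le_const2) auto
  then show ?thesis by (simp add: fps_tails_def)
qed

lemma summable_tails: "fsummable (fps_tails F) r0"
proof (rule summable_comparison_test')
  show "summable (\<lambda>n. L * (r0 / l) ^ n)" using r0 by (intro summable_mult summable_geometric) auto
  fix n :: nat assume "0 \<le> n"
  have "(fps_tails F) $ n * r0 ^ n \<le> L / l ^ n * r0 ^ n"
    using tails_le r0 by (intro mult_right_mono) auto
  then show "norm ((fps_tails F) $ n * r0 ^ n) \<le> L * (r0 / l) ^ n"
    using tails_nonneg r0 by (simp add: power_divide)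
qed

abbreviation "Mc \<equiv> fps_of_real (fps_tails F)"

lemma radius_Mc: "ereal r0 \<le> fps_conv_radius Mc"
  using summable_tails r0 by (intro fps_conv_radius_of_real_ge) auto

lemma radius_Fc: "ereal l \<le> fps_conv_radius (fps_of_real F)"
  using sums_l l by (intro fps_conv_radius_of_real_ge) (auto simp: sums_iff)

lemma tails_sum_ge_1: "1 \<le> (\<Sum>n. (fps_tails F) $ n)"
proof -
  have "fsummable (fps_tails F) 1"
    using r0 by (intro summable_fps_mono[OF summable_tails] tails_nonneg) auto
  then have "(\<Sum>n\<in>{0}. (fps_tails F) $ n) \<le> (\<Sum>n. (fps_tails F) $ n)"
    using tails_nonneg by (intro sum_le_suminf) auto
  then show ?thesis by (simp add: fps_tails_def F_0)
qed

text \<open>A zero gives \<open>F z = 1\<close>. Then the nonnegative terms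
  \<open>F $ n * (1 - Re (z ^ n))\<close> sum to 0; the one for \<open>n = 1\<close> forces
  \<open>z = 1\<close>, where the value is the sum of the tails, which is at least 1.\<close>

lemma eval_Mc_nonzero:
  assumes z: "norm z \<le> 1"
  shows "eval_fps Mc z \<noteq> 0"
proof
  assume 0: "eval_fps Mc z = 0"
  have rM: "ereal (norm z) < fps_conv_radius Mc"
    using z r0 radius_Mc by (meson ereal_less_eq(3) less_ereal.simps(1) order_le_less_trans order_less_le_trans)
  have rF: "ereal (norm z) < fps_conv_radius (fps_of_real F)"
    using z l radius_Fc by (meson ereal_less_eq(3) less_ereal.simps(1) order_le_less_trans order_less_le_trans)
  have "(1 - fps_X) * Mc = 1 - fps_of_real F"
    using arg_cong[OF fps_tails_mult[of F], of fps_of_real] by simp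
  moreover have "eval_fps ((1 - fps_X) * Mc) z = eval_fps (1 - fps_X) z * eval_fps Mc z"
    using rM by (intro eval_fps_mult)
      (auto intro!: less_le_trans[OF _ fps_conv_radius_diff])
  moreover have "eval_fps (1 - fps_of_real F) z = 1 - eval_fps (fps_of_real F) z"
    using rF by (subst eval_fps_diff) auto
  ultimately have Fz: "eval_fps (fps_of_real F) z = 1" using 0 by simp
  have "(\<lambda>n. of_real (F $ n) * z ^ n) sums 1"
    using sums_eval_fps[OF rF] Fz by (simp add: fps_of_real_def)
  from sums_Re[OF this] have "(\<lambda>n. F $ n * Re (z ^ n)) sums 1" by simp
  from sums_diff[OF sums_1 this] have s0: "(\<lambda>n. F $ n * (1 - Re (z ^ n))) sums 0"
    by (simp add: right_diff_distrib)
  have nn: "0 \<le> F $ n * (1 - Re (z ^ n))" for n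
  proof -
    have "Re (z ^ n) \<le> norm (z ^ n)" by (rule complex_Re_le_cmod)
    also have "\<dots> \<le> 1" using z by (simp add: norm_power power_le_one)
    finally show ?thesis using nonneg by simp
  qed
  have "(\<Sum>n\<in>{1}. F $ n * (1 - Re (z ^ n))) \<le> (\<Sum>n. F $ n * (1 - Re (z ^ n)))"
    by (rule sum_le_suminf) (use s0 nn in \<open>auto simp: sums_iff\<close>)
  then have "F $ (Suc 0) * (1 - Re z) \<le> 0" using s0 by (simp add: sums_iff)
  then have "1 \<le> Re z" using F_1 by (simp add: mult_le_0_iff)
  moreover have "Re z \<le> 1" using z complex_Re_le_cmod order_trans by blast
  ultimately have "Re z = 1" by simp
  moreover have "Im z = 0"
    using z \<open>Re z = 1\<close> by (simp add: cmod_def)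
  ultimately have z1: "z = 1" by (simp add: complex_eq_iff)
  have "(\<lambda>n. complex_of_real ((fps_tails F) $ n)) sums 0"
    using sums_eval_fps[OF rM] 0 z1 by (simp add: fps_of_real_def)
  then have "fps_nth (fps_tails F) sums 0" using sums_of_real_iff[of "fps_nth (fps_tails F)" 0, where 'a=complex] by simp
  then show False using tails_sum_ge_1 by (simp add: sums_iff)
qed

text \<open>The zeros in a slightly larger closed disc form a compact set; if there are any, one is
  nearest to 0, and its modulus exceeds 1 by \<open>eval_Mc_nonzero\<close>.\<close>

lemma nonzero_radius:
  obtains r where "1 < r" "r \<le> r0" "\<And>z. norm z < r \<Longrightarrow> eval_fps Mc z \<noteq> 0"
proof -
  define r1 where "r1 = (1 + r0) / 2"
  have r1: "1 < r1" "r1 < r0" using r0 by (auto simp: r1_def)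
  define Z where "Z = {z \<in> cball 0 r1. eval_fps Mc z = 0}"
  have cont: "continuous_on (cball 0 r1) (eval_fps Mc)"
    using r1 radius_Mc
    by (intro continuous_on_subset[OF continuous_on_eval_fps])
       (auto simp: in_eball_iff dist_norm intro!: less_le_trans[OF _ radius_Mc])
  have cZ: "compact Z"
    unfolding compact_eq_bounded_closed
  proof
    show "bounded Z" by (rule bounded_subset[OF bounded_cball[of 0 r1]]) (auto simp: Z_def)
    show "closed Z" unfolding Z_def by (rule continuous_closed_preimage_constant[OF cont closed_cball])
  qed
  show ?thesis
  proof (cases "Z = {}")
    case True
    show ?thesis by (rule that[of r1]) (use r1 True in \<open>auto simp: Z_def\<close>)
  next
    case False
    from continuous_attains_inf[OF cZ False continuous_on_norm_id]
    obtain z0 where z0: "z0 \<in> Z" "\<And>z. z \<in> Z \<Longrightarrow> norm z0 \<le> norm z" by auto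
    have "1 < norm z0" using z0(1) eval_Mc_nonzero[of z0] by (force simp: Z_def)
    moreover have le: "norm z0 \<le> r1" using z0(1) by (simp add: Z_def)
    moreover have "eval_fps Mc z \<noteq> 0" if "norm z < norm z0" for z
      using z0(2)[of z] that le by (auto simp: Z_def)
    ultimately show ?thesis using r1 by (intro that[of "norm z0"]) auto
  qed
qed

text \<open>Two square roots are compared: the holomorphic one, from a logarithm on a zero-free
  disc, has the radius of convergence; the formal one, from the binomial series, has real
  coefficients.\<close>

lemma sqrt_tails:
  obtains Q x where "Q ^ 2 = fps_tails F" "Q $ 0 = 1" "x > 1" "fsummable Q x"
proof -
  obtain r where r: "1 < r" "r \<le> r0" "\<And>z. norm z < r \<Longrightarrow> eval_fps Mc z \<noteq> 0"
    using nonzero_radius by blast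
  have hol: "eval_fps Mc holomorphic_on ball 0 r"
    by (intro holomorphic_on_eval_fps)
       (use r in \<open>auto simp: in_eball_iff dist_norm intro!: less_le_trans[OF _ radius_Mc]\<close>)
  obtain g where g: "g holomorphic_on ball 0 r" "\<And>z. z \<in> ball 0 r \<Longrightarrow> exp (g z) = eval_fps Mc z"
    by (rule holomorphic_logarithm_exists[OF _ _ hol, of 0]) (use r in auto)
  define q where "q = (\<lambda>z. exp (g z / 2))"
  have q: "q holomorphic_on ball 0 r" unfolding q_def by (intro holomorphic_intros g) auto
  have q2: "q z * q z = eval_fps Mc z" if "z \<in> ball 0 r" for z
    using g(2)[OF that] by (simp add: q_def flip: exp_add)
  define Qc where "Qc = fps_expansion q 0"
  have exQ: "q has_fps_expansion Qc"
    unfolding Qc_def by (rule has_fps_expansion_fps_expansion[OF _ _ q]) (use r in auto)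
  have "fps_conv_radius Mc > 0" using radius_Mc r0 by (auto intro!: less_le_trans[OF _ radius_Mc])
  then have "eval_fps Mc has_fps_expansion Mc" by (rule eval_fps_has_fps_expansion)
  moreover have "eventually (\<lambda>z. q z * q z = eval_fps Mc z) (nhds 0)"
  proof -
    have "eventually (\<lambda>z::complex. z \<in> ball 0 r) (nhds 0)"
      using r by (intro eventually_nhds_in_open) auto
    then show ?thesis by eventually_elim (rule q2)
  qed
  ultimately have "(\<lambda>z. q z * q z) has_fps_expansion Mc"
    using has_fps_expansion_cong[of "\<lambda>z. q z * q z" "eval_fps Mc" Mc Mc] by simp
  from fps_expansion_unique_complex[OF has_fps_expansion_mult[OF exQ exQ] this]
  have Qc2: "Qc * Qc = Mc" .
  define Q where "Q = fps_binomial (1/2) oo (fps_tails F - 1)"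
  have t0: "(fps_tails F - 1) $ 0 = 0" by (simp add: fps_tails_def F_0)
  have "Q ^ 2 = (fps_binomial (1/2) ^ 2) oo (fps_tails F - 1)"
    unfolding Q_def by (rule fps_compose_power[OF t0])
  also have "fps_binomial (1/2 :: real) ^ 2 = 1 + fps_X"
    by (simp add: fps_binomial_power fps_binomial_1)
  also have "(1 + fps_X) oo (fps_tails F - 1) = fps_tails F"
    using t0 by (simp add: fps_compose_add_distrib)
  finally have Q2: "Q ^ 2 = fps_tails F" .
  have "fps_of_real Q * fps_of_real Q = Mc"
    using arg_cong[OF Q2, of fps_of_real] by (simp add: power2_eq_square)
  \<comment> \<open>Formal power series over a field have no zero divisors, so the two roots agree
    up to sign, hence in the absolute values of their coefficients.\<close>
  then have "(Qc - fps_of_real Q) * (Qc + fps_of_real Q) = 0"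
    using Qc2 by (simp add: algebra_simps)
  then have "Qc = fps_of_real Q \<or> Qc = - fps_of_real Q"
    by (metis eq_neg_iff_add_eq_0 mult_eq_0_iff right_minus_eq)
  then have nQ: "norm (Qc $ n) = \<bar>Q $ n\<bar>" for n
    by (auto simp: fps_of_real_def)
  have rQ: "ereal r \<le> fps_conv_radius Qc"
    unfolding Qc_def using q by (intro conv_radius_fps_expansion) simp
  define x where "x = (1 + r) / 2"
  have x: "1 < x" "x < r" using r by (auto simp: x_def)
  have "ereal (norm (complex_of_real x)) < conv_radius (fps_nth Qc)"
    using x rQ unfolding fps_conv_radius_def by (intro less_le_trans[OF _ rQ[unfolded fps_conv_radius_def]]) auto
  from abs_summable_in_conv_radius[OF this]
  have "summable (\<lambda>n. \<bar>Q $ n * x ^ n\<bar>)"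
    using x by (simp add: norm_mult norm_power nQ abs_mult)
  then have "fsummable Q x" by (rule summable_rabs_cancel)
  then show ?thesis using Q2 x by (intro that[of Q x]) (auto simp: Q_def)
qed

end

lemma fps_square_eqD:
  fixes P R :: "real fps"
  assumes "P ^ 2 = R ^ 2" "P $ 0 = 1" "R $ 0 = 1"
  shows "P = R"
proof -
  have "(P - R) * (P + R) = 0" using assms(1) by (simp add: algebra_simps power2_eq_square)
  moreover have "P + R \<noteq> 0" using assms(2,3) by (metis fps_add_nth fps_zero_nth one_add_one zero_neq_numeral)
  ultimately show ?thesis by simp
qed

definition sqrt_fps :: "real fps" where
  "sqrt_fps = fps_binomial (1/2) oo (- fps_X)"

lemma sqrt_fps_power2: "sqrt_fps ^ 2 = 1 - fps_X"
proof -
  have "sqrt_fps ^ 2 = (fps_binomial (1/2) ^ 2) oo (- fps_X)"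
    unfolding sqrt_fps_def by (rule fps_compose_power) simp
  also have "fps_binomial (1/2 :: real) ^ 2 = 1 + fps_X"
    by (simp add: fps_binomial_power fps_binomial_1)
  finally show ?thesis by (simp add: fps_compose_add_distrib)
qed

text \<open>Up to sign the coefficients are the binomial coefficients of 1/2, of order
  \<open>n powr (-3/2)\<close> with constant \<open>1 / Gamma (-1/2)\<close>. Only its being nonzero
  matters, which holds because -1/2 is not a pole of \<open>Gamma\<close>.\<close>

lemma has_ratio_sqrt_fps:
  obtains s where "s \<noteq> 0" "has_ratio sqrt_fps s"
proof -
  define s where "s = inverse (Gamma (- (1/2) :: real))"
  have "- (1/2) \<notin> (\<int>\<^sub>\<le>\<^sub>0 :: real set)"
  proof
    assume "- (1/2) \<in> (\<int>\<^sub>\<le>\<^sub>0 :: real set)"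
    then have "- (1/2 :: real) \<in> \<int>" using nonpos_Ints_Int by blast
    then have "(1/2 :: real) \<in> \<int>" using Ints_minus by fastforce
    then show False using fraction_not_in_Ints[of 2 1, where 'a = real] by simp
  qed
  then have s: "s \<noteq> 0" by (simp add: s_def Gamma_eq_zero_iff)
  have "(\<lambda>n. ((1/2 :: real) gchoose n) / ((-1) ^ n / exp ((1/2 + 1) * of_real (ln (real n))))) \<longlonglongrightarrow> s"
    unfolding s_def by (rule gbinomial_asymptotic)
  moreover have "(\<lambda>n. wt n / exp ((1/2 + 1) * ln (real n))) \<longlonglongrightarrow> 1"
    unfolding wt_def by real_asymp
  ultimately have "(\<lambda>n. ((1/2 :: real) gchoose n) / ((-1) ^ n / exp ((1/2 + 1) * of_real (ln (real n))))
      * (wt n / exp ((1/2 + 1) * ln (real n)))) \<longlonglongrightarrow> s * 1"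
    by (rule tendsto_mult)
  also have "(\<lambda>n. ((1/2 :: real) gchoose n) / ((-1) ^ n / exp ((1/2 + 1) * of_real (ln (real n))))
      * (wt n / exp ((1/2 + 1) * ln (real n)))) = (\<lambda>n. sqrt_fps $ n * wt n)"
  proof
    fix n
    have "((-1 :: real) ^ n) * (-1) ^ n = 1" by (simp flip: power_mult_distrib)
    then have "1 / (-1 :: real) ^ n = (-1) ^ n" by (metis nonzero_eq_divide_eq power_eq_0_iff zero_neq_neg_one)
    then show "((1/2 :: real) gchoose n) / ((-1) ^ n / exp ((1/2 + 1) * of_real (ln (real n))))
      * (wt n / exp ((1/2 + 1) * ln (real n))) = sqrt_fps $ n * wt n"
      unfolding sqrt_fps_def fps_compose_uminus' by (simp add: field_simps)
  qed
  finally have "has_ratio sqrt_fps s" by (simp add: has_ratio_def)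
  with s show ?thesis by (rule that)
qed

context aperiodic_steps
begin

lemma sqrt_compose:
  assumes "Q ^ 2 = fps_tails F" "Q $ 0 = 1"
  shows "sqrt_fps oo F = sqrt_fps * Q"
proof (rule fps_square_eqD)
  have "(sqrt_fps oo F) ^ 2 = (1 - fps_X) oo F"
    using fps_compose_power[OF F_0, of sqrt_fps 2] by (simp add: sqrt_fps_power2)
  also have "\<dots> = 1 - F" using F_0 by (simp add: fps_compose_sub_distrib)
  also have "\<dots> = (sqrt_fps * Q) ^ 2"
    by (simp add: power_mult_distrib sqrt_fps_power2 assms fps_tails_mult)
  finally show "(sqrt_fps oo F) ^ 2 = (sqrt_fps * Q) ^ 2" .
qed (simp_all add: sqrt_fps_def assms)

text \<open>Subtracting \<open>K / s\<close> times \<open>sqrt_fps\<close> leaves a negligible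
  series, which stays negligible after composition. The subtracted part composes to a multiple of
  \<open>sqrt_fps * Q\<close>, where the coefficients of \<open>Q\<close> are negligible, so only
  its sum enters the constant.\<close>

theorem has_ratio_compose:
  assumes a: "fps_nonneg a" "has_ratio a K" "K > 0"
  obtains C where "C > 0" "has_ratio (a oo F) C"
proof -
  obtain s where s: "s \<noteq> 0" "has_ratio sqrt_fps s" using has_ratio_sqrt_fps by blast
  obtain Q x where Q: "Q ^ 2 = fps_tails F" "Q $ 0 = 1" "x > 1" "fsummable Q x"
    using sqrt_tails by blast
  define b where "b = a - fps_const (K / s) * sqrt_fps"
  have "has_ratio b (K - K / s * s)"
    unfolding b_def by (intro has_ratio_diff a has_ratio_cmult s)
  then have "has_ratio b 0" using s by simp
  then have b: "has_ratio (b oo F) 0"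
    by (rule has_ratio_compose_0[OF nonneg F_0 sum_le_1 sums_l l])
  have "has_ratio Q 0" by (rule has_ratio_0_if_summable[OF Q(4,3)])
  from has_ratio_mult[OF s(2) this] have "has_ratio (sqrt_fps oo F) (suminf (fps_nth Q) * s)"
    by (simp add: sqrt_compose[OF Q(1,2)])
  then have "has_ratio (fps_const (K / s) * (sqrt_fps oo F) + (b oo F)) (K / s * (suminf (fps_nth Q) * s) + 0)"
    by (intro has_ratio_add has_ratio_cmult b)
  also have "fps_const (K / s) * (sqrt_fps oo F) + (b oo F) = a oo F"
    unfolding b_def fps_compose_sub_distrib by (simp add: fps_compose_mult_distrib[OF F_0])
  also have "K / s * (suminf (fps_nth Q) * s) + 0 = K * suminf (fps_nth Q)" using s by simp
  finally have ratio: "has_ratio (a oo F) (K * suminf (fps_nth Q))" .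
  \<comment> \<open>The constant is nonnegative as a limit of nonnegative numbers. It is not 0,
    since the square of \<open>suminf (fps_nth Q)\<close> is the value of \<open>fps_tails F\<close>
    at 1, which is at least 1.\<close>
  have "K * suminf (fps_nth Q) \<ge> 0"
    using ratio fps_nonneg_compose[OF nonneg a(1)] unfolding has_ratio_def
    by (intro LIMSEQ_le_const[of _ _ 0]) auto
  moreover have "suminf (fps_nth Q) \<noteq> 0"
  proof
    assume "suminf (fps_nth Q) = 0"
    then have 0: "eval_fps Q 1 = 0" by (simp add: eval_fps_def)
    have "ereal (norm x) \<le> fps_conv_radius Q"
      unfolding fps_conv_radius_def by (rule conv_radius_geI[OF Q(4)])
    moreover have "ereal (norm (1::real)) < ereal (norm x)" using Q(3) by simp
    ultimately have r: "ereal (norm (1::real)) < fps_conv_radius Q" by (rule less_le_trans[rotated])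
    have "eval_fps (Q * Q) 1 = 0" by (subst eval_fps_mult[OF r r]) (simp add: 0)
    then have "(\<Sum>n. (fps_tails F) $ n) = 0"
      using Q(1) by (simp add: eval_fps_def power2_eq_square)
    then show False using tails_sum_ge_1 by simp
  qed
  ultimately have "K * suminf (fps_nth Q) > 0" using a(3) by (simp add: less_le)
  then show ?thesis using ratio by (rule that)
qed

end

section \<open>Rescaling the singularity to 1; the coefficients of \<open>T_gf\<close>\<close>

definition fps_scale :: "real \<Rightarrow> real fps \<Rightarrow> real fps" where
  "fps_scale r f = Abs_fps (\<lambda>n. r ^ n * f $ n)"

lemma fps_scale_nth [simp]: "(fps_scale r f) $ n = r ^ n * f $ n"
  by (simp add: fps_scale_def)

lemma fps_scale_altdef: "fps_scale r f = f oo (fps_const r * fps_X)"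
  by (simp add: fps_scale_def fps_compose_linear)

lemma fps_scale_compose: "f $ 0 = 0 \<Longrightarrow> fps_scale r (g oo f) = g oo fps_scale r f"
  unfolding fps_scale_altdef by (rule fps_compose_assoc[symmetric]) auto

lemma fps_scale_mult: "fps_scale r (f * g) = fps_scale r f * fps_scale r g"
  unfolding fps_scale_altdef by (rule fps_compose_mult_distrib) auto

lemma fps_scale_diff: "fps_scale r (f - g) = fps_scale r f - fps_scale r g"
  and fps_scale_add: "fps_scale r (f + g) = fps_scale r f + fps_scale r g"
  and fps_scale_1 [simp]: "fps_scale r 1 = 1"
  and fps_scale_X [simp]: "fps_scale r fps_X = fps_const r * fps_X"
  by (rule fps_ext; simp add: algebra_simps)+

lemma fps_nonneg_scale: "fps_nonneg f \<Longrightarrow> 0 \<le> r \<Longrightarrow> fps_nonneg (fps_scale r f)"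
  by simp

lemma fsums_scale: "fsums (fps_scale r f) x y \<longleftrightarrow> fsums f (r * x) y"
  by (simp add: power_mult_distrib mult_ac)

lemma fps_compose_scale_const:
  "fps_scale (inverse c) a oo (fps_const c * f) = a oo f" if "c \<noteq> 0" for c :: real
proof (rule fps_ext)
  fix n show "(fps_scale (inverse c) a oo (fps_const c * f)) $ n = (a oo f) $ n"
    using that by (simp add: fps_compose_nth power_mult_distrib field_simps)
qed

text \<open>Stirling's formula without its constant: the logarithm of the ratio has summable increments.\<close>
lemma has_ratio_tree_fps:
  obtains K where "K > 0" "has_ratio (fps_scale (exp (-1)) tree_fps) K"
proof -
  \<comment> \<open>For \<open>n > 0\<close> this is the logarithm of
    \<open>n powr (n + 1/2) * exp (- n) / fact n\<close>.\<close>
  define c where "c n = (real n + 1/2) * ln (real n) - real n - ln (fact n)" for n :: nat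
  have diff: "c (Suc n) - c n = (real n + 1/2) * (ln (real n + 1) - ln (real n)) - 1" for n
  proof -
    have "ln (fact (Suc n) :: real) = ln (real (Suc n)) + ln (fact n)"
      unfolding fact_Suc by (subst ln_mult) auto
    then show ?thesis by (simp add: c_def algebra_simps)
  qed
  have "summable (\<lambda>n. c (Suc n) - c n)"
  proof (rule summable_comparison_test_bigo)
    show "summable (\<lambda>n. norm (1 / real n ^ 2))"
      using inverse_power_summable[of 2, where 'a = real] by (simp add: divide_inverse)
    show "(\<lambda>n. c (Suc n) - c n) \<in> O(\<lambda>n. 1 / real n ^ 2)"
      unfolding diff by real_asymp
  qed
  then have "convergent (\<lambda>n. \<Sum>k<n. c (Suc k) - c k)" by (simp add: summable_iff_convergent)
  then obtain C where "(\<lambda>n. \<Sum>k<n. c (Suc k) - c k) \<longlonglongrightarrow> C" by (auto simp: convergent_def)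
  then have "(\<lambda>n. c n - c 0) \<longlonglongrightarrow> C" by (simp add: sum_lessThan_telescope)
  then have "(\<lambda>n. (c n - c 0) + c 0) \<longlonglongrightarrow> C + c 0" by (intro tendsto_intros)
  then have "(\<lambda>n. exp (c n)) \<longlonglongrightarrow> exp (C + c 0)" by (intro tendsto_exp) simp
  moreover have "(\<lambda>n. wt n / real n powr (3/2)) \<longlonglongrightarrow> 1"
    unfolding wt_def by real_asymp
  ultimately have "(\<lambda>n. exp (c n) * (wt n / real n powr (3/2))) \<longlonglongrightarrow> exp (C + c 0) * 1"
    by (rule tendsto_mult)
  moreover have "eventually (\<lambda>n. exp (c n) * (wt n / real n powr (3/2))
      = (fps_scale (exp (-1)) tree_fps) $ n * wt n) sequentially"
    using eventually_gt_at_top[of 0]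
  proof eventually_elim
    case (elim n)
    have "exp (c n) = real n powr (real n + 1/2) * exp (- real n) / fact n"
    proof -
      have e: "exp (c n) = exp ((real n + 1/2) * ln (real n)) / exp (real n) / exp (ln (fact n))"
        by (simp only: c_def exp_diff)
      have p: "real n powr (real n + 1/2) = exp ((real n + 1/2) * ln (real n))"
        using elim by (simp add: powr_def)
      have f: "exp (ln (fact n)) = (fact n :: real)" by simp
      show ?thesis unfolding e p f exp_minus by (simp only: divide_inverse)
    qed
    \<comment> \<open>\<open>n + 1/2 = (n - 1) + 3/2\<close> separates the numerator in
      \<open>tree_fps\<close> from the weight.\<close>
    also have "real n powr (real n + 1/2) = real n powr (real (n - 1) + 3/2)"
      using elim by (cases n) (auto simp: add_ac)
    also have "\<dots> = real n ^ (n - 1) * real n powr (3/2)"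
      using elim by (simp only: powr_add powr_realpow of_nat_0_less_iff)
    finally have "exp (c n) = real n ^ (n - 1) * real n powr (3/2) * exp (- real n) / fact n" .
    moreover have "exp (- real n) = exp (-1) ^ n" by (simp flip: exp_of_nat_mult)
    ultimately show ?case using elim by (simp add: tree_fps_def field_simps)
  qed
  ultimately have "(\<lambda>n. (fps_scale (exp (-1)) tree_fps) $ n * wt n) \<longlonglongrightarrow> exp (C + c 0) * 1"
    by (rule Lim_transform_eventually)
  then show ?thesis by (intro that[of "exp (C + c 0)"]) (auto simp: has_ratio_def)
qed

theorem has_ratio_T:
  obtains C where "C > 0" "has_ratio (fps_scale rho T_gf) C"
proof -
  \<comment> \<open>The factor \<open>exp 1\<close> normalizes \<open>F\<close> to
    \<open>F 1 = exp 1 * G rho = 1\<close> and moves the singularity \<open>exp (-1)\<close> of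
    \<open>tree_fps\<close> to 1.\<close>
  define F where "F = fps_const (exp 1) * fps_scale rho G_fps"
  define x where "x = (rho + sqrt rho) / 2"
  have x: "rho < x" "x < sqrt rho" using rho_less_sqrt by (auto simp: x_def)
  have Fs: "fsums F y (exp 1 * G (rho * y))" if "0 \<le> y" "rho * y < sqrt rho" for y
  proof -
    have "fsums (fps_scale rho G_fps) y (G (rho * y))"
      unfolding fsums_scale using that rho_pos by (intro fsums_G_fps) auto
    from sums_mult[OF this, of "exp 1"] show ?thesis by (simp add: F_def mult.assoc)
  qed
  interpret aperiodic_steps F "x / rho" "exp 1 * G x"
  proof
    show "fps_nonneg F" using G_fps_nonneg rho_pos by (simp add: F_def)
    show "F $ 0 = 0" "F $ (Suc 0) > 0" using rho_pos by (simp_all add: F_def)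
    show "fps_nth F sums 1"
      using Fs[of 1] rho_less_sqrt by (simp add: G_rho flip: exp_add)
    show "x / rho > 1" using x rho_pos by simp
    show "fsums F (x / rho) (exp 1 * G x)" using Fs[of "x / rho"] x rho_pos by simp
  qed
  obtain K where K: "K > 0" "has_ratio (fps_scale (exp (-1)) tree_fps) K"
    using has_ratio_tree_fps by blast
  obtain C where C: "C > 0" "has_ratio (fps_scale (exp (-1)) tree_fps oo F) C"
    by (rule has_ratio_compose[OF fps_nonneg_scale[OF fps_nonneg_tree_fps] K(2,1)]) auto
  have "fps_scale (exp (-1)) tree_fps oo F = tree_fps oo fps_scale rho G_fps"
    unfolding F_def using fps_compose_scale_const[of "exp 1" tree_fps] by (simp add: exp_minus)
  also have "\<dots> = fps_scale rho T_gf"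
    by (simp add: T_gf_eq_tree_fps fps_scale_compose)
  finally show ?thesis using C that by simp
qed

section \<open>Limits of the moments\<close>

abbreviation Tv :: "nat \<Rightarrow> real \<Rightarrow> real" where
  "Tv k x \<equiv> eval_fps (Tk_gf k) x"

definition Av :: "nat \<Rightarrow> real \<Rightarrow> real" where
  "Av k x = (\<Sum>i. Tv k (x ^ Suc i) / real (Suc i))"

text \<open>The limit of P (X_n >= k), by \<open>Tk_ratio_tendsto\<close>. By \<open>Tv_Suc\<close>
  the factors are \<open>rho * exp (Av (i - 1) rho)\<close>.\<close>

definition limit_tail :: "nat \<Rightarrow> real" where
  "limit_tail k = (\<Prod>i=1..k. (Tv i rho + rho))"

lemma Tk_gf_le_T_gf: "(Tk_gf k) $ n \<le> T_gf $ n"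
  using Tk_gf_antimono[of 0 k n] by simp

lemma fps_nonneg_Tk_gf: "fps_nonneg (Tk_gf k)"
  by (simp add: Tk_gf_nth_nonneg)

lemma Tk_gf_nth_0 [simp]: "(Tk_gf k) $ 0 = 0"
  by (rule Tk_gf_nth_eq_0) simp

lemma summable_Tk_gf:
  assumes "0 \<le> x" "x \<le> rho"
  shows "fsummable (Tk_gf k) x"
proof (rule summable_fps_mono)
  show "fsummable (Tk_gf k) rho"
    by (rule summable_fps_le[OF summable_T_gf_rho])
       (use Tk_gf_le_T_gf Tk_gf_nth_nonneg rho_pos in auto)
qed (use assms fps_nonneg_Tk_gf in auto)

lemma rho_less_1: "rho < 1" using rho_le_half by simp

lemma fsums_eul_Tk:
  assumes "0 \<le> x" "x \<le> rho"
  shows "fsums (eul (Tk_gf k)) x (Av k x)"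
  unfolding Av_def
  by (rule fsums_eul[OF summable_Tk_gf]) (use assms rho_less_1 fps_nonneg_Tk_gf in auto)

lemma Tv_Suc:
  assumes "0 \<le> x" "x \<le> rho"
  shows "Tv (Suc k) x = x * (exp (Av k x) - 1)"
proof -
  have "fsums (fps_exp 1 oo eul (Tk_gf k)) x (exp (Av k x))"
    by (intro fsums_exp_compose fsums_eul_Tk fps_nonneg_eul fps_nonneg_Tk_gf) (use assms in auto)
  moreover have "fsums 1 x 1"
    using fsums_power[OF fsums_eul_Tk[OF assms] fps_nonneg_eul[OF fps_nonneg_Tk_gf] assms(1), of k 0] by simp
  ultimately have "fsums ((fps_exp 1 oo eul (Tk_gf k)) - 1) x (exp (Av k x) - 1)"
    using sums_diff by (fastforce simp: left_diff_distrib)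
  then have "fsums (Tk_gf (Suc k)) x (x * (exp (Av k x) - 1))"
    unfolding Tk_gf_Suc by (rule fsums_X_mult)
  then show ?thesis by (rule fsums_imp_eval_fps)
qed

lemma Tv_0:
  assumes "0 \<le> x" "x \<le> rho"
  shows "Tv 0 x = x * exp (Av 0 x)"
proof -
  have "fsums (fps_exp 1 oo eul (Tk_gf 0)) x (exp (Av 0 x))"
    by (intro fsums_exp_compose fsums_eul_Tk fps_nonneg_eul fps_nonneg_Tk_gf) (use assms in auto)
  from fsums_X_mult[OF this] show ?thesis
    using T_gf_rec fsums_imp_eval_fps by (simp add: fsums_imp_eval_fps)
qed

lemma Tv_nonneg: "0 \<le> x \<Longrightarrow> x \<le> rho \<Longrightarrow> 0 \<le> Tv k x"
  by (intro eval_fps_nonneg summable_Tk_gf fps_nonneg_Tk_gf)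

lemma Tv_antimono:
  assumes "k \<le> l" "0 \<le> x" "x \<le> rho"
  shows "Tv l x \<le> Tv k x"
  by (rule fsums_le[OF eval_fps_sums eval_fps_sums]) (use assms summable_Tk_gf Tk_gf_antimono in auto)

lemma limit_tail_0 [simp]: "limit_tail 0 = 1"
  by (simp add: limit_tail_def)

lemma limit_tail_Suc: "limit_tail (Suc k) = limit_tail k * (Tv (Suc k) rho + rho)"
  by (simp add: limit_tail_def)

lemma limit_tail_nonneg: "0 \<le> limit_tail k"
  unfolding limit_tail_def using Tv_nonneg[of rho] rho_pos by (intro prod_nonneg) (auto intro: add_nonneg_nonneg)

text \<open>\<open>eulB T_gf\<close> converges beyond \<open>rho\<close>, so after rescaling its
  coefficients decay exponentially, and they dominate those of \<open>eulB (Tk_gf k)\<close>. Hence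
  passing from \<open>Tk_gf k\<close> to its \<open>eul\<close> does not change the
  constant.\<close>

lemma has_ratio_eulB_Tk: "has_ratio (fps_scale rho (eulB (Tk_gf k))) 0"
proof (rule has_ratio_0_le)
  define x where "x = (rho + sqrt rho) / 2"
  have x: "rho < x" "x < sqrt rho" using rho_less_sqrt by (auto simp: x_def)
  have "fsummable (fps_scale rho (eulB T_gf)) (x / rho)"
  proof -
    have "fsummable (eulB T_gf) x"
      using x rho_pos by (intro summable_eulB_T_gf) auto
    moreover have e: "(fps_scale rho (eulB T_gf)) $ n * (x / rho) ^ n = (eulB T_gf) $ n * x ^ n" for n
      using rho_pos by (simp add: power_divide)
    ultimately show ?thesis unfolding e by simp
  qed
  then show "has_ratio (fps_scale rho (eulB T_gf)) 0"
    by (rule has_ratio_0_if_summable) (use x rho_pos in simp)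
  fix n
  have "0 \<le> (eulB (Tk_gf k)) $ n" using fps_nonneg_eulB[OF fps_nonneg_Tk_gf] by simp
  moreover have "(eulB (Tk_gf k)) $ n \<le> (eulB T_gf) $ n"
    by (rule eulB_mono) (use Tk_gf_le_T_gf in auto)
  ultimately show "\<bar>(fps_scale rho (eulB (Tk_gf k))) $ n\<bar> \<le> \<bar>(fps_scale rho (eulB T_gf)) $ n\<bar>"
    using rho_pos by (simp add: abs_mult)
qed

lemma has_ratio_eul_Tk:
  assumes "has_ratio (fps_scale rho (Tk_gf k)) c"
  shows "has_ratio (fps_scale rho (eul (Tk_gf k))) c"
  using has_ratio_add[OF assms has_ratio_eulB_Tk[of k]]
  by (simp add: eul_eq[of "Tk_gf k"] fps_scale_add)

text \<open>One step multiplies the constant by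
  \<open>rho * exp (Av k rho) = Tv (Suc k) rho + rho\<close>, the derivative of
  \<open>rho * exp u\<close> at \<open>u = Av k rho\<close>.\<close>

lemma has_ratio_Tk:
  assumes C: "has_ratio (fps_scale rho T_gf) C"
  shows "has_ratio (fps_scale rho (Tk_gf k)) (C * limit_tail k)"
proof (induction k)
  case (Suc k)
  let ?A = "fps_scale rho (eul (Tk_gf k))"
  have A: "has_ratio ?A (C * limit_tail k)" by (rule has_ratio_eul_Tk[OF Suc])
  have "fsums ?A 1 (Av k rho)" unfolding fsums_scale using fsums_eul_Tk[of rho k] rho_pos by simp
  then have s: "suminf (fps_nth ?A) = Av k rho" by (simp add: sums_iff del: fps_scale_nth)
  have "has_ratio (fps_exp 1 oo ?A) (C * limit_tail k * exp (Av k rho))"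
    using has_ratio_exp_compose[OF A] fps_nonneg_eul[OF fps_nonneg_Tk_gf] rho_pos by (simp add: s)
  from has_ratio_diff[OF this has_ratio_1]
  have "has_ratio ((fps_exp 1 oo ?A) - 1) (C * limit_tail k * exp (Av k rho))" by simp
  from has_ratio_cmult[OF has_ratio_X_mult[OF this], of rho]
  have "has_ratio (fps_const rho * (fps_X * ((fps_exp 1 oo ?A) - 1))) (rho * (C * limit_tail k * exp (Av k rho)))" .
  also have "fps_const rho * (fps_X * ((fps_exp 1 oo ?A) - 1)) = fps_scale rho (Tk_gf (Suc k))"
    unfolding Tk_gf_Suc fps_scale_mult fps_scale_diff fps_scale_X fps_scale_1
    by (simp add: fps_scale_compose mult.assoc)
  also have "rho * (C * limit_tail k * exp (Av k rho)) = C * limit_tail (Suc k)"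
    using Tv_Suc[of rho k] rho_pos by (simp add: limit_tail_Suc algebra_simps)
  finally show ?case .
qed (use C in simp)

lemma T_gf_pos: "n > 0 \<Longrightarrow> T_gf $ n > 0"
  using T_gf_nth_ge_1[of n] by simp

lemma Tk_ratio_tendsto: "(\<lambda>n. (Tk_gf k) $ n / T_gf $ n) \<longlonglongrightarrow> limit_tail k"
proof -
  obtain C where C: "C > 0" "has_ratio (fps_scale rho T_gf) C" using has_ratio_T by blast
  have "(\<lambda>n. ((fps_scale rho (Tk_gf k)) $ n * wt n) / ((fps_scale rho T_gf) $ n * wt n))
      \<longlonglongrightarrow> (C * limit_tail k) / C"
    using has_ratio_Tk[OF C(2), of k] C unfolding has_ratio_def by (intro tendsto_divide) auto
  also have "(\<lambda>n. ((fps_scale rho (Tk_gf k)) $ n * wt n) / ((fps_scale rho T_gf) $ n * wt n))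
      = (\<lambda>n. (Tk_gf k) $ n / T_gf $ n)"
    using rho_pos by (auto simp: field_simps)
  finally show ?thesis using C by simp
qed

section \<open>Geometric decay in \<open>k\<close>, uniformly in \<open>n\<close>\<close>

lemma Tv_rho_tendsto_0: "(\<lambda>k. Tv k rho) \<longlonglongrightarrow> 0"
proof (rule real_tendsto_sandwich[OF _ _ tendsto_const])
  have T: "fsums T_gf rho 1" using eval_fps_sums[OF summable_T_gf_rho] by (simp add: T_rho)
  then have "(\<lambda>k. \<Sum>n\<le>k. T_gf $ n * rho ^ n) \<longlonglongrightarrow> 1" by (simp add: sums_def_le)
  then have "(\<lambda>k. 1 - (\<Sum>n\<le>k. T_gf $ n * rho ^ n)) \<longlonglongrightarrow> 1 - 1" by (intro tendsto_intros)
  then show "(\<lambda>k. 1 - (\<Sum>n\<le>k. T_gf $ n * rho ^ n)) \<longlonglongrightarrow> 0" by simp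
  show "eventually (\<lambda>k. 0 \<le> Tv k rho) sequentially" using Tv_nonneg rho_pos by simp
  \<comment> \<open>\<open>Tk_gf k\<close> vanishes up to index \<open>k\<close> and is below
    \<open>T_gf\<close> after it, so its value is at most a tail of the convergent series
    \<open>T_gf\<close> at \<open>rho\<close>.\<close>
  have "Tv k rho \<le> 1 - (\<Sum>n\<le>k. T_gf $ n * rho ^ n)" for k
  proof (rule sums_le)
    show "fsums (Tk_gf k) rho (Tv k rho)" using rho_pos by (intro eval_fps_sums summable_Tk_gf) auto
    have "(\<lambda>n. if n \<in> {..k} then T_gf $ n * rho ^ n else 0) sums (\<Sum>n\<in>{..k}. T_gf $ n * rho ^ n)"
      by (rule sums_If_finite_set) simp
    from sums_diff[OF T this]
    show "(\<lambda>n. T_gf $ n * rho ^ n - (if n \<in> {..k} then T_gf $ n * rho ^ n else 0)) sums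
        (1 - (\<Sum>n\<le>k. T_gf $ n * rho ^ n))" .
    show "(Tk_gf k) $ n * rho ^ n \<le> T_gf $ n * rho ^ n - (if n \<in> {..k} then T_gf $ n * rho ^ n else 0)" for n
      using Tk_gf_le_T_gf[of k n] Tk_gf_nth_eq_0[of n k] rho_pos by (auto intro: mult_right_mono)
  qed
  then show "eventually (\<lambda>k. Tv k rho \<le> 1 - (\<Sum>n\<le>k. T_gf $ n * rho ^ n)) sequentially" by simp
qed

text \<open>The inequality holds between the outer series, since
  \<open>1 / fact (Suc j) \<le> 1 / fact j\<close>, and composition with a nonnegative series
  preserves it.\<close>

lemma exp_compose_minus_1_le:
  assumes "fps_nonneg a" "a $ 0 = 0"
  shows "((fps_exp 1 oo a) - 1) $ n \<le> (a * (fps_exp 1 oo a)) $ n"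
proof -
  have "((fps_exp 1 - 1) oo a) $ n \<le> ((fps_X * fps_exp 1) oo a) $ n"
    unfolding fps_compose_nth
  proof (intro sum_mono mult_right_mono)
    fix i
    show "(fps_exp 1 - 1) $ i \<le> (fps_X * fps_exp (1 :: real)) $ i"
    proof (cases i)
      case (Suc j)
      have "(1 :: real) / fact (Suc j) \<le> 1 / fact j"
        by (intro divide_left_mono fact_mono) auto
      then show ?thesis using Suc by (simp del: fact_Suc)
    qed simp
  qed (use fps_nonneg_power[OF assms(1)] in auto)
  then show ?thesis
    by (simp add: fps_compose_sub_distrib fps_compose_mult_distrib[OF assms(2)] assms(2))
qed

text \<open>The explicit factor \<open>eul (Tk_gf k)\<close> passes a bound \<open>a * T_gf\<close>
  for \<open>Tk_gf k\<close> on to the next series; the other factor is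
  \<open>fps_X * exp (eul (Tk_gf k))\<close>.\<close>

lemma Tk_gf_Suc_le:
  "(Tk_gf (Suc k)) $ n \<le> (eul (Tk_gf k) * (Tk_gf (Suc k) + fps_X)) $ n"
proof -
  let ?E = "fps_exp 1 oo eul (Tk_gf k)"
  have "(fps_X * (?E - 1)) $ n \<le> (fps_X * (eul (Tk_gf k) * ?E)) $ n"
    using exp_compose_minus_1_le[OF fps_nonneg_eul[OF fps_nonneg_Tk_gf] eul_nth_0]
    by (cases n) auto
  also have "fps_X * (eul (Tk_gf k) * ?E) = eul (Tk_gf k) * (Tk_gf (Suc k) + fps_X)"
    unfolding Tk_gf_Suc by (simp add: algebra_simps)
  finally show ?thesis unfolding Tk_gf_Suc .
qed

lemma eul_Tk_le:
  assumes "\<And>n. (Tk_gf k) $ n \<le> a * T_gf $ n"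
  shows "(eul (Tk_gf k)) $ n \<le> a * (eul T_gf) $ n"
proof -
  have "(eul (Tk_gf k)) $ n \<le> (eul (fps_const a * T_gf)) $ n"
    by (rule eul_mono) (use assms in simp)
  also have "\<dots> = a * (eul T_gf) $ n"
    by (simp add: eul_def sum_distrib_left mult_ac)
  finally show ?thesis .
qed

lemma eul_Tk_nth_eq_0:
  assumes "n \<le> k"
  shows "(eul (Tk_gf k)) $ n = 0"
proof (cases "n = 0")
  case False
  then show ?thesis unfolding eul_def fps_nth_Abs_fps
    using assms by (intro sum.neutral) (auto dest!: dvd_imp_le simp: Tk_gf_nth_eq_0)
qed simp

text \<open>Restricting \<^term>\<open>eul T_gf\<close> to large indices removes the part of the limit of the convolution
  that is not small; this makes the constant below smaller than 1.\<close>
lemma Tk_contraction: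
  "\<exists>k2. \<forall>k\<ge>k2. \<forall>a\<ge>0. (\<forall>n. (Tk_gf k) $ n \<le> a * T_gf $ n)
    \<longrightarrow> (\<forall>n. (Tk_gf (Suc k)) $ n \<le> 7/8 * a * T_gf $ n)"
proof -
  obtain C where C: "C > 0" "has_ratio (fps_scale rho T_gf) C" using has_ratio_T by blast
  have "eventually (\<lambda>k. Tv k rho < 1/8) sequentially"
    using Tv_rho_tendsto_0 by (rule order_tendstoD) simp
  then obtain k1 where k1: "Tv k1 rho < 1/8" by (auto simp: eventually_sequentially)
  define h where "h = Tk_gf k1 + fps_X"
  have hs: "fps_nth (fps_scale rho h) sums (Tv k1 rho + rho)"
  proof -
    have "fsums fps_X rho (rho * 1)"
      using sums_single[of 1 "\<lambda>_. rho"] by (simp add: if_distrib[of "\<lambda>x. x * _"] cong: if_cong)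
    then have "fsums h rho (Tv k1 rho + rho)"
      unfolding h_def using sums_add[OF eval_fps_sums[OF summable_Tk_gf[of rho k1]], of "\<lambda>n. fps_X $ n * rho ^ n" rho] rho_pos
      by (simp add: distrib_right)
    then have "fsums (fps_scale rho h) 1 (Tv k1 rho + rho)" unfolding fsums_scale by simp
    then show ?thesis by (simp del: fps_scale_nth)
  qed
  have hr: "has_ratio (fps_scale rho h) (C * limit_tail k1)"
  proof -
    have "has_ratio (fps_const rho * (fps_X * 1)) (rho * 0)"
      by (intro has_ratio_cmult has_ratio_X_mult has_ratio_1)
    from has_ratio_add[OF has_ratio_Tk[OF C(2), of k1] this] show ?thesis
      by (simp add: h_def fps_scale_add)
  qed
  define A where "A = fps_scale rho (eul T_gf)"
  have Ar: "has_ratio A C" using has_ratio_eul_Tk[of 0] C(2) by (simp add: A_def)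
  have As: "fps_nth A sums Av 0 rho"
  proof -
    have "fsums A 1 (Av 0 rho)"
      unfolding A_def fsums_scale using fsums_eul_Tk[of rho 0] rho_pos by simp
    then show ?thesis by simp
  qed
  have Ann: "fps_nonneg A" using fps_nonneg_eul[OF T_gf_nonneg] rho_pos by (simp add: A_def)
  have "(\<lambda>K. (Av 0 rho - (\<Sum>n<K. A $ n)) * limit_tail k1) \<longlonglongrightarrow> (Av 0 rho - Av 0 rho) * limit_tail k1"
    using As unfolding sums_def by (intro tendsto_intros)
  then have "eventually (\<lambda>K. (Av 0 rho - (\<Sum>n<K. A $ n)) * limit_tail k1 < 1/8) sequentially"
    by (intro order_tendstoD) auto
  then obtain K where K: "(Av 0 rho - (\<Sum>n<K. A $ n)) * limit_tail k1 < 1/8"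
    by (auto simp: eventually_sequentially)
  \<comment> \<open>For \<open>k \<ge> K\<close> the series \<open>eul (Tk_gf k)\<close> has no
    coefficient below \<open>K\<close>, so \<open>fps_const a * B\<close> still dominates it. The
    cut leaves the constant \<open>C\<close> unchanged but makes the sum small.\<close>
  define B where "B = Abs_fps (\<lambda>n. if n < K then 0 else (eul T_gf) $ n)"
  have Bs: "fps_nth (fps_scale rho B) sums (Av 0 rho - (\<Sum>n<K. A $ n))"
  proof -
    have "(\<lambda>n. if n \<in> {..<K} then A $ n else 0) sums (\<Sum>n\<in>{..<K}. A $ n)"
      by (rule sums_If_finite_set) simp
    from sums_diff[OF As this] show ?thesis
      by (rule sums_cong[THEN iffD1, rotated]) (auto simp: A_def B_def)
  qed
  have Br: "has_ratio (fps_scale rho B) C"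
    unfolding has_ratio_def
  proof (rule Lim_transform_eventually)
    show "(\<lambda>n. A $ n * wt n) \<longlonglongrightarrow> C" using Ar by (simp add: has_ratio_def)
    show "eventually (\<lambda>n. A $ n * wt n = (fps_scale rho B) $ n * wt n) sequentially"
      using eventually_ge_at_top[of K] by eventually_elim (simp add: A_def B_def)
  qed
  define M where "M = (Av 0 rho - (\<Sum>n<K. A $ n)) * (C * limit_tail k1) + (Tv k1 rho + rho) * C"
  have "has_ratio (fps_scale rho B * fps_scale rho h) M"
    using has_ratio_mult[OF Br hr] Bs hs by (simp add: M_def sums_iff)
  then have "has_ratio (fps_scale rho (B * h)) M" by (simp add: fps_scale_mult)
  from has_ratio_diff[OF has_ratio_cmult[OF C(2), of "7/8"] this]
  have lim: "has_ratio (fps_const (7/8) * fps_scale rho T_gf - fps_scale rho (B * h)) (7/8 * C - M)" .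
  \<comment> \<open>The three parts are below 1/8 by the choice of \<open>K\<close>, below 1/8 by
    the choice of \<open>k1\<close>, and at most 1/2 by \<open>rho_le_half\<close>; together they
    are less than 7/8.\<close>
  have "M = C * ((Av 0 rho - (\<Sum>n<K. A $ n)) * limit_tail k1 + (Tv k1 rho + rho))"
    by (simp add: M_def algebra_simps)
  also have "\<dots> < C * (7/8)"
    using K k1 rho_le_half C(1) by (intro mult_strict_left_mono) auto
  finally have "7/8 * C - M > 0" by simp
  from order_tendstoD(1)[OF lim[unfolded has_ratio_def] this]
  have "eventually (\<lambda>n. 0 < (fps_const (7/8) * fps_scale rho T_gf - fps_scale rho (B * h)) $ n * wt n) sequentially" .
  then obtain n0 where n0: "\<And>n. n0 \<le> n \<Longrightarrow> 0 < (fps_const (7/8) * fps_scale rho T_gf - fps_scale rho (B * h)) $ n * wt n"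
    by (auto simp: eventually_sequentially)
  have Bh: "(B * h) $ n \<le> 7/8 * T_gf $ n" if "n0 \<le> n" for n
  proof -
    have "0 < rho ^ n * (7/8 * T_gf $ n - fps_nth (B * h) n)"
      using n0[OF that] by (simp add: zero_less_mult_iff algebra_simps)
    then show ?thesis using rho_pos by (simp add: zero_less_mult_iff)
  qed
  show ?thesis
  proof (intro exI[of _ "max (max K n0) k1"] allI impI)
    fix k a n
    assume k: "max (max K n0) k1 \<le> k" and a: "0 \<le> (a::real)"
      and "\<forall>n. (Tk_gf k) $ n \<le> a * T_gf $ n"
    then have le: "\<And>n. (Tk_gf k) $ n \<le> a * T_gf $ n" by blast
    \<comment> \<open>Up to index \<open>Suc k\<close> the left-hand side vanishes; beyond it
      \<open>n \<ge> n0\<close>, so the asymptotic inequality \<open>Bh\<close> applies to every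
      remaining \<open>n\<close>.\<close>
    show "(Tk_gf (Suc k)) $ n \<le> 7/8 * a * T_gf $ n"
    proof (cases "n \<le> Suc k")
      case True
      then show ?thesis using a T_gf_nonneg by (simp add: Tk_gf_nth_eq_0)
    next
      case False
      have "(Tk_gf (Suc k)) $ n \<le> (eul (Tk_gf k) * (Tk_gf (Suc k) + fps_X)) $ n"
        by (rule Tk_gf_Suc_le)
      also have "\<dots> \<le> ((fps_const a * B) * h) $ n"
      proof (rule fps_mult_mono)
        show "(eul (Tk_gf k)) $ m \<le> (fps_const a * B) $ m" for m
        proof (cases "m < K")
          case True
          then show ?thesis using k by (simp add: B_def eul_Tk_nth_eq_0)
        next
          case False
          then show ?thesis using eul_Tk_le[OF le] by (simp add: B_def)
        qed
        show "(Tk_gf (Suc k) + fps_X) $ m \<le> h $ m" for m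
          using Tk_gf_antimono[of k1 "Suc k" m] k by (simp add: h_def)
      qed (use fps_nonneg_eul[OF fps_nonneg_Tk_gf] Tk_gf_nth_nonneg in auto)
      also have "\<dots> = a * (B * h) $ n" by (simp add: mult.assoc)
      also have "\<dots> \<le> a * (7/8 * T_gf $ n)"
        using Bh[of n] False k a by (intro mult_left_mono) auto
      finally show ?thesis by simp
    qed
  qed
qed

lemma Tk_geometric_bound:
  obtains M where "\<And>k n. (Tk_gf k) $ n \<le> M * (7/8) ^ k * T_gf $ n"
proof -
  obtain k2 where k2: "\<forall>k\<ge>k2. \<forall>a\<ge>0. (\<forall>n. (Tk_gf k) $ n \<le> a * T_gf $ n)
    \<longrightarrow> (\<forall>n. (Tk_gf (Suc k)) $ n \<le> 7/8 * a * T_gf $ n)"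
    using Tk_contraction ..
  have ge: "(Tk_gf (k2 + j)) $ n \<le> (7/8) ^ j * T_gf $ n" for j n
  proof (induction j arbitrary: n)
    case (Suc j)
    show ?case using k2[rule_format, of "k2 + j" "(7/8) ^ j" n] Suc by simp
  qed (use Tk_gf_le_T_gf in simp)
  show ?thesis
  \<comment> \<open>The factor \<open>(8/7) ^ k2\<close> gives the trivial bound by
    \<open>T_gf\<close> for \<open>k < k2\<close> the same form.\<close>
  proof (rule that[of "(8/7) ^ k2"])
    fix k n
    have "(8/7 :: real) ^ k2 * (7/8) ^ k2 = 1" by (simp flip: power_mult_distrib)
    show "(Tk_gf k) $ n \<le> (8/7) ^ k2 * (7/8) ^ k * T_gf $ n"
    proof (cases "k2 \<le> k")
      case True
      then obtain j where k: "k = k2 + j" using le_Suc_ex by blast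
      have "(8/7 :: real) ^ k2 * (7/8) ^ k = (7/8) ^ j"
        using \<open>(8/7 :: real) ^ k2 * (7/8) ^ k2 = 1\<close> by (simp add: k power_add mult.assoc[symmetric])
      then show ?thesis using ge[of j n] by (simp add: k)
    next
      case False
      have "1 = (8/7 :: real) ^ k2 * (7/8) ^ k2" using \<open>(8/7 :: real) ^ k2 * (7/8) ^ k2 = 1\<close> by simp
      also have "\<dots> \<le> (8/7) ^ k2 * (7/8) ^ k" using False by (intro mult_left_mono power_decreasing) auto
      finally have "1 * T_gf $ n \<le> (8/7) ^ k2 * (7/8) ^ k * T_gf $ n"
        using T_gf_nonneg by (intro mult_right_mono) auto
      then show ?thesis using Tk_gf_le_T_gf[of k n] by simp
    qed
  qed
qed

text \<open>Tannery's theorem with the majorant \<open>M * (w k * (7/8) ^ k)\<close>. The weights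
  \<open>w k = 1\<close> and \<open>w k = 2 * k + 1\<close> give the first and the second
  moment.\<close>

lemma weighted_sum_tendsto:
  fixes w :: "nat \<Rightarrow> real"
  assumes w: "\<And>k. 0 \<le> w k" "summable (\<lambda>k. w k * (7/8) ^ k)"
  shows "summable (\<lambda>k. w k * limit_tail (Suc k))"
    and "(\<lambda>n. \<Sum>k. w k * ((Tk_gf (Suc k)) $ n / T_gf $ n)) \<longlonglongrightarrow> (\<Sum>k. w k * limit_tail (Suc k))"
proof -
  obtain M where M: "\<And>k n. (Tk_gf k) $ n \<le> M * (7/8) ^ k * T_gf $ n"
    using Tk_geometric_bound by blast
  have M0: "M \<ge> 0" using M[of 0 1] T_gf_pos[of 1] by (simp add: mult_le_cancel_right1)
  have "norm (w k * ((Tk_gf (Suc k)) $ n / T_gf $ n)) \<le> M * (w k * (7/8) ^ k)" for k n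
  proof -
    have "(Tk_gf (Suc k)) $ n / T_gf $ n \<le> M * (7/8) ^ Suc k"
    proof (cases "n = 0")
      case False
      then show ?thesis using M[of "Suc k" n] T_gf_pos[of n] by (simp add: divide_le_eq)
    qed (use M0 in simp)
    also have "\<dots> \<le> M * (7/8) ^ k" using M0 by (intro mult_left_mono power_decreasing) auto
    finally have "w k * ((Tk_gf (Suc k)) $ n / T_gf $ n) \<le> w k * (M * (7/8) ^ k)"
      using w by (intro mult_left_mono) auto
    then show ?thesis using w Tk_gf_nth_nonneg T_gf_nonneg by (simp add: abs_mult mult_ac)
  qed
  then have bound: "eventually (\<lambda>(k, n). norm (w k * ((Tk_gf (Suc k)) $ n / T_gf $ n)) \<le> M * (w k * (7/8) ^ k))
      (at_top \<times>\<^sub>F sequentially)"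
    by (intro always_eventually) auto
  have lim: "(\<lambda>n. w k * ((Tk_gf (Suc k)) $ n / T_gf $ n)) \<longlonglongrightarrow> w k * limit_tail (Suc k)" for k
    by (intro tendsto_mult_left Tk_ratio_tendsto)
  note tan = tannerys_theorem[OF lim bound summable_mult[OF w(2)] sequentially_bot]
  show "(\<lambda>n. \<Sum>k. w k * ((Tk_gf (Suc k)) $ n / T_gf $ n)) \<longlonglongrightarrow> (\<Sum>k. w k * limit_tail (Suc k))"
    using tan by blast
  show "summable (\<lambda>k. w k * limit_tail (Suc k))"
    by (rule summable_norm_cancel[OF tan[THEN conjunct2, THEN conjunct1]])
qed

section \<open>Moments as weighted sums of tail probabilities\<close>

lemma expectation_eq_sum:
  fixes w :: "nat \<Rightarrow> real"
  assumes "n > 0"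
  shows "measure_pmf.expectation (random_polya_tree n) (\<lambda>t. \<Sum>k<protection_number t. w k)
    = (\<Sum>k. w k * ((Tk_gf (Suc k)) $ n / T_gf $ n))"
proof -
  have ne: "polya_trees n \<noteq> {}" using polya_trees_nonempty[of "n - 1"] assms by simp
  \<comment> \<open>The upper end of the sum is moved to \<open>n\<close>, independent of the tree,
    so that the sums can be exchanged.\<close>
  have "(\<Sum>k<protection_number t. w k) = (\<Sum>k<n. if Suc k \<le> protection_number t then w k else 0)"
    if "t \<in> polya_trees n" for t
  proof -
    have "protection_number t < n" using protection_number_less[of t] that by (simp add: polya_trees_def)
    then have "{..<protection_number t} = {..<n} \<inter> {k. Suc k \<le> protection_number t}" by auto
    then show ?thesis by (simp add: sum.inter_restrict)
  qed
  then have "(\<Sum>t\<in>polya_trees n. \<Sum>k<protection_number t. w k) =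
      (\<Sum>t\<in>polya_trees n. \<Sum>k<n. if Suc k \<le> protection_number t then w k else 0)"
    by (rule sum.cong[OF refl])
  also have "\<dots> = (\<Sum>k<n. \<Sum>t\<in>polya_trees n. if Suc k \<le> protection_number t then w k else 0)"
    by (rule sum.swap)
  also have "\<dots> = (\<Sum>k<n. w k * (Tk_gf (Suc k)) $ n)"
  proof (intro sum.cong refl)
    fix k
    have "(\<Sum>t\<in>polya_trees n. if Suc k \<le> protection_number t then w k else 0)
      = (\<Sum>t | t \<in> polya_trees n \<and> Suc k \<le> protection_number t. w k)"
      by (rule sum.inter_filter[symmetric]) (rule finite_polya_trees)
    then show "(\<Sum>t\<in>polya_trees n. if Suc k \<le> protection_number t then w k else 0) = w k * (Tk_gf (Suc k)) $ n"
      by (simp add: Tk_gf_def)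
  qed
  finally have "measure_pmf.expectation (random_polya_tree n) (\<lambda>t. \<Sum>k<protection_number t. w k)
      = (\<Sum>k<n. w k * (Tk_gf (Suc k)) $ n) / T_gf $ n"
    unfolding random_polya_tree_def
    by (subst integral_pmf_of_set[OF ne finite_polya_trees]) (simp add: T_gf_def)
  also have "\<dots> = (\<Sum>k<n. w k * ((Tk_gf (Suc k)) $ n / T_gf $ n))"
    by (simp add: sum_divide_distrib)
  also have "\<dots> = (\<Sum>k. w k * ((Tk_gf (Suc k)) $ n / T_gf $ n))"
    by (rule suminf_finite[symmetric]) (auto simp: Tk_gf_nth_eq_0)
  finally show ?thesis .
qed

lemma expectation_tendsto:
  fixes w :: "nat \<Rightarrow> real"
  assumes w: "\<And>k. 0 \<le> w k" "summable (\<lambda>k. w k * (7/8) ^ k)"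
  shows "(\<lambda>n. measure_pmf.expectation (random_polya_tree n) (\<lambda>t. \<Sum>k<protection_number t. w k))
    \<longlonglongrightarrow> (\<Sum>k. w k * limit_tail (Suc k))"
proof (rule Lim_transform_eventually[OF weighted_sum_tendsto(2)[OF w]])
  show "eventually (\<lambda>n. (\<Sum>k. w k * ((Tk_gf (Suc k)) $ n / T_gf $ n)) =
      measure_pmf.expectation (random_polya_tree n) (\<lambda>t. \<Sum>k<protection_number t. w k)) sequentially"
    using eventually_gt_at_top[of 0] by eventually_elim (simp add: expectation_eq_sum)
qed

lemma sum_odd_eq_square: "(\<Sum>k<m. 2 * real k + 1) = real m ^ 2"
  by (induction m) (auto simp: power2_eq_square algebra_simps)

lemma summable_odd_weights: "summable (\<lambda>k. (2 * real k + 1) * (7/8) ^ k)"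
proof -
  have "summable (\<lambda>k. 2 * (of_nat (Suc k) * (7/8 :: real) ^ k))"
    using geometric_deriv_sums[of "7/8 :: real"] by (intro summable_mult) (auto simp: sums_iff)
  then show ?thesis by (rule summable_comparison_test'[where N = 0]) auto
qed

theorem protection_number_limits:
  defines "m1 \<equiv> (\<Sum>k. limit_tail (Suc k))" and "m2 \<equiv> (\<Sum>k. (2 * real k + 1) * limit_tail (Suc k))"
  shows "(\<lambda>k. limit_tail (Suc k)) sums m1"
    and "(\<lambda>k. (2 * real k + 1) * limit_tail (Suc k)) sums m2"
    and "(\<lambda>n. measure_pmf.expectation (random_polya_tree n) (\<lambda>t. real (protection_number t))) \<longlonglongrightarrow> m1"
    and "(\<lambda>n. measure_pmf.variance (random_polya_tree n) (\<lambda>t. real (protection_number t))) \<longlonglongrightarrow> m2 - m1 ^ 2"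
proof -
  have s: "summable (\<lambda>k. 1 * (7/8 :: real) ^ k)" by (simp add: summable_geometric)
  show "(\<lambda>k. limit_tail (Suc k)) sums m1"
    using weighted_sum_tendsto(1)[of "\<lambda>_. 1"] s by (simp add: m1_def summable_sums)
  show "(\<lambda>k. (2 * real k + 1) * limit_tail (Suc k)) sums m2"
    unfolding m2_def by (intro summable_sums weighted_sum_tendsto(1) summable_odd_weights) auto
  show E1: "(\<lambda>n. measure_pmf.expectation (random_polya_tree n) (\<lambda>t. real (protection_number t))) \<longlonglongrightarrow> m1"
    using expectation_tendsto[of "\<lambda>_. 1"] s by (simp add: m1_def)
  have E2: "(\<lambda>n. measure_pmf.expectation (random_polya_tree n) (\<lambda>t. real (protection_number t) ^ 2)) \<longlonglongrightarrow> m2"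
    using expectation_tendsto[OF _ summable_odd_weights] by (simp add: m2_def sum_odd_eq_square)
  have "eventually (\<lambda>n. measure_pmf.expectation (random_polya_tree n) (\<lambda>t. real (protection_number t) ^ 2)
      - (measure_pmf.expectation (random_polya_tree n) (\<lambda>t. real (protection_number t))) ^ 2
      = measure_pmf.variance (random_polya_tree n) (\<lambda>t. real (protection_number t))) sequentially"
    using eventually_gt_at_top[of 0]
  proof eventually_elim
    case (elim n)
    have "polya_trees n \<noteq> {}" using polya_trees_nonempty[of "n - 1"] elim by simp
    then have "finite (set_pmf (random_polya_tree n))"
      by (simp add: random_polya_tree_def finite_polya_trees)
    then show ?case
      by (intro measure_pmf.variance_eq[symmetric] integrable_measure_pmf_finite)
  qed
  then show "(\<lambda>n. measure_pmf.variance (random_polya_tree n) (\<lambda>t. real (protection_number t))) \<longlonglongrightarrow> m2 - m1 ^ 2"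
    by (rule Lim_transform_eventually[rotated]) (intro tendsto_diff tendsto_power E1 E2)
qed

section \<open>Fixed-point enclosures\<close>

text \<open>The scale is 2^68, so one unit is about 3.4e-21. The final enclosure of the second
  moment is some 44000 units wide, about 1.5e-16.\<close>

definition scl :: int where "scl = 295147905179352825856"

definition rs :: "int \<Rightarrow> real" where "rs a = real_of_int a / real_of_int scl"

lemma scl_pos: "scl > 0" by (simp add: scl_def)

lemma rs_le_iff [simp]: "rs a \<le> rs b \<longleftrightarrow> a \<le> b"
  using scl_pos by (simp add: rs_def divide_le_cancel)

lemma rs_add: "rs (a + b) = rs a + rs b" by (simp add: rs_def add_divide_distrib)
lemma rs_scl [simp]: "rs scl = 1" using scl_pos by (simp add: rs_def)
lemma rs_0 [simp]: "rs 0 = 0" by (simp add: rs_def)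
lemma rs_nonneg: "0 \<le> a \<Longrightarrow> 0 \<le> rs a" using rs_le_iff[of 0 a] by simp
lemma rs_mult_int: "rs (k * a) = real_of_int k * rs a" by (simp add: rs_def)

lemma real_div_le_int: "0 < b \<Longrightarrow> real_of_int a / real_of_int b \<le> real_of_int (a div b + 1)"
  using real_of_int_div3[of a b] by simp

lemma int_le_real_div: "real_of_int (a div b) \<le> real_of_int a / real_of_int b"
  by (rule real_of_int_div4)

definition mul_up :: "int \<Rightarrow> int \<Rightarrow> int" where "mul_up a b = a * b div scl + 1"
definition mul_lo :: "int \<Rightarrow> int \<Rightarrow> int" where "mul_lo a b = a * b div scl"

lemma rs_mul_up: "rs a * rs b \<le> rs (mul_up a b)"
proof -
  have "rs a * rs b = (real_of_int (a * b) / real_of_int scl) / real_of_int scl" by (simp add: rs_def)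
  also have "\<dots> \<le> real_of_int (a * b div scl + 1) / real_of_int scl"
    using scl_pos by (intro divide_right_mono real_div_le_int) auto
  finally show ?thesis by (simp add: rs_def mul_up_def)
qed

lemma rs_mul_lo: "rs (mul_lo a b) \<le> rs a * rs b"
proof -
  have "real_of_int (a * b div scl) / real_of_int scl \<le> (real_of_int (a * b) / real_of_int scl) / real_of_int scl"
    using scl_pos by (intro divide_right_mono int_le_real_div) auto
  then show ?thesis by (simp add: rs_def mul_lo_def)
qed

lemma mul_up_ge: "x \<le> rs a \<Longrightarrow> y \<le> rs b \<Longrightarrow> 0 \<le> x \<Longrightarrow> 0 \<le> y \<Longrightarrow> x * y \<le> rs (mul_up a b)"
  using mult_mono[of x "rs a" y "rs b"] rs_mul_up[of a b] by linarith

lemma mul_lo_le: "rs a \<le> x \<Longrightarrow> rs b \<le> y \<Longrightarrow> 0 \<le> x \<Longrightarrow> 0 \<le> b \<Longrightarrow> rs (mul_lo a b) \<le> x * y"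
  using mult_mono[of "rs a" x "rs b" y] rs_mul_lo[of a b] rs_nonneg[of b] by linarith

lemma rs_div_up: "0 < m \<Longrightarrow> rs a / real_of_int m \<le> rs (a div m + 1)"
proof -
  assume m: "0 < m"
  have "rs a / real_of_int m = (real_of_int a / real_of_int m) / real_of_int scl" by (simp add: rs_def)
  also have "\<dots> \<le> real_of_int (a div m + 1) / real_of_int scl"
    using scl_pos m by (intro divide_right_mono real_div_le_int) auto
  finally show ?thesis by (simp add: rs_def)
qed

lemma rs_div_lo: "rs (a div m) \<le> rs a / real_of_int m"
proof -
  have "real_of_int (a div m) / real_of_int scl \<le> (real_of_int a / real_of_int m) / real_of_int scl"
    using scl_pos by (intro divide_right_mono int_le_real_div) auto
  then show ?thesis by (simp add: rs_def mult.commute)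
qed

text \<open>In both loops, \<open>t\<close> bounds the term with index \<open>n\<close> of the exponential series and \<open>s\<close> the sum
  of the terms with indices \<open>1, \<dots>, n - 1\<close>; \<open>3 ^ (a div scl + 1)\<close> bounds the factor
  \<open>exp (rs a)\<close> in Lagrange's remainder.\<close>
fun exp_loop_up :: "nat \<Rightarrow> int \<Rightarrow> int \<Rightarrow> int \<Rightarrow> int \<Rightarrow> int" where
  "exp_loop_up 0 a n t s = s + t + t * 3 ^ nat (a div scl + 1)"
| "exp_loop_up (Suc f) a n t s =
    (if t \<le> 1 then s + t + t * 3 ^ nat (a div scl + 1)
     else exp_loop_up f a (n + 1) (t * a div (scl * (n + 1)) + 1) (s + t))"

fun exp_loop_lo :: "nat \<Rightarrow> int \<Rightarrow> int \<Rightarrow> int \<Rightarrow> int \<Rightarrow> int" where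
  "exp_loop_lo 0 a n t s = s"
| "exp_loop_lo (Suc f) a n t s =
    (if t \<le> 0 then s else exp_loop_lo f a (n + 1) (t * a div (scl * (n + 1))) (s + t))"

text \<open>The loop starts with the linear term \<open>t = a\<close> and the empty sum. The number
  60 only limits the recursion; the bounds are correct for every value of it.\<close>

definition expm1_up :: "int \<Rightarrow> int" where "expm1_up a = exp_loop_up 60 a 1 a 0"
definition expm1_lo :: "int \<Rightarrow> int" where "expm1_lo a = exp_loop_lo 60 a 1 a 0"

lemma exp_remainder_le:
  fixes x :: real
  assumes "0 \<le> x"
  shows "exp x - 1 \<le> (\<Sum>m=1..n. x ^ m / fact m) + x ^ n / fact n * exp x"
proof -
  obtain t where t: "\<bar>t\<bar> \<le> \<bar>x\<bar>" "exp x = (\<Sum>m<n. x ^ m / fact m) + exp t / fact n * x ^ n"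
    using Maclaurin_exp_le[of x n] by blast
  have "x ^ n / fact n * exp t \<le> x ^ n / fact n * exp x"
    using t(1) assms by (intro mult_left_mono) auto
  then have "exp t / fact n * x ^ n \<le> x ^ n / fact n * exp x" by (simp add: mult.commute)
  \<comment> \<open>Lagrange's form stops before index \<open>n\<close>, whereas the sum
    \<open>s + t\<close> in the loop includes term \<open>n\<close>; adding it only enlarges the
    bound.\<close>
  moreover have "(\<Sum>m<n. x ^ m / fact m) \<le> 1 + (\<Sum>m=1..n. x ^ m / fact m)"
  proof -
    have "(\<Sum>m<n. x ^ m / fact m) \<le> (\<Sum>m\<in>insert 0 {1..n}. x ^ m / fact m)"
      using assms by (intro sum_mono2) auto
    then show ?thesis by simp
  qed
  ultimately show ?thesis using t(2) by linarith
qed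

lemma exp_rs_le: "0 \<le> a \<Longrightarrow> exp (rs a) \<le> 3 ^ nat (a div scl + 1)"
proof -
  assume a: "0 \<le> a"
  have "rs a \<le> real_of_int (a div scl + 1)"
    unfolding rs_def by (rule real_div_le_int[OF scl_pos])
  also have "\<dots> = real (nat (a div scl + 1))"
    using a scl_pos by (simp add: pos_imp_zdiv_nonneg_iff add_nonneg_nonneg)
  finally have "exp (rs a) \<le> exp (real (nat (a div scl + 1)))" by simp
  also have "\<dots> = exp 1 ^ nat (a div scl + 1)" by (simp flip: exp_of_nat_mult)
  also have "\<dots> \<le> 3 ^ nat (a div scl + 1)" by (intro power_mono exp_le) auto
  finally show ?thesis .
qed

lemma exp_loop_up_correct:
  assumes a: "0 \<le> a"
  shows "n > 0 \<Longrightarrow> rs a ^ n / fact n \<le> rs t \<Longrightarrow> (\<Sum>m=1..n. rs a ^ m / fact m) \<le> rs (s + t) \<Longrightarrow>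
    exp (rs a) - 1 \<le> rs (exp_loop_up f a (int n) t s)"
proof (induction f arbitrary: n t s)
  have fin: "exp (rs a) - 1 \<le> rs (s + t + t * 3 ^ nat (a div scl + 1))"
    if "rs a ^ n / fact n \<le> rs t" "(\<Sum>m=1..n. rs a ^ m / fact m) \<le> rs (s + t)" for n t s
  proof -
    have "0 \<le> rs a ^ n / fact n" using rs_nonneg[OF a] by simp
    then have "rs a ^ n / fact n * exp (rs a) \<le> rs t * 3 ^ nat (a div scl + 1)"
      using that(1) exp_rs_le[OF a] by (intro mult_mono) auto
    moreover have "rs (s + t + t * 3 ^ nat (a div scl + 1)) = rs (s + t) + rs t * 3 ^ nat (a div scl + 1)"
      by (simp add: rs_def add_divide_distrib)
    ultimately show ?thesis
      using exp_remainder_le[OF rs_nonneg[OF a], of n] that(2) by linarith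
  qed
  case 0
  show ?case unfolding exp_loop_up.simps by (rule fin[OF 0(2,3)])
  case (Suc f)
  show ?case
  proof (cases "t \<le> 1")
    case True
    then show ?thesis using fin[OF Suc.prems(2,3)] by simp
  next
    case False
    define t' where "t' = t * a div (scl * (int n + 1)) + 1"
    have "rs a ^ Suc n / fact (Suc n) = rs a ^ n / fact n * rs a / real (Suc n)"
      by (simp add: field_simps)
    also have "\<dots> \<le> rs t * rs a / real (Suc n)"
      using Suc.prems rs_nonneg[OF a] by (intro divide_right_mono mult_right_mono) auto
    also have "\<dots> = (real_of_int (t * a) / real_of_int (scl * (int n + 1))) / real_of_int scl"
      by (simp add: rs_def field_simps)
    also have "\<dots> \<le> rs t'"
      unfolding rs_def t'_def using scl_pos by (intro divide_right_mono real_div_le_int) auto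
    finally have 1: "rs a ^ Suc n / fact (Suc n) \<le> rs t'" .
    then have "(\<Sum>m=1..Suc n. rs a ^ m / fact m) \<le> rs (s + t + t')"
      using Suc.prems(3) by (simp add: rs_add)
    from Suc.IH[OF _ 1 this] show ?thesis
      using False by (simp add: Let_def t'_def add.commute)
  qed
qed

lemma expm1_up: "0 \<le> x \<Longrightarrow> x \<le> rs a \<Longrightarrow> exp x - 1 \<le> rs (expm1_up a)"
proof -
  assume x: "0 \<le> x" "x \<le> rs a"
  have "0 \<le> a" using x rs_le_iff[of 0 a] by simp
  then have "exp (rs a) - 1 \<le> rs (expm1_up a)"
    unfolding expm1_up_def using exp_loop_up_correct[of a 1 a 0 60] by simp
  moreover have "exp x \<le> exp (rs a)" using x by simp
  ultimately show ?thesis by linarith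
qed

lemma exp_loop_lo_correct:
  assumes a: "0 \<le> a"
  shows "n > 0 \<Longrightarrow> rs t \<le> rs a ^ n / fact n \<Longrightarrow> rs (s + t) \<le> (\<Sum>m=1..n. rs a ^ m / fact m) \<Longrightarrow> 0 \<le> t \<Longrightarrow> 0 \<le> s \<Longrightarrow>
    rs (exp_loop_lo f a (int n) t s) \<le> exp (rs a) - 1 \<and> 0 \<le> exp_loop_lo f a (int n) t s"
proof (induction f arbitrary: n t s)
  have fin: "rs s \<le> exp (rs a) - 1" if "rs s \<le> (\<Sum>m=1..n. rs a ^ m / fact m)" for n s
  proof -
    have "(\<Sum>m\<in>insert 0 {1..n}. rs a ^ m / fact m) \<le> exp (rs a)"
      unfolding sums_unique[OF fsums_exp] using fsums_exp[of "rs a"] rs_nonneg[OF a]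
      by (intro order_trans[OF _ sum_le_suminf[of _ "insert 0 {1..n}"]]) (auto simp: sums_iff)
    then show ?thesis using that by simp
  qed
  case 0
  have "rs s \<le> rs (s + t)" using 0 by simp
  from fin[OF order_trans[OF this 0(3)]] show ?case using 0 by simp
  case (Suc f)
  show ?case
  proof (cases "t \<le> 0")
    case True
    have "rs s \<le> rs (s + t)" using Suc.prems by simp
    from fin[OF order_trans[OF this Suc.prems(3)]] show ?thesis using True Suc.prems by simp
  next
    case False
    define t' where "t' = t * a div (scl * (int n + 1))"
    have "rs t' \<le> (real_of_int (t * a) / real_of_int (scl * (int n + 1))) / real_of_int scl"
      unfolding rs_def t'_def using scl_pos by (intro divide_right_mono int_le_real_div) auto
    also have "\<dots> = rs t * rs a / real (Suc n)"
      by (simp add: rs_def field_simps)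
    also have "\<dots> \<le> rs a ^ n / fact n * rs a / real (Suc n)"
      using Suc.prems rs_nonneg[OF a] by (intro divide_right_mono mult_right_mono) auto
    also have "\<dots> = rs a ^ Suc n / fact (Suc n)"
      by (simp add: field_simps)
    finally have 1: "rs t' \<le> rs a ^ Suc n / fact (Suc n)" .
    then have 2: "rs (s + t + t') \<le> (\<Sum>m=1..Suc n. rs a ^ m / fact m)"
      using Suc.prems(3) by (simp add: rs_add)
    have 3: "0 \<le> t'" unfolding t'_def using a Suc.prems scl_pos by (simp add: pos_imp_zdiv_nonneg_iff)
    from Suc.IH[OF _ 1 2 3] show ?thesis
      using False Suc.prems 3 by (simp add: Let_def t'_def add.commute)
  qed
qed

lemma expm1_lo: "0 \<le> a \<Longrightarrow> rs a \<le> x \<Longrightarrow> rs (expm1_lo a) \<le> exp x - 1"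
  and expm1_lo_nonneg: "0 \<le> a \<Longrightarrow> 0 \<le> expm1_lo a"
proof -
  assume a: "0 \<le> a"
  then have *: "rs (expm1_lo a) \<le> exp (rs a) - 1 \<and> 0 \<le> expm1_lo a"
    unfolding expm1_lo_def using exp_loop_lo_correct[of a 1 a 0 60] by simp
  then show "0 \<le> expm1_lo a" by blast
  assume "rs a \<le> x"
  then have "exp (rs a) \<le> exp x" by simp
  then show "rs (expm1_lo a) \<le> exp x - 1" using * by linarith
qed

section \<open>Rows of bounds for the values at the powers of \<open>rho\<close>\<close>

fun powers_up :: "int \<Rightarrow> nat \<Rightarrow> int \<Rightarrow> int list" where
  "powers_up X 0 p = []"
| "powers_up X (Suc n) p = p # powers_up X n (mul_up p X)"

fun powers_lo :: "int \<Rightarrow> nat \<Rightarrow> int \<Rightarrow> int list" where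
  "powers_lo X 0 p = []"
| "powers_lo X (Suc n) p = p # powers_lo X n (mul_lo p X)"

lemma length_powers [simp]: "length (powers_up X n p) = n" "length (powers_lo X n p) = n"
  by (induction n arbitrary: p) auto

lemma powers_up:
  assumes "rho \<le> rs X"
  shows "rho ^ Suc i \<le> rs p \<Longrightarrow> j < n \<Longrightarrow> rho ^ (Suc i + j) \<le> rs (powers_up X n p ! j)"
proof (induction n arbitrary: p i j)
  case (Suc n)
  show ?case
  proof (cases j)
    case (Suc j')
    have "rho ^ Suc (Suc i) \<le> rs (mul_up p X)"
      using mul_up_ge[of "rho ^ Suc i" p rho X] Suc.prems assms rho_pos by (simp add: mult.commute)
    from Suc.IH[OF this, of j'] Suc.prems Suc show ?thesis by simp
  qed (use Suc.prems in simp)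
qed simp

lemma powers_lo:
  assumes "rs X \<le> rho" "0 \<le> X"
  shows "rs p \<le> rho ^ Suc i \<Longrightarrow> j < n \<Longrightarrow> rs (powers_lo X n p ! j) \<le> rho ^ (Suc i + j)"
proof (induction n arbitrary: p i j)
  case (Suc n)
  show ?case
  proof (cases j)
    case (Suc j')
    have "rs (mul_lo p X) \<le> rho ^ Suc (Suc i)"
      using mul_lo_le[of p "rho ^ Suc i" X rho] Suc.prems assms rho_pos by (simp add: mult.commute)
    from Suc.IH[OF this, of j'] Suc.prems Suc show ?thesis by simp
  qed (use Suc.prems in simp)
qed simp

text \<open>Entry \<open>j\<close> of a row bounds \<^term>\<open>Tv k (rho ^ Suc j)\<close>; summing every \<open>Suc d\<close>-th entry, divided by
  its multiplier, bounds the leading part of \<^term>\<open>Av k (rho ^ Suc d)\<close>.\<close>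
fun harm :: "int \<Rightarrow> nat \<Rightarrow> nat \<Rightarrow> int \<Rightarrow> int list \<Rightarrow> int" where
  "harm e d i m [] = 0"
| "harm e d 0 m (x # xs) = x div m + e + harm e d d (m + 1) xs"
| "harm e d (Suc i) m (x # xs) = harm e d i m xs"

text \<open>\<open>e = 1\<close> rounds every quotient up, \<open>e = 0\<close> down. The summand
  \<open>last r\<close> bounds the rest of the series, see \<open>Av_le\<close>; on the lower side
  the rest is dropped.\<close>

definition harm_up :: "int list \<Rightarrow> nat \<Rightarrow> int" where "harm_up r d = harm 1 d d 1 r + last r"
definition harm_lo :: "int list \<Rightarrow> nat \<Rightarrow> int" where "harm_lo r d = harm 0 d d 1 r"

lemma harm_eq_sum:
  "harm e d i m r = (\<Sum>q | i + q * Suc d < length r. r ! (i + q * Suc d) div (m + int q) + e)"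
proof (induction e d i m r rule: harm.induct)
  case (2 e d m x xs)
  have "{q. 0 + q * Suc d < length (x # xs)} = insert 0 (Suc ` {q. d + q * Suc d < length xs})"
    (is "?A = insert 0 (Suc ` ?B)")
  proof (rule set_eqI)
    fix q show "q \<in> ?A \<longleftrightarrow> q \<in> insert 0 (Suc ` ?B)" by (cases q) auto
  qed
  moreover have "finite ?B"
  proof (rule finite_subset)
    show "?B \<subseteq> {..length xs}"
    proof
      fix q assume "q \<in> ?B"
      moreover have "q \<le> q * Suc d" by simp
      ultimately show "q \<in> {..length xs}" by auto
    qed
  qed simp
  ultimately have "(\<Sum>q\<in>?A. (x # xs) ! (0 + q * Suc d) div (m + int q) + e)
      = x div m + e + (\<Sum>q\<in>?B. (x # xs) ! (Suc q * Suc d) div (m + int (Suc q)) + e)"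
    by (simp add: sum.reindex)
  also have "\<dots> = x div m + e + (\<Sum>q\<in>?B. xs ! (d + q * Suc d) div (m + 1 + int q) + e)"
    by (simp add: add_ac)
  finally show ?case using 2 by simp
qed simp_all

lemma harm_eq_sum':
  "harm e d d 1 r = (\<Sum>m=1..length r div Suc d. r ! (m * Suc d - 1) div int m + e)"
proof -
  have "{q. d + q * Suc d < length r} = {q. Suc q * Suc d \<le> length r}" by auto
  also have "\<dots> = {q. Suc q \<le> length r div Suc d}" by (simp only: less_eq_div_iff_mult_less_eq zero_less_Suc)
  finally have "harm e d d 1 r = (\<Sum>q | Suc q \<le> length r div Suc d. r ! (d + q * Suc d) div (1 + int q) + e)"
    by (simp only: harm_eq_sum)
  also have "\<dots> = (\<Sum>m=1..length r div Suc d. r ! (m * Suc d - 1) div int m + e)"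
    by (rule sum.reindex_bij_witness[where i = "\<lambda>m. m - 1" and j = Suc]) (auto simp: ac_simps)
  finally show ?thesis .
qed

definition row_up :: "nat \<Rightarrow> int list \<Rightarrow> bool" where
  "row_up k r \<longleftrightarrow> r \<noteq> [] \<and> (\<forall>j<length r. Tv k (rho ^ Suc j) \<le> rs (r ! j))"

definition row_lo :: "nat \<Rightarrow> int list \<Rightarrow> bool" where
  "row_lo k r \<longleftrightarrow> (\<forall>j<length r. 0 \<le> r ! j \<and> rs (r ! j) \<le> Tv k (rho ^ Suc j))"

lemma rs_sum: "rs (sum f A) = (\<Sum>m\<in>A. rs (f m))"
  by (simp add: rs_def sum_divide_distrib)

lemma rho_power_le_rho: "0 < j \<Longrightarrow> rho ^ j \<le> rho"
  using power_decreasing[of 1 j rho] rho_pos rho_less_1 by simp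

lemma Av_sums:
  assumes "0 < j"
  shows "(\<lambda>i. Tv k (rho ^ (Suc i * j)) / real (Suc i)) sums Av k (rho ^ j)"
proof -
  have j: "0 \<le> rho ^ j" "rho ^ j \<le> rho" "rho ^ j < 1"
    using rho_power_le_rho[OF assms] rho_pos rho_less_1 by auto
  have "(\<lambda>i. Tv k ((rho ^ j) ^ Suc i) / real (Suc i)) sums Av k (rho ^ j)"
    unfolding Av_def
    by (intro summable_sums summable_eul_terms summable_Tk_gf fps_nonneg_Tk_gf) (use j in auto)
  then show ?thesis by (simp only: power_mult[symmetric] mult.commute[of j])
qed

lemma Tv_power_nonneg: "0 < j \<Longrightarrow> 0 \<le> Tv k (rho ^ j)"
  using rho_power_le_rho rho_pos by (intro Tv_nonneg) auto

lemma Tv_rho_add_le: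
  assumes "0 < l"
  shows "Tv k (rho ^ (l + i)) \<le> (1/2) ^ i * Tv k (rho ^ l)"
proof -
  have "Tv k (rho ^ l * rho ^ i) \<le> (rho ^ i) ^ 1 * Tv k (rho ^ l)"
    by (rule eval_fps_mult_le[OF summable_Tk_gf fps_nonneg_Tk_gf])
       (use rho_power_le_rho[OF assms] rho_pos rho_less_1 power_le_one[of rho i] in auto)
  also have "(rho ^ i) ^ 1 * Tv k (rho ^ l) \<le> (1/2) ^ i * Tv k (rho ^ l)"
    using rho_le_half rho_pos Tv_power_nonneg[OF assms] by (intro mult_right_mono) (auto intro: power_mono)
  finally show ?thesis by (simp add: power_add)
qed

text \<open>The omitted terms have exponents \<open>m * j > l\<close> that grow by at least 1 from
  term to term. As \<open>rho \<le> 1/2\<close>, they are at most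
  \<open>(1/2) ^ i * Tv k (rho ^ l)\<close> for \<open>i = 1, 2, ...\<close>, which sums to
  \<open>Tv k (rho ^ l)\<close>.\<close>

lemma Av_le:
  assumes "0 < j" "0 < l"
  shows "Av k (rho ^ j) \<le> (\<Sum>m=1..l div j. Tv k (rho ^ (m * j)) / real m) + Tv k (rho ^ l)"
proof -
  let ?f = "\<lambda>i. Tv k (rho ^ (Suc i * j)) / real (Suc i)" and ?q = "l div j"
  have s: "?f sums Av k (rho ^ j)" by (rule Av_sums[OF assms(1)])
  have s1: "(\<lambda>i. ?f (i + ?q)) sums (Av k (rho ^ j) - (\<Sum>i<?q. ?f i))"
    by (rule sums_split_initial_segment[OF s])
  have s2: "(\<lambda>i. (1/2) ^ Suc i * Tv k (rho ^ l)) sums (1 * Tv k (rho ^ l))"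
    by (intro sums_mult2 power_half_series)
  have "?f (i + ?q) \<le> (1/2) ^ Suc i * Tv k (rho ^ l)" for i
  proof -
    let ?m = "Suc (i + ?q)"
    have "l < Suc ?q * j" using dividend_less_div_times[OF assms(1), of l] by simp
    moreover have "i \<le> i * j" using assms(1) by simp
    moreover have "?m * j = Suc ?q * j + i * j" by (simp add: algebra_simps)
    ultimately have "l + Suc i \<le> ?m * j" by linarith
    then obtain d where "?m * j = l + Suc i + d" using le_Suc_ex by blast
    then have d: "?m * j = l + (Suc i + d)" by simp
    have "?f (i + ?q) \<le> Tv k (rho ^ (?m * j)) / 1"
      using Tv_power_nonneg[of "?m * j"] assms by (intro divide_left_mono) auto
    also have "\<dots> \<le> (1/2) ^ (Suc i + d) * Tv k (rho ^ l)"
      unfolding d div_by_1 by (rule Tv_rho_add_le[OF assms(2)])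
    also have "\<dots> \<le> (1/2) ^ Suc i * Tv k (rho ^ l)"
      using Tv_power_nonneg[OF assms(2)] by (intro mult_right_mono power_decreasing) auto
    finally show ?thesis .
  qed
  then have "Av k (rho ^ j) - (\<Sum>i<?q. ?f i) \<le> 1 * Tv k (rho ^ l)"
    by (rule sums_le[OF _ s1 s2])
  moreover have "(\<Sum>i<?q. ?f i) = (\<Sum>m=1..?q. Tv k (rho ^ (m * j)) / real m)"
    by (rule sum.reindex_bij_witness[where i = "\<lambda>m. m - 1" and j = Suc]) auto
  ultimately show ?thesis by simp
qed

lemma Av_ge:
  assumes "0 < j"
  shows "(\<Sum>m=1..q. Tv k (rho ^ (m * j)) / real m) \<le> Av k (rho ^ j)"
proof -
  let ?f = "\<lambda>i. Tv k (rho ^ (Suc i * j)) / real (Suc i)"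
  have "(\<Sum>i<q. ?f i) \<le> Av k (rho ^ j)"
    unfolding sums_unique[OF Av_sums[OF assms, of k]] using Av_sums[OF assms, of k] assms
    by (intro sum_le_suminf) (auto simp: sums_iff intro!: divide_nonneg_nonneg Tv_power_nonneg)
  moreover have "(\<Sum>i<q. ?f i) = (\<Sum>m=1..q. Tv k (rho ^ (m * j)) / real m)"
    by (rule sum.reindex_bij_witness[where i = "\<lambda>m. m - 1" and j = Suc]) auto
  ultimately show ?thesis by simp
qed

lemma harm_index:
  assumes "m \<in> {1..length r div Suc d}"
  shows "m * Suc d - 1 < length r" "Suc (m * Suc d - 1) = m * Suc d"
proof -
  have "m * Suc d \<le> length r"
    using assms by (simp only: atLeastAtMost_iff less_eq_div_iff_mult_less_eq zero_less_Suc)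
  moreover have "0 < m * Suc d" using assms by simp
  ultimately show "m * Suc d - 1 < length r" "Suc (m * Suc d - 1) = m * Suc d" by linarith+
qed

lemma harm_up_ge_sum:
  assumes v: "\<And>m. m \<in> {1..length r div Suc d} \<Longrightarrow> v m \<le> rs (r ! (m * Suc d - 1))" and w: "w \<le> rs (last r)"
  shows "(\<Sum>m=1..length r div Suc d. v m / real m) + w \<le> rs (harm_up r d)"
proof -
  have "(\<Sum>m=1..length r div Suc d. v m / real m) + w
      \<le> (\<Sum>m=1..length r div Suc d. rs (r ! (m * Suc d - 1) div int m + 1)) + rs (last r)"
  proof (intro add_mono sum_mono w)
    fix m assume m: "m \<in> {1..length r div Suc d}"
    have "v m / real m \<le> rs (r ! (m * Suc d - 1)) / real_of_int (int m)"
      using v[OF m] by (simp add: divide_right_mono)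
    also have "\<dots> \<le> rs (r ! (m * Suc d - 1) div int m + 1)" using m by (intro rs_div_up) auto
    finally show "v m / real m \<le> rs (r ! (m * Suc d - 1) div int m + 1)" .
  qed
  also have "\<dots> = rs (harm_up r d)"
    by (simp add: harm_up_def harm_eq_sum' rs_add rs_sum)
  finally show ?thesis .
qed

lemma harm_lo_le_sum:
  assumes v: "\<And>m. m \<in> {1..length r div Suc d} \<Longrightarrow> rs (r ! (m * Suc d - 1)) \<le> v m"
  shows "rs (harm_lo r d) \<le> (\<Sum>m=1..length r div Suc d. v m / real m)"
proof -
  have "rs (harm_lo r d) = (\<Sum>m=1..length r div Suc d. rs (r ! (m * Suc d - 1) div int m))"
    by (simp add: harm_lo_def harm_eq_sum' rs_sum)
  also have "\<dots> \<le> (\<Sum>m=1..length r div Suc d. v m / real m)"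
  proof (rule sum_mono)
    fix m assume m: "m \<in> {1..length r div Suc d}"
    have "rs (r ! (m * Suc d - 1) div int m) \<le> rs (r ! (m * Suc d - 1)) / real_of_int (int m)"
      by (rule rs_div_lo)
    also have "\<dots> \<le> v m / real m"
      using v[OF m] by (simp add: divide_right_mono)
    finally show "rs (r ! (m * Suc d - 1) div int m) \<le> v m / real m" .
  qed
  finally show ?thesis .
qed

lemma harm_lo_nonneg:
  assumes "\<And>j. j < length r \<Longrightarrow> 0 \<le> r ! j"
  shows "0 \<le> harm_lo r d"
  unfolding harm_lo_def harm_eq_sum'
proof (rule sum_nonneg)
  fix m assume m: "m \<in> {1..length r div Suc d}"
  then have "0 < int m" by simp
  then show "0 \<le> r ! (m * Suc d - 1) div int m + 0"
    using assms[OF harm_index(1)[OF m]] pos_imp_zdiv_nonneg_iff by simp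
qed

lemma harm_up_ge:
  assumes "row_up k r"
  shows "Av k (rho ^ Suc d) \<le> rs (harm_up r d)"
proof -
  have r: "r \<noteq> []" "\<And>j. j < length r \<Longrightarrow> Tv k (rho ^ Suc j) \<le> rs (r ! j)"
    using assms by (auto simp: row_up_def)
  have "Av k (rho ^ Suc d) \<le> (\<Sum>m=1..length r div Suc d. Tv k (rho ^ (m * Suc d)) / real m) + Tv k (rho ^ length r)"
    using r by (intro Av_le) auto
  also have "\<dots> \<le> rs (harm_up r d)"
  proof (rule harm_up_ge_sum)
    show "Tv k (rho ^ length r) \<le> rs (last r)"
      using r(2)[of "length r - 1"] r(1) by (simp add: last_conv_nth)
    show "Tv k (rho ^ (m * Suc d)) \<le> rs (r ! (m * Suc d - 1))" if "m \<in> {1..length r div Suc d}" for m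
      using r(2)[OF harm_index(1)[OF that]] unfolding harm_index(2)[OF that] .
  qed
  finally show ?thesis .
qed

lemma harm_lo_le:
  assumes "row_lo k r"
  shows "rs (harm_lo r d) \<le> Av k (rho ^ Suc d)" and "0 \<le> harm_lo r d"
proof -
  have r: "\<And>j. j < length r \<Longrightarrow> 0 \<le> r ! j \<and> rs (r ! j) \<le> Tv k (rho ^ Suc j)"
    using assms by (auto simp: row_lo_def)
  have "rs (harm_lo r d) \<le> (\<Sum>m=1..length r div Suc d. Tv k (rho ^ (m * Suc d)) / real m)"
  proof (rule harm_lo_le_sum)
    show "rs (r ! (m * Suc d - 1)) \<le> Tv k (rho ^ (m * Suc d))" if "m \<in> {1..length r div Suc d}" for m
      using r[OF harm_index(1)[OF that]] unfolding harm_index(2)[OF that] by simp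
  qed
  also have "\<dots> \<le> Av k (rho ^ Suc d)" by (rule Av_ge) simp
  finally show "rs (harm_lo r d) \<le> Av k (rho ^ Suc d)" .
  show "0 \<le> harm_lo r d" using r by (intro harm_lo_nonneg) blast
qed

fun step_up :: "int list \<Rightarrow> nat \<Rightarrow> nat \<Rightarrow> int list \<Rightarrow> int list" where
  "step_up r d 0 xs = []"
| "step_up r d (Suc n) [] = []"
| "step_up r d (Suc n) (x # xs) = mul_up x (expm1_up (harm_up r d)) # step_up r (Suc d) n xs"

fun step_lo :: "int list \<Rightarrow> nat \<Rightarrow> nat \<Rightarrow> int list \<Rightarrow> int list" where
  "step_lo r d 0 xs = []"
| "step_lo r d (Suc n) [] = []"
| "step_lo r d (Suc n) (x # xs) = mul_lo x (expm1_lo (harm_lo r d)) # step_lo r (Suc d) n xs"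

text \<open>A supersolution test for the functional equation of \<open>T\<close> at the powers of
  \<open>rho\<close>. Entry 0 is exempt because \<open>T rho = 1\<close> is known exactly; the bound
  by \<open>scl\<close> keeps the entries in [0, 1], where \<open>u * exp (-u)\<close>
  increases.\<close>

fun cert_up :: "int list \<Rightarrow> int list \<Rightarrow> nat \<Rightarrow> bool" where
  "cert_up U xs 0 \<longleftrightarrow> True"
| "cert_up U xs (Suc j) \<longleftrightarrow> 0 \<le> U ! Suc j \<and> U ! Suc j \<le> scl \<and>
     mul_up (xs ! Suc j) (scl + expm1_up (harm_up U (Suc j))) \<le> U ! Suc j \<and> cert_up U xs j"

fun cert_lo :: "int list \<Rightarrow> int list \<Rightarrow> nat \<Rightarrow> bool" where
  "cert_lo L xs 0 \<longleftrightarrow> True"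
| "cert_lo L xs (Suc j) \<longleftrightarrow> 0 \<le> L ! Suc j \<and> L ! Suc j \<le> scl \<and>
     L ! Suc j \<le> mul_lo (xs ! Suc j) (scl + expm1_lo (harm_lo L (Suc j))) \<and> cert_lo L xs j"

text \<open>The components are \<open>k\<close>, the row for \<open>Tk_gf k\<close>, the bound for
  \<open>limit_tail k\<close>, and the partial sums for the first and the second moment.\<close>

type_synonym state = "int \<times> int list \<times> int \<times> int \<times> int"

text \<open>\<open>k\<close> is the index before the step: \<open>c\<close> bounds
  \<open>limit_tail (k + 1)\<close>, whose weight in the second moment is
  \<open>2 * k + 1\<close>.\<close>

definition add_tail :: "int \<Rightarrow> int list \<Rightarrow> int \<Rightarrow> int \<Rightarrow> int \<Rightarrow> state" where
  "add_tail k r s1 s2 c = (k + 1, r, c, s1 + c, s2 + (2 * k + 1) * c)"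

definition add_row_up :: "int \<Rightarrow> int \<Rightarrow> int \<Rightarrow> int \<Rightarrow> int \<Rightarrow> int list \<Rightarrow> state" where
  "add_row_up X k c s1 s2 r = add_tail k r s1 s2 (mul_up c (hd r + X))"

definition add_row_lo :: "int \<Rightarrow> int \<Rightarrow> int \<Rightarrow> int \<Rightarrow> int \<Rightarrow> int list \<Rightarrow> state" where
  "add_row_lo X k c s1 s2 r = add_tail k r s1 s2 (mul_lo c (hd r + X))"

fun advance_up :: "int \<Rightarrow> int list \<Rightarrow> nat \<Rightarrow> state \<Rightarrow> state" where
  "advance_up X xs n (k, r, c, s1, s2) = add_row_up X k c s1 s2 (step_up r 0 n xs)"

fun advance_lo :: "int \<Rightarrow> int list \<Rightarrow> nat \<Rightarrow> state \<Rightarrow> state" where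
  "advance_lo X xs n (k, r, c, s1, s2) = add_row_lo X k c s1 s2 (step_lo r 0 n xs)"

fun run_up :: "int \<Rightarrow> int list \<Rightarrow> nat list \<Rightarrow> state \<Rightarrow> state" where
  "run_up X xs [] st = st"
| "run_up X xs (n # ns) st = run_up X xs ns (advance_up X xs n st)"

fun run_lo :: "int \<Rightarrow> int list \<Rightarrow> nat list \<Rightarrow> state \<Rightarrow> state" where
  "run_lo X xs [] st = st"
| "run_lo X xs (n # ns) st = run_lo X xs ns (advance_lo X xs n st)"

lemma length_step [simp]: "length (step_up r d n xs) = min n (length xs)" "length (step_lo r d n xs) = min n (length xs)"
  by (induction r d n xs rule: step_up.induct) auto

lemma step_up_nth:
  "j < min n (length xs) \<Longrightarrow> step_up r d n xs ! j = mul_up (xs ! j) (expm1_up (harm_up r (d + j)))"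
proof (induction r d n xs arbitrary: j rule: step_up.induct)
  case (3 r d n x xs)
  then show ?case by (cases j) auto
qed auto

lemma step_lo_nth:
  "j < min n (length xs) \<Longrightarrow> step_lo r d n xs ! j = mul_lo (xs ! j) (expm1_lo (harm_lo r (d + j)))"
proof (induction r d n xs arbitrary: j rule: step_lo.induct)
  case (3 r d n x xs)
  then show ?case by (cases j) auto
qed auto

definition pow_up :: "int list \<Rightarrow> bool" where
  "pow_up xs \<longleftrightarrow> xs \<noteq> [] \<and> (\<forall>j<length xs. rho ^ Suc j \<le> rs (xs ! j))"

definition pow_lo :: "int list \<Rightarrow> bool" where
  "pow_lo xs \<longleftrightarrow> xs \<noteq> [] \<and> (\<forall>j<length xs. 0 \<le> xs ! j \<and> rs (xs ! j) \<le> rho ^ Suc j)"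

lemma rho_power_bounds: "0 \<le> rho ^ Suc j" "rho ^ Suc j \<le> rho"
  using rho_pos rho_power_le_rho[of "Suc j"] by auto

lemma Av_power_nonneg: "0 \<le> Av k (rho ^ Suc j)"
  using Av_ge[of "Suc j" k 0] by simp

lemma Tv_Suc_power: "Tv (Suc k) (rho ^ Suc j) = rho ^ Suc j * (exp (Av k (rho ^ Suc j)) - 1)"
  by (rule Tv_Suc[OF rho_power_bounds])

lemma row_up_step:
  assumes "row_up k r" "pow_up xs" "n > 0"
  shows "row_up (Suc k) (step_up r 0 n xs)"
  unfolding row_up_def
proof (intro conjI allI impI)
  show "step_up r 0 n xs \<noteq> []" using assms by (cases n; cases xs) (auto simp: pow_up_def)
  fix j assume j: "j < length (step_up r 0 n xs)"
  have "rho ^ Suc j * (exp (Av k (rho ^ Suc j)) - 1) \<le> rs (mul_up (xs ! j) (expm1_up (harm_up r j)))"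
  proof (rule mul_up_ge)
    show "rho ^ Suc j \<le> rs (xs ! j)" using assms(2) j by (simp add: pow_up_def)
    show "exp (Av k (rho ^ Suc j)) - 1 \<le> rs (expm1_up (harm_up r j))"
      by (intro expm1_up Av_power_nonneg harm_up_ge assms)
    show "0 \<le> exp (Av k (rho ^ Suc j)) - 1" using Av_power_nonneg[of k j] by simp
  qed (rule rho_power_bounds)
  then show "Tv (Suc k) (rho ^ Suc j) \<le> rs (step_up r 0 n xs ! j)"
    unfolding Tv_Suc_power using step_up_nth[of j n xs r 0] j by simp
qed

lemma row_lo_step:
  assumes "row_lo k r" "pow_lo xs"
  shows "row_lo (Suc k) (step_lo r 0 n xs)"
  unfolding row_lo_def
proof (intro allI impI)
  fix j assume j: "j < length (step_lo r 0 n xs)"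
  have e: "step_lo r 0 n xs ! j = mul_lo (xs ! j) (expm1_lo (harm_lo r j))"
    using step_lo_nth[of j n xs r 0] j by simp
  have x: "0 \<le> xs ! j" "rs (xs ! j) \<le> rho ^ Suc j" using assms(2) j by (auto simp: pow_lo_def)
  have m: "0 \<le> expm1_lo (harm_lo r j)" by (intro expm1_lo_nonneg harm_lo_le[OF assms(1)])
  have "0 \<le> mul_lo (xs ! j) (expm1_lo (harm_lo r j))"
    unfolding mul_lo_def using x m scl_pos pos_imp_zdiv_nonneg_iff by simp
  moreover have "rs (mul_lo (xs ! j) (expm1_lo (harm_lo r j))) \<le> rho ^ Suc j * (exp (Av k (rho ^ Suc j)) - 1)"
    by (intro mul_lo_le x rho_power_bounds m expm1_lo harm_lo_le[OF assms(1)])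
  ultimately show "0 \<le> step_lo r 0 n xs ! j \<and> rs (step_lo r 0 n xs ! j) \<le> Tv (Suc k) (rho ^ Suc j)"
    unfolding e Tv_Suc_power by simp
qed

fun state_up :: "state \<Rightarrow> bool" where
  "state_up (k, r, c, s1, s2) \<longleftrightarrow> (\<exists>K. k = int K \<and> row_up K r \<and> limit_tail K \<le> rs c \<and>
     (\<Sum>i<K. limit_tail (Suc i)) \<le> rs s1 \<and> (\<Sum>i<K. (2 * real i + 1) * limit_tail (Suc i)) \<le> rs s2)"

fun state_lo :: "state \<Rightarrow> bool" where
  "state_lo (k, r, c, s1, s2) \<longleftrightarrow> (\<exists>K. k = int K \<and> row_lo K r \<and> rs c \<le> limit_tail K \<and>
     rs s1 \<le> (\<Sum>i<K. limit_tail (Suc i)) \<and> rs s2 \<le> (\<Sum>i<K. (2 * real i + 1) * limit_tail (Suc i)))"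

lemma state_up_advance:
  assumes st: "state_up st" and X: "rho \<le> rs X" and xs: "pow_up xs" and n: "n > 0"
  shows "state_up (advance_up X xs n st)"
proof -
  obtain k r c s1 s2 where e: "st = (k, r, c, s1, s2)" by (cases st)
  from st obtain K where K: "k = int K" "row_up K r" "limit_tail K \<le> rs c"
    "(\<Sum>i<K. limit_tail (Suc i)) \<le> rs s1" "(\<Sum>i<K. (2 * real i + 1) * limit_tail (Suc i)) \<le> rs s2"
    unfolding e by auto
  define r' where "r' = step_up r 0 n xs"
  have r': "row_up (Suc K) r'" unfolding r'_def by (rule row_up_step[OF K(2) xs n])
  then have "Tv (Suc K) (rho ^ Suc 0) \<le> rs (hd r')" unfolding row_up_def by (metis hd_conv_nth length_greater_0_conv)
  then have "Tv (Suc K) rho + rho \<le> rs (hd r' + X)" using X by (simp add: rs_add)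
  moreover have "0 \<le> Tv (Suc K) rho + rho" using Tv_nonneg[of rho "Suc K"] rho_pos by simp
  ultimately have c: "limit_tail (Suc K) \<le> rs (mul_up c (hd r' + X))"
    unfolding limit_tail_Suc by (intro mul_up_ge K limit_tail_nonneg)
  moreover have "(2 * real K + 1) * limit_tail (Suc K) \<le> rs ((2 * k + 1) * mul_up c (hd r' + X))"
    unfolding rs_mult_int K(1) using c by (simp add: mult_left_mono)
  ultimately show ?thesis
    unfolding e advance_up.simps add_row_up_def add_tail_def r'_def[symmetric] state_up.simps
    by (intro exI[of _ "Suc K"]) (use K r' in \<open>simp add: rs_add\<close>)
qed

lemma state_lo_advance:
  assumes st: "state_lo st" and X: "rs X \<le> rho" "0 \<le> X" and xs: "pow_lo xs" and n: "n > 0"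
  shows "state_lo (advance_lo X xs n st)"
proof -
  obtain k r c s1 s2 where e: "st = (k, r, c, s1, s2)" by (cases st)
  from st obtain K where K: "k = int K" "row_lo K r" "rs c \<le> limit_tail K"
    "rs s1 \<le> (\<Sum>i<K. limit_tail (Suc i))" "rs s2 \<le> (\<Sum>i<K. (2 * real i + 1) * limit_tail (Suc i))"
    unfolding e by auto
  define r' where "r' = step_lo r 0 n xs"
  have r': "row_lo (Suc K) r'" unfolding r'_def by (rule row_lo_step[OF K(2) xs])
  have len: "0 < length r'" unfolding r'_def using n xs by (simp add: pow_lo_def)
  then have "0 \<le> r' ! 0 \<and> rs (r' ! 0) \<le> Tv (Suc K) (rho ^ Suc 0)"
    using r' unfolding row_lo_def by blast
  then have h: "0 \<le> hd r'" "rs (hd r') \<le> Tv (Suc K) rho" using len by (simp_all add: hd_conv_nth)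
  then have "rs (hd r' + X) \<le> Tv (Suc K) rho + rho" using X by (simp add: rs_add)
  then have c: "rs (mul_lo c (hd r' + X)) \<le> limit_tail (Suc K)"
    unfolding limit_tail_Suc by (intro mul_lo_le K limit_tail_nonneg) (use h X in auto)
  moreover have "rs ((2 * k + 1) * mul_lo c (hd r' + X)) \<le> (2 * real K + 1) * limit_tail (Suc K)"
    unfolding rs_mult_int K(1) using c by (simp add: mult_left_mono)
  ultimately show ?thesis
    unfolding e advance_lo.simps add_row_lo_def add_tail_def r'_def[symmetric] state_lo.simps
    by (intro exI[of _ "Suc K"]) (use K r' in \<open>simp add: rs_add\<close>)
qed

lemma state_up_run:
  assumes "rho \<le> rs X" "pow_up xs"
  shows "state_up st \<Longrightarrow> \<forall>n\<in>set ns. n > 0 \<Longrightarrow> state_up (run_up X xs ns st)"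
  by (induction ns arbitrary: st) (simp_all add: state_up_advance[OF _ assms])

lemma state_lo_run:
  assumes "rs X \<le> rho" "0 \<le> X" "pow_lo xs"
  shows "state_lo st \<Longrightarrow> \<forall>n\<in>set ns. n > 0 \<Longrightarrow> state_lo (run_lo X xs ns st)"
  by (induction ns arbitrary: st) (simp_all add: state_lo_advance[OF _ assms])

section \<open>Verification of the guessed row for \<open>T_gf\<close>\<close>

lemma mult_exp_minus_strict_mono:
  fixes a b :: real
  assumes "0 \<le> a" "a < b" "b \<le> 1"
  shows "a * exp (- a) < b * exp (- b)"
proof -
  let ?u = "b - a"
  \<comment> \<open>\<open>(1 - ?u / 2) ^ 2\<close> is a lower bound of \<open>exp (- ?u)\<close>
    for which the comparison is polynomial: the difference is a nonnegative plus a positive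
    term.\<close>
  have "a < b * (1 - ?u / 2) ^ 2"
  proof -
    have "b * (1 - ?u / 2) ^ 2 - a = (1 - b) * ?u + b * (?u / 2) ^ 2" by (simp add: power2_eq_square field_simps)
    moreover have "0 \<le> (1 - b) * ?u" using assms by simp
    moreover have "0 < b * (?u / 2) ^ 2" using assms by simp
    ultimately show ?thesis by linarith
  qed
  also have "\<dots> \<le> b * exp (- ?u / 2) ^ 2"
  proof (intro mult_left_mono power_mono)
    show "1 - ?u / 2 \<le> exp (- ?u / 2)"
      using exp_ge_add_one_self[of "- ?u / 2"] by (simp only: diff_conv_add_uminus minus_divide_left)
  qed (use assms in auto)
  also have "\<dots> = b * exp (- b) * exp a" by (simp flip: exp_of_nat_mult exp_add)
  finally have "a * exp (- a) < b * exp (- b) * exp a * exp (- a)" by (intro mult_strict_right_mono) auto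
  then show ?thesis by (simp add: mult.assoc flip: exp_add)
qed

lemma cert_up_nth:
  "cert_up U xs n \<Longrightarrow> 1 \<le> j \<Longrightarrow> j \<le> n \<Longrightarrow>
     0 \<le> U ! j \<and> U ! j \<le> scl \<and> mul_up (xs ! j) (scl + expm1_up (harm_up U j)) \<le> U ! j"
  by (induction n) (auto simp: le_Suc_eq)

lemma cert_lo_nth:
  "cert_lo L xs n \<Longrightarrow> 1 \<le> j \<Longrightarrow> j \<le> n \<Longrightarrow>
     0 \<le> L ! j \<and> L ! j \<le> scl \<and> L ! j \<le> mul_lo (xs ! j) (scl + expm1_lo (harm_lo L j))"
  by (induction n) (auto simp: le_Suc_eq)

lemma Tv_0_power:
  shows "Tv 0 (rho ^ Suc j) = rho ^ Suc j * exp (Av 0 (rho ^ Suc j))" and "Tv 0 (rho ^ Suc j) \<le> 1"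
proof -
  show "Tv 0 (rho ^ Suc j) = rho ^ Suc j * exp (Av 0 (rho ^ Suc j))"
    by (rule Tv_0[OF rho_power_bounds])
  have "Tv 0 (rho ^ Suc j) \<le> Tv 0 rho"
    by (rule eval_fps_mono[OF summable_Tk_gf fps_nonneg_Tk_gf rho_power_bounds]) (use rho_pos in auto)
  then show "Tv 0 (rho ^ Suc j) \<le> 1" by (simp add: T_rho)
qed

lemma sum_split_first:
  fixes f :: "nat \<Rightarrow> real"
  shows "1 \<le> q \<Longrightarrow> (\<Sum>m=1..q. f m) = f 1 + (\<Sum>m=2..q. f m)"
  by (subst sum.atLeast_Suc_atMost) (auto simp: numeral_2_eq_2)

text \<open>Downward induction on the index: the inequality certified for entry \<open>j\<close> involves the later entries
  and entry \<open>j\<close> itself, and \<open>u * exp (-u)\<close> increases on \<open>[0, 1]\<close>.\<close>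
lemma row_up_cert:
  assumes cert: "cert_up U xs n" and len: "length U = n + 2" "length xs \<ge> n + 1"
    and first: "U ! 0 = scl" and final: "xs ! n \<le> U ! (n + 1)" and xs: "pow_up xs"
  shows "row_up 0 U"
proof -
  have x: "rho ^ Suc j \<le> rs (xs ! j)" if "j \<le> n" for j
    using xs that len by (simp add: pow_up_def)
  \<comment> \<open>The last entry has no later ones to be checked against;
    \<open>T (rho ^ (n + 2)) \<le> rho ^ (n + 1) * T rho\<close> bounds it directly.\<close>
  have last: "Tv 0 (rho ^ (n + 2)) \<le> rs (last U)"
  proof -
    have "Tv 0 (rho ^ Suc (n + 1)) \<le> rho ^ (n + 1) * Tv 0 rho"
      by (rule eval_fps_power_le[OF summable_Tk_gf fps_nonneg_Tk_gf]) (use rho_pos rho_less_1 in auto)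
    also have "\<dots> \<le> rs (xs ! n)" using x[of n] by (simp add: T_rho)
    also have "\<dots> \<le> rs (last U)" using final len by (simp add: last_conv_nth flip: length_0_conv)
    finally show ?thesis by simp
  qed
  have "Tv 0 (rho ^ Suc j) \<le> rs (U ! j)" if "j < n + 2" for j
    using that
  proof (induction "n + 2 - j" arbitrary: j rule: less_induct)
    case less
    consider "j = 0" | "j = n + 1" | "1 \<le> j" "j \<le> n" using less.prems by linarith
    then show ?case
    proof cases
      case 1
      then show ?thesis using first by (simp add: T_rho)
    next
      case 2
      then show ?thesis using last len by (simp add: last_conv_nth flip: length_0_conv)
    next
      case 3
      let ?T = "Tv 0 (rho ^ Suc j)" and ?y = "rs (U ! j)" and ?x = "rho ^ Suc j"
      let ?q = "(n + 2) div Suc j"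
      \<comment> \<open>\<open>R\<close> bounds all of \<open>Av 0 ?x\<close> but its first term
        \<open>?T\<close>. Then \<open>?T \<le> ?x * exp (?T + R)\<close>, while the candidate
        satisfies \<open>?x * exp (?y + R) \<le> ?y\<close>; so \<open>?x * exp R\<close> separates
        the values of \<open>u * exp (-u)\<close> at \<open>?T\<close> and
        \<open>?y\<close>.\<close>
      define R where "R = (\<Sum>m=2..?q. Tv 0 (rho ^ (m * Suc j)) / real m) + Tv 0 (rho ^ (n + 2))"
      have c: "0 \<le> U ! j" "U ! j \<le> scl" "mul_up (xs ! j) (scl + expm1_up (harm_up U j)) \<le> U ! j"
        using cert_up_nth[OF cert 3] by auto
      have q: "1 \<le> ?q" using less.prems by (simp add: Suc_le_eq div_greater_zero_iff)
      have "Av 0 ?x \<le> (\<Sum>m=1..?q. Tv 0 (rho ^ (m * Suc j)) / real m) + Tv 0 (rho ^ (n + 2))"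
        by (rule Av_le) auto
      then have A: "Av 0 ?x \<le> ?T + R"
        unfolding sum_split_first[OF q] R_def by simp
      have R0: "0 \<le> R" unfolding R_def
        by (intro add_nonneg_nonneg sum_nonneg divide_nonneg_nonneg Tv_power_nonneg) auto
      \<comment> \<open>The candidate \<open>?y\<close> stands in for the unknown value at
        \<open>m = 1\<close>; for \<open>m \<ge> 2\<close> the true values are bounded by the
        induction hypothesis.\<close>
      define v where "v m = (if m = 1 then ?y else Tv 0 (rho ^ (m * Suc j)))" for m
      have "(\<Sum>m=1..length U div Suc j. v m / real m) + Tv 0 (rho ^ (n + 2)) \<le> rs (harm_up U j)"
      proof (rule harm_up_ge_sum)
        fix m assume m: "m \<in> {1..length U div Suc j}"
        show "v m \<le> rs (U ! (m * Suc j - 1))"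
        proof (cases "m = 1")
          case False
          then have "j < m * Suc j - 1" using m 3 by (cases m) auto
          then have "Tv 0 (rho ^ Suc (m * Suc j - 1)) \<le> rs (U ! (m * Suc j - 1))"
            using harm_index(1)[OF m] len by (intro less.hyps) auto
          then show ?thesis unfolding harm_index(2)[OF m] using False by (simp add: v_def)
        qed (simp add: v_def)
      qed (rule last)
      moreover have "(\<Sum>m=1..?q. v m / real m) = ?y + (\<Sum>m=2..?q. Tv 0 (rho ^ (m * Suc j)) / real m)"
        unfolding sum_split_first[OF q] by (simp add: v_def)
      ultimately have "?y + R \<le> rs (harm_up U j)" by (simp add: R_def len)
      then have "exp (?y + R) \<le> rs (scl + expm1_up (harm_up U j))"
        using expm1_up[of "?y + R" "harm_up U j"] R0 rs_nonneg[OF c(1)] by (simp add: rs_add)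
      then have "?x * exp (?y + R) \<le> rs (mul_up (xs ! j) (scl + expm1_up (harm_up U j)))"
        using x[OF 3(2)] rho_power_bounds by (intro mul_up_ge) auto
      also have "\<dots> \<le> ?y" using c(3) by simp
      finally have y: "?x * exp R \<le> ?y * exp (- ?y)" by (simp add: exp_add exp_minus field_simps)
      have "?T \<le> ?x * exp (?T + R)"
        unfolding Tv_0_power(1)[of j] using A Tv_0_power(1)[of j] rho_power_bounds by (intro mult_left_mono) auto
      then have T: "?T * exp (- ?T) \<le> ?x * exp R" by (simp add: exp_add exp_minus field_simps)
      show ?thesis
      proof (rule ccontr)
        assume "\<not> ?thesis"
        then have "?y * exp (- ?y) < ?T * exp (- ?T)"
          using rs_nonneg[OF c(1)] Tv_0_power(2) by (intro mult_exp_minus_strict_mono) auto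
        then show False using y T by linarith
      qed
    qed
  qed
  then show ?thesis using len by (auto simp: row_up_def)
qed

text \<open>The mirror image of \<open>row_up_cert\<close>. A lower bound may drop the rest of the
  series, so no separate last entry is supplied and the row has length \<open>n + 1\<close>.\<close>

lemma row_lo_cert:
  assumes cert: "cert_lo L xs n" and len: "length L = n + 1" "length xs \<ge> n + 1"
    and first: "0 \<le> L ! 0" "L ! 0 \<le> scl" and xs: "pow_lo xs"
  shows "row_lo 0 L"
proof -
  have x: "rs (xs ! j) \<le> rho ^ Suc j" if "j \<le> n" for j
    using xs that len by (simp add: pow_lo_def)
  have nn: "0 \<le> L ! j" if "j < n + 1" for j
    using that first cert_lo_nth[OF cert, of j] by (cases "j = 0") auto
  have "rs (L ! j) \<le> Tv 0 (rho ^ Suc j)" if "j < n + 1" for j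
    using that
  proof (induction "n + 1 - j" arbitrary: j rule: less_induct)
    case less
    show ?case
    proof (cases "j = 0")
      case True
      then show ?thesis using first rs_le_iff[of "L ! 0" scl] by (simp add: T_rho)
    next
      case False
      then have 3: "1 \<le> j" "j \<le> n" using less.prems by auto
      let ?T = "Tv 0 (rho ^ Suc j)" and ?y = "rs (L ! j)" and ?x = "rho ^ Suc j"
      let ?q = "(n + 1) div Suc j"
      define R where "R = (\<Sum>m=2..?q. Tv 0 (rho ^ (m * Suc j)) / real m)"
      have c: "0 \<le> L ! j" "L ! j \<le> scl" "L ! j \<le> mul_lo (xs ! j) (scl + expm1_lo (harm_lo L j))"
        using cert_lo_nth[OF cert 3] by auto
      have q: "1 \<le> ?q" using less.prems by (simp add: Suc_le_eq div_greater_zero_iff)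
      have "(\<Sum>m=1..?q. Tv 0 (rho ^ (m * Suc j)) / real m) \<le> Av 0 ?x"
        by (rule Av_ge) auto
      then have A: "?T + R \<le> Av 0 ?x"
        unfolding sum_split_first[OF q] R_def by simp
      define v where "v m = (if m = 1 then ?y else Tv 0 (rho ^ (m * Suc j)))" for m
      have "rs (harm_lo L j) \<le> (\<Sum>m=1..length L div Suc j. v m / real m)"
      proof (rule harm_lo_le_sum)
        fix m assume m: "m \<in> {1..length L div Suc j}"
        show "rs (L ! (m * Suc j - 1)) \<le> v m"
        proof (cases "m = 1")
          case False
          then have "j < m * Suc j - 1" using m 3 by (cases m) auto
          then have "rs (L ! (m * Suc j - 1)) \<le> Tv 0 (rho ^ Suc (m * Suc j - 1))"
            using harm_index(1)[OF m] len by (intro less.hyps) auto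
          then show ?thesis unfolding harm_index(2)[OF m] using False by (simp add: v_def)
        qed (simp add: v_def)
      qed
      moreover have "(\<Sum>m=1..?q. v m / real m) = ?y + R"
        unfolding sum_split_first[OF q] by (simp add: v_def R_def)
      ultimately have h: "rs (harm_lo L j) \<le> ?y + R" by (simp add: len)
      have hn: "0 \<le> harm_lo L j" using nn len by (intro harm_lo_nonneg) auto
      have "rs (scl + expm1_lo (harm_lo L j)) \<le> exp (?y + R)"
        using expm1_lo[OF hn h] by (simp add: rs_add)
      moreover have "0 \<le> scl + expm1_lo (harm_lo L j)" using expm1_lo_nonneg[OF hn] scl_pos by simp
      ultimately have "rs (mul_lo (xs ! j) (scl + expm1_lo (harm_lo L j))) \<le> ?x * exp (?y + R)"
        using x[OF 3(2)] rho_power_bounds by (intro mul_lo_le) auto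
      moreover have "?y \<le> rs (mul_lo (xs ! j) (scl + expm1_lo (harm_lo L j)))" using c(3) by simp
      ultimately have "?y \<le> ?x * exp (?y + R)" by linarith
      then have y: "?y * exp (- ?y) \<le> ?x * exp R" by (simp add: exp_add exp_minus field_simps)
      have "?x * exp (?T + R) \<le> ?x * exp (Av 0 ?x)"
        using A rho_power_bounds by (intro mult_left_mono) auto
      then have "?x * exp (?T + R) \<le> ?T" using Tv_0_power(1)[of j] by simp
      then have T: "?x * exp R \<le> ?T * exp (- ?T)" by (simp add: exp_add exp_minus field_simps)
      show ?thesis
      proof (rule ccontr)
        assume "\<not> ?thesis"
        moreover have "?y \<le> 1" using c(2) rs_le_iff[of "L ! j" scl] by simp
        ultimately have "?T * exp (- ?T) < ?y * exp (- ?y)"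
          using Tv_power_nonneg[of "Suc j" 0] by (intro mult_exp_minus_strict_mono) auto
        then show False using y T by linarith
      qed
    qed
  qed
  then show ?thesis using len nn by (auto simp: row_lo_def)
qed

lemma rho_exp_Av: "rho * exp (Av 0 rho) = 1"
  using Tv_0_power(1)[of 0] by (simp add: T_rho)

text \<open>\<open>T rho = 1\<close> turns the functional equation at \<open>rho\<close> into
  \<open>rho * exp (Av 0 rho) = 1\<close>, so an upper bound for \<open>Av 0 rho\<close> bounds
  \<open>rho\<close> from below.\<close>

lemma rho_ge_of_row:
  assumes "row_up 0 U" "0 \<le> X" "mul_up X (scl + expm1_up (harm_up U 0)) \<le> scl"
  shows "rs X \<le> rho"
proof -
  have A: "0 \<le> Av 0 rho" "Av 0 rho \<le> rs (harm_up U 0)"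
    using Av_power_nonneg[of 0 0] harm_up_ge[OF assms(1), of 0] by simp_all
  have "rs X * exp (Av 0 rho) \<le> rs (mul_up X (scl + expm1_up (harm_up U 0)))"
    using expm1_up[OF A] rs_nonneg[OF assms(2)] by (intro mul_up_ge) (auto simp: rs_add)
  also have "\<dots> \<le> 1" using rs_le_iff[of _ scl] assms(3) by simp
  finally have "rs X * exp (Av 0 rho) \<le> rho * exp (Av 0 rho)" by (simp only: rho_exp_Av)
  then show ?thesis by simp
qed

lemma rho_le_of_row:
  assumes "row_lo 0 L" "0 \<le> X" "scl \<le> mul_lo X (scl + expm1_lo (harm_lo L 0))"
  shows "rho \<le> rs X"
proof -
  have A: "0 \<le> harm_lo L 0" "rs (harm_lo L 0) \<le> Av 0 rho"
    using harm_lo_le[OF assms(1), of 0] by simp_all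
  have "1 \<le> rs (mul_lo X (scl + expm1_lo (harm_lo L 0)))" using rs_le_iff[of scl] assms(3) by simp
  also have "\<dots> \<le> rs X * exp (Av 0 rho)"
    using expm1_lo[OF A] expm1_lo_nonneg[OF A(1)] scl_pos rs_nonneg[OF assms(2)]
    by (intro mul_lo_le) (auto simp: rs_add)
  finally have "rho * exp (Av 0 rho) \<le> rs X * exp (Av 0 rho)" by (simp only: rho_exp_Av)
  then show ?thesis by simp
qed

section \<open>Numerical data and their evaluation\<close>

definition rho_lo :: int where "rho_lo = 99854987340189928456"
definition rho_up :: int where "rho_up = 99854987340189928504"

text \<open>Entry \<open>j\<close> is a guess for \<open>T (rho ^ Suc j)\<close>, justified only by
  the certificate; entry 0 is the exact value 1. With 48 entries the last power
  \<open>rho ^ 48\<close> is below one unit.\<close>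

definition T_cert_up :: "int list" where
  "T_cert_up =
     [295147905179352825856, 38808374358438644087, 11909366492901093655, 3918898247832096519,
     1314098408363574357, 443274535826729868, 149820279943997364, 50670444813560516,
     17140971391615910, 5798942413891629, 1961883459628050, 663745135735649, 224559152680643,
     75973231271495, 25703400300581, 8696021617224, 2942054123820, 995361207704, 336752451326,
     113930714562, 38545250900, 13040700859, 4411954131, 1492660515, 504999678, 170852430, 57803113,
     19556058, 6616243, 2238421, 757308, 256215, 86684, 29328, 9923, 3358, 1137, 386, 132, 46, 17,
     7, 4, 3, 2, 2, 2, 1]"

definition T_cert_lo :: "int list" where
  "T_cert_lo =
     [295147905179352825856, 38808374358438644035, 11909366492901093633, 3918898247832096508,
     1314098408363574351, 443274535826729865, 149820279943997361, 50670444813560513,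
     17140971391615907, 5798942413891626, 1961883459628047, 663745135735646, 224559152680640,
     75973231271493, 25703400300579, 8696021617222, 2942054123817, 995361207702, 336752451323,
     113930714560, 38545250898, 13040700856, 4411954128, 1492660513, 504999676, 170852428, 57803110,
     19556055, 6616240, 2238418, 757305, 256212, 86682, 29326, 9921, 3356, 1135, 383, 129, 43, 14,
     4, 1, 0, 0, 0, 0, 0]"

text \<open>Row \<open>k\<close> needs only about \<open>48 / (k + 1)\<close> entries: the next ones are below the resolution.\<close>
definition row_lengths :: "nat list" where
  "row_lengths =
     [24, 16, 12, 10, 8, 7, 6, 6, 5, 5, 4, 4, 4, 4, 3, 3, 3, 3, 3, 3, 3, 3, 2, 2, 2, 2, 2, 2, 2, 2,
     2, 2, 2, 2, 2, 2, 2, 2, 2, 2]"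

definition powers_rho_up :: "int list" where "powers_rho_up = powers_up rho_up 48 rho_up"
definition powers_rho_lo :: "int list" where "powers_rho_lo = powers_lo rho_lo 48 rho_lo"

lemma T_cert_up_valid: "cert_up T_cert_up powers_rho_up 46"
  by code_simp

lemma T_cert_lo_valid: "cert_lo T_cert_lo powers_rho_lo 47"
  by code_simp

text \<open>After 40 rows the bound for \<open>limit_tail\<close> has dropped to 431 units, so a
  crude estimate of the rest of both series suffices in \<open>moment_bounds\<close>.\<close>

lemma run_up_eq: "run_up rho_up powers_rho_up row_lengths (0, T_cert_up, scl, 0, 0) =
    (40, [168, 1], 431, 636011172575711266470, 1774884476269640772378)"
  by code_simp

lemma run_lo_eq: "run_lo rho_lo powers_rho_lo row_lengths (0, T_cert_lo, scl, 0, 0) =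
    (40, [163, 0], 429, 636011172575711265154, 1774884476269640764374)"
  by code_simp

lemma rho_check_up: "mul_up rho_lo (scl + expm1_up (harm_up T_cert_up 0)) \<le> scl"
  by code_simp

lemma rho_check_lo: "scl \<le> mul_lo rho_up (scl + expm1_lo (harm_lo T_cert_lo 0))"
  by code_simp

text \<open>Entry 47 of the row stands for \<open>T (rho ^ 48) \<le> rho ^ 47\<close>, and entry 46
  of the powers bounds \<open>rho ^ 47\<close>; hence the upper certificate stops at entry
  46.\<close>

lemma powers_rho_up_46: "powers_rho_up ! 46 \<le> T_cert_up ! 47"
  by code_simp

lemma pow_up_rho: "rho \<le> rs rho_up \<Longrightarrow> pow_up powers_rho_up"
  using powers_up[of rho_up 0 rho_up _ 48]
  by (auto simp: pow_up_def powers_rho_up_def simp flip: length_greater_0_conv)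

lemma powers_lo_nonneg: "0 \<le> X \<Longrightarrow> 0 \<le> p \<Longrightarrow> j < n \<Longrightarrow> 0 \<le> powers_lo X n p ! j"
proof (induction n arbitrary: p j)
  case (Suc n)
  have "0 \<le> mul_lo p X" using Suc.prems scl_pos pos_imp_zdiv_nonneg_iff by (simp add: mul_lo_def)
  then show ?case using Suc by (cases j) auto
qed simp

lemma rho_lo_nonneg: "0 \<le> rho_lo" and rho_up_nonneg: "0 \<le> rho_up" and rho_lo_le_up: "rho_lo \<le> rho_up"
  by (simp_all add: rho_lo_def rho_up_def)

lemma pow_lo_rho: "rs rho_lo \<le> rho \<Longrightarrow> pow_lo powers_rho_lo"
  using powers_lo[of rho_lo rho_lo 0 _ 48] powers_lo_nonneg[of rho_lo rho_lo _ 48] rho_lo_nonneg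
  by (auto simp: pow_lo_def powers_rho_lo_def simp flip: length_greater_0_conv)

lemma row_up_T_cert: "rho \<le> rs rho_up \<Longrightarrow> row_up 0 T_cert_up"
  using powers_rho_up_46
  by (intro row_up_cert[OF T_cert_up_valid] pow_up_rho)
     (simp_all add: powers_rho_up_def, simp_all add: T_cert_up_def scl_def)

lemma row_lo_T_cert: "rs rho_lo \<le> rho \<Longrightarrow> row_lo 0 T_cert_lo"
  by (intro row_lo_cert[OF T_cert_lo_valid] pow_lo_rho)
     (simp_all add: powers_rho_lo_def, simp_all add: T_cert_lo_def scl_def)

text \<open>Each of the two bounds is derived from the other one; at least one of them holds because
  \<^term>\<open>rho_lo \<le> rho_up\<close>.\<close>
lemma rho_bounds: "rs rho_lo \<le> rho" "rho \<le> rs rho_up"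
proof -
  have lo: "rs rho_lo \<le> rho" if "rho \<le> rs rho_up"
    using rho_ge_of_row[OF row_up_T_cert[OF that] rho_lo_nonneg rho_check_up] .
  have up: "rho \<le> rs rho_up" if "rs rho_lo \<le> rho"
    using rho_le_of_row[OF row_lo_T_cert[OF that] rho_up_nonneg rho_check_lo] .
  have "rs rho_lo \<le> rs rho_up" using rho_lo_le_up by simp
  then have "rs rho_lo \<le> rho \<or> rho \<le> rs rho_up" by linarith
  then show "rs rho_lo \<le> rho" "rho \<le> rs rho_up" using lo up by blast+
qed

lemma row_lengths_pos: "\<forall>n\<in>set row_lengths. n > 0"
  by (simp add: row_lengths_def)

lemma state_up_final: "state_up (40, [168, 1], 431, 636011172575711266470, 1774884476269640772378)"
  unfolding run_up_eq[symmetric]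
  using row_up_T_cert rho_bounds
  by (intro state_up_run[OF rho_bounds(2) pow_up_rho[OF rho_bounds(2)] _ row_lengths_pos])
     (simp add: exI[of _ "0::nat"])

lemma state_lo_final: "state_lo (40, [163, 0], 429, 636011172575711265154, 1774884476269640764374)"
  unfolding run_lo_eq[symmetric]
  using row_lo_T_cert rho_bounds
  by (intro state_lo_run[OF rho_bounds(1) rho_lo_nonneg pow_lo_rho[OF rho_bounds(1)] _ row_lengths_pos])
     (simp add: exI[of _ "0::nat"])

lemma limit_tail_geometric:
  assumes "Tv K rho + rho \<le> 1/2"
  shows "limit_tail (K + i) \<le> (1/2) ^ i * limit_tail K"
proof (induction i)
  case (Suc i)
  have "Tv (Suc (K + i)) rho + rho \<le> 1/2"
    using Tv_antimono[of K "Suc (K + i)" rho] rho_pos assms by simp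
  moreover have "0 \<le> Tv (Suc (K + i)) rho + rho" using Tv_nonneg[of rho "Suc (K + i)"] rho_pos by simp
  ultimately have "limit_tail (K + i) * (Tv (Suc (K + i)) rho + rho) \<le> ((1/2) ^ i * limit_tail K) * (1/2)"
    using Suc limit_tail_nonneg by (intro mult_mono) auto
  then show ?case by (simp add: limit_tail_Suc)
qed simp

lemma sums_le_initial:
  fixes f g :: "nat \<Rightarrow> real"
  assumes "f sums m" "\<And>i. f (i + K) \<le> g i" "g sums t"
  shows "m \<le> (\<Sum>i<K. f i) + t"
  using sums_le[OF assms(2) sums_split_initial_segment[OF assms(1)] assms(3)] by simp

lemma sums_ge_initial:
  fixes f :: "nat \<Rightarrow> real"
  assumes "f sums m" "\<And>i. 0 \<le> f i"
  shows "(\<Sum>i<K. f i) \<le> m"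
  using sum_le_suminf[of f "{..<K}"] assms by (auto simp: sums_iff)

lemma moment_bounds:
  fixes m1 m2 :: real
  assumes m1: "(\<lambda>k. limit_tail (Suc k)) sums m1"
    and m2: "(\<lambda>k. (2 * real k + 1) * limit_tail (Suc k)) sums m2"
  shows "rs 636011172575711265154 \<le> m1" "m1 \<le> rs 636011172575711266901"
    "rs 1774884476269640764374 \<le> m2" "m2 \<le> rs 1774884476269640808151"
proof -
  have lo: "rs 636011172575711265154 \<le> (\<Sum>i<40. limit_tail (Suc i))"
      "rs 1774884476269640764374 \<le> (\<Sum>i<40. (2 * real i + 1) * limit_tail (Suc i))"
  proof -
    obtain K where K: "(40::int) = int K" "rs 636011172575711265154 \<le> (\<Sum>i<K. limit_tail (Suc i))"
        "rs 1774884476269640764374 \<le> (\<Sum>i<K. (2 * real i + 1) * limit_tail (Suc i))"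
      using state_lo_final unfolding state_lo.simps by (elim exE conjE)
    have "K = 40" using K(1) by simp
    then show "rs 636011172575711265154 \<le> (\<Sum>i<40. limit_tail (Suc i))"
      "rs 1774884476269640764374 \<le> (\<Sum>i<40. (2 * real i + 1) * limit_tail (Suc i))"
      using K(2,3) by simp_all
  qed
  have "(\<exists>K. (40::int) = int K \<and> row_up K [168, 1] \<and> limit_tail K \<le> rs 431 \<and>
     (\<Sum>i<K. limit_tail (Suc i)) \<le> rs 636011172575711266470 \<and> (\<Sum>i<K. (2 * real i + 1) * limit_tail (Suc i)) \<le> rs 1774884476269640772378)"
    using state_up_final unfolding state_up.simps .
  then obtain K where K: "(40::int) = int K" "row_up K [168, 1]" "limit_tail K \<le> rs 431"
     "(\<Sum>i<K. limit_tail (Suc i)) \<le> rs 636011172575711266470" "(\<Sum>i<K. (2 * real i + 1) * limit_tail (Suc i)) \<le> rs 1774884476269640772378"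
    by blast
  have K40: "K = 40" using K(1) by simp
  have nn: "0 \<le> limit_tail i" for i by (rule limit_tail_nonneg)
  have "Tv 40 rho \<le> rs 168"
    using K(2) unfolding row_up_def K40 by (auto dest!: spec[of _ 0])
  then have "Tv 40 rho + rho \<le> rs 168 + rs rho_up" using rho_bounds(2) by linarith
  also have "\<dots> \<le> 1/2" by (simp add: rs_def scl_def rho_up_def)
  finally have half: "Tv 40 rho + rho \<le> 1/2" .
  \<comment> \<open>From index 40 on every factor of \<open>limit_tail\<close> is at most 1/2, since
    \<open>Tv\<close> decreases in \<open>k\<close>.\<close>
  have t: "limit_tail (Suc (i + 40)) \<le> (1/2) ^ Suc i * rs 431" for i
  proof -
    have "limit_tail (40 + Suc i) \<le> (1/2) ^ Suc i * limit_tail 40" by (rule limit_tail_geometric[OF half])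
    also have "\<dots> \<le> (1/2) ^ Suc i * rs 431" using K(3) unfolding K40 by (intro mult_left_mono) auto
    finally show ?thesis by (simp add: add.commute)
  qed
  have "m1 \<le> (\<Sum>i<40. limit_tail (Suc i)) + 1 * rs 431"
    by (rule sums_le_initial[OF m1 t]) (intro sums_mult2 power_half_series)
  also have "\<dots> \<le> rs 636011172575711266470 + rs 431" using K(4) unfolding K40 by simp
  finally show "m1 \<le> rs 636011172575711266901" by (simp flip: rs_add)
  \<comment> \<open>83 arises from \<open>2 * (i + 40) + 1 = 2 * (i + 1) + 79\<close>: the sums of
    \<open>(i + 1) / 2 ^ i\<close> and of \<open>1 / 2 ^ (i + 1)\<close> are 4 and 1.\<close>
  have s: "(\<lambda>i. (2 * real (i + 40) + 1) * ((1/2) ^ Suc i * rs 431)) sums (83 * rs 431)"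
  proof -
    have "(\<lambda>i. of_nat (Suc i) * (1/2 :: real) ^ i + 79 * (1/2) ^ Suc i) sums (1 / (1 - 1/2) ^ 2 + 79 * 1)"
      by (intro sums_add sums_mult power_half_series geometric_deriv_sums) simp
    note * = sums_mult2[OF this, of "rs 431"]
    have e: "(of_nat (Suc i) * (1/2) ^ i + 79 * (1/2) ^ Suc i) * rs 431
        = (2 * real (i + 40) + 1) * ((1/2) ^ Suc i * rs 431)" for i
      by (simp add: algebra_simps)
    have v: "1 / (1 - 1/2) ^ 2 + 79 * 1 = (83 :: real)" by (simp add: power2_eq_square)
    show ?thesis using * unfolding e v .
  qed
  have "m2 \<le> (\<Sum>i<40. (2 * real i + 1) * limit_tail (Suc i)) + 83 * rs 431"
    by (rule sums_le_initial[OF m2 _ s]) (intro mult_left_mono t, simp)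
  also have "\<dots> \<le> rs 1774884476269640772378 + 83 * rs 431" using K(5) unfolding K40 by simp
  also have "\<dots> = rs 1774884476269640808151" by (simp add: rs_def)
  finally show "m2 \<le> rs 1774884476269640808151" .
  show "rs 636011172575711265154 \<le> m1" using lo(1) sums_ge_initial[OF m1, of 40] nn by simp
  show "rs 1774884476269640764374 \<le> m2" using lo(2) sums_ge_initial[OF m2, of 40] nn by simp
qed

text \<open>\<open>5 / 10 ^ 16\<close> is half a unit in the last of the fifteen decimals. The shift
  to \<open>Suc k\<close> lets the series start with the product for \<open>k = 1\<close>.\<close>

theorem theorem3:
  shows "\<exists>\<mu> v :: real.
           (\<lambda>k. \<Prod>i = 1..Suc k. (eval_fps (Tk_gf i) rho + rho)) sums \<mu>
         \<and> (\<lambda>n. measure_pmf.expectation (random_polya_tree n)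
                  (\<lambda>t. real (protection_number t))) \<longlonglongrightarrow> \<mu>
         \<and> \<bar>\<mu> - 2.154889671973873\<bar> < 5 / 10 ^ 16
         \<and> (\<lambda>n. measure_pmf.variance (random_polya_tree n)
                  (\<lambda>t. real (protection_number t))) \<longlonglongrightarrow> v
         \<and> \<bar>v - 1.369993017502652\<bar> < 5 / 10 ^ 16"
proof (intro exI conjI)
  define m1 where "m1 = (\<Sum>k. limit_tail (Suc k))"
  define m2 where "m2 = (\<Sum>k. (2 * real k + 1) * limit_tail (Suc k))"
  note lim = protection_number_limits[folded m1_def m2_def]
  note b = moment_bounds[OF lim(1,2)]
  show "(\<lambda>k. \<Prod>i = 1..Suc k. (eval_fps (Tk_gf i) rho + rho)) sums m1"
    using lim(1) by (simp only: limit_tail_def)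
  show "(\<lambda>n. measure_pmf.expectation (random_polya_tree n) (\<lambda>t. real (protection_number t))) \<longlonglongrightarrow> m1"
    by (rule lim(3))
  show "(\<lambda>n. measure_pmf.variance (random_polya_tree n) (\<lambda>t. real (protection_number t))) \<longlonglongrightarrow> m2 - m1 ^ 2"
    by (rule lim(4))
  show "\<bar>m1 - 2.154889671973873\<bar> < 5 / 10 ^ 16"
    using b(1,2) by (simp add: rs_def scl_def abs_less_iff)
  have sq: "(rs 636011172575711265154) ^ 2 \<le> m1 ^ 2" "m1 ^ 2 \<le> (rs 636011172575711266901) ^ 2"
  proof -
    have "0 \<le> rs 636011172575711265154" by (intro rs_nonneg) simp
    then show "(rs 636011172575711265154) ^ 2 \<le> m1 ^ 2" "m1 ^ 2 \<le> (rs 636011172575711266901) ^ 2"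
      using b(1,2) by (intro power_mono; linarith)+
  qed
  \<comment> \<open>Opposite ends of the two enclosures are combined, since \<open>m1 ^ 2\<close> is
    subtracted.\<close>
  have "m2 - m1 ^ 2 \<le> rs 1774884476269640808151 - (rs 636011172575711265154) ^ 2" "rs 1774884476269640764374 - (rs 636011172575711266901) ^ 2 \<le> m2 - m1 ^ 2"
    using b(3,4) sq by linarith+
  moreover have "rs 1774884476269640808151 - (rs 636011172575711265154) ^ 2 < 1.369993017502652 + 5 / 10 ^ 16"
    "1.369993017502652 - 5 / 10 ^ 16 < rs 1774884476269640764374 - (rs 636011172575711266901) ^ 2"
    by (simp_all add: rs_def scl_def power_divide field_simps)
  ultimately show "\<bar>m2 - m1 ^ 2 - 1.369993017502652\<bar> < 5 / 10 ^ 16"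
    unfolding abs_less_iff by linarith
qed

end
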